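(* Let $\mathbb{N}=\{0,1,2,\ldots\}$, $\mathbb{Z}^+=\{1,2,3,\ldots\}$ and $p_8(x)=x(3x-2)$ for $x\in\mathbb{Z}$. (i) An integer $n\in\mathbb{N}$ can be written as $p_8(x)+p_8(y)+2p_8(z)$ with $x,y,z\in\mathbb{Z}$ if and only if $n$ does not belong to the set $$\left\{4^{k+2}q-\tfrac{2}{3}(4^k+2):\ k\in\mathbb{N},\ q\in\mathbb{Z}^+\right\}.$$ Also, every nonnegative even integer can be written as $p_8(x)+2p_8(y)+4p_8(z)$ with $x,y,z\in\mathbb{Z}$. Consequently, $$\left\{p_8(x)+\left\lfloor\frac{p_8(y)}2\right\rfloor+\left\lfloor\frac{p_8(z)}2\right\rfloor:\ x,y,z\in\mathbb{Z}\right\}=\mathbb{N}\quad\text{and}\quad\left\{\left\lfloor\frac{x^2}3\right\rfloor+\left\lfloor\frac{y^2}6\right\rfloor+\left\lfloor\frac{z^2}6\right\rfloor:\ x,y,z\in\mathbb{Z}\right\}=\mathbb{N}.$$ (ii) $\{p_8(x)+p_8(y)+\lfloor p_8(z)/2\rfloor:\ x,y,z\in\mathbb{Z}\}=\mathbb{N}$; hence $\{p_8(x)+p_8(y)+\lfloor p_8(z)/8\rfloor:\ x,y,z\in\mathbb{Z}\}=\mathbb{N}$ and $\{\lfloor x^2/3\rfloor+\lfloor y^2/3\rfloor+\lfloor z^2/6\rfloor:\ x,y,z\in\mathbb{Z}\}=\mathbb{N}$. (iii) For every $n\in\mathbb{N}$ there are $x,y,z\in\mathbb{Z}$ such that $n=p_8(x)+p_8(y)+\frac{p_8(z)}{4}$.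 (iv) $\{p_8(x)+p_8(y)+\lfloor p_8(z)/5\rfloor:\ x,y,z\in\mathbb{Z}\}=\mathbb{N}$, and hence $\{\lfloor x^2/3\rfloor+\lfloor y^2/3\rfloor+\lfloor z^2/15\rfloor:\ x,y,z\in\mathbb{Z}\}=\mathbb{N}$.
   Context: $\lfloor\cdot\rfloor$ denotes the floor function. *)

theory Defs
  imports Complex_Main
begin

text \<open>Generalized octagonal numbers: the argument ranges over all integers.\<close>

definition p8 :: "int \<Rightarrow> int" where
  "p8 x = x * (3 * x - 2)"

end

theory Submission
  imports Defs "HOL-Number_Theory.Number_Theory" "HOL-Computational_Algebra.Squarefree"
begin

text \<open>
  Since \<open>3 p\<^sub>8(x) + 1 = (3x - 1)\<^sup>2\<close>, every claim reduces to representing a number in a residue class by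
  one of the forms \<open>x\<^sup>2 + y\<^sup>2 + 2z\<^sup>2\<close>, \<open>x\<^sup>2 + 2y\<^sup>2 + 2z\<^sup>2\<close>, \<open>x\<^sup>2 + 4y\<^sup>2 + 4z\<^sup>2\<close>, \<open>x\<^sup>2 + 5y\<^sup>2 + 5z\<^sup>2\<close>
  with all variables prime to 3. Without the last condition this is the theorem of Legendre and
  Gauss on sums of three squares, applied to a multiple of the number. A representation in which
  two variables are divisible by 3 is repaired through \<open>9 = 1 + 2 \<cdot> 2\<^sup>2 = 2\<^sup>2 + 5 \<cdot> 1\<^sup>2\<close>; when these two
  variables vanish, the number is a square \<open>X\<^sup>2\<close>, and a second representation of \<open>X\<^sup>2\<close> comes from
  writing \<open>X\<close> as the reduced norm of a quaternion.

  For the three-squares theorem it suffices, by Davenport and Cassels, to find rational squares. For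
  squarefree \<open>n\<close> these come from solving \<open>n w\<^sup>2 = z\<^sup>2 + a u\<^sup>2\<close> and \<open>a v\<^sup>2 = c\<^sup>2 + d\<^sup>2\<close> by the pigeonhole
  principle, where \<open>a\<close> is \<open>q\<close> or \<open>2 q\<close> for a prime \<open>q\<close> with prescribed quadratic characters. Such a \<open>q\<close>
  exists by Dirichlet's method, which needs only real characters here: \<open>L(1, f) \<noteq> 0\<close> follows from
  Monsky's argument and makes \<open>\<Sum> f(d) \<Lambda>(d) / d\<close> bounded.
\<close>

section \<open>Real characters\<close>

text \<open>Real characters modulo M cannot tell a from a * b^2 for b prime to M, but nothing finer
  is required: the auxiliary prime q enters only through Legendre symbols and its residue mod 8, and
  odd squares are 1 mod 8. Twisting by f(N) and summing over all real f leaves only prime powers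
  that agree with N under every f. Without a prime among them these would all be even powers, whose
  sum is bounded, whereas the principal character alone contributes ln n. The exceptional numbers
  shape the second half. A floor helps to avoid them: n = p8(x) + p8(y) + floor(p8(z) / k) asks for
  a representation of 3 k n + 3 r + 2 k + 1 for just one remainder r < k, and r is chosen so that
  the three-squares theorem applies. Squares are the other obstacle: 1 has only trivial
  representations by x^2 + y^2 + 2 z^2, as have 4 and 16 by x^2 + y^2 + 5 z^2, which explains the
  lower bounds and the parity conditions there.\<close>

definition real_char :: "nat \<Rightarrow> (nat \<Rightarrow> real) \<Rightarrow> bool" where
  "real_char M f \<longleftrightarrow>
     (\<forall>a b. f (a * b) = f a * f b) \<and> (\<forall>a. f (a + M) = f a) \<and>
     (\<forall>a. f a \<in> (if coprime a M then {1, -1} else {0}))"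

lemma real_char_mult: "real_char M f \<Longrightarrow> f (a * b) = f a * f b"
  by (simp add: real_char_def)

lemma real_char_period: "real_char M f \<Longrightarrow> f (a + M) = f a"
  by (simp add: real_char_def)

lemma real_char_period_mult: "real_char M f \<Longrightarrow> f (a + k * M) = f a"
proof (induction k)
  case (Suc k)
  have "f (a + Suc k * M) = f ((a + k * M) + M)" by (simp add: algebra_simps)
  with Suc show ?case using real_char_period by metis
qed simp

lemma real_char_mod: "real_char M f \<Longrightarrow> f (a mod M) = f a"
  using real_char_period_mult[of M f "a mod M" "a div M"] by simp

lemma real_char_coprime: "real_char M f \<Longrightarrow> coprime a M \<Longrightarrow> f a = 1 \<or> f a = -1"
  unfolding real_char_def by (metis insertE singletonD)

lemma real_char_eq_0: "real_char M f \<Longrightarrow> \<not> coprime a M \<Longrightarrow> f a = 0"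
  unfolding real_char_def by (metis singletonD)

lemma real_char_cases: "real_char M f \<Longrightarrow> f a = 1 \<or> f a = -1 \<or> f a = 0"
  using real_char_coprime real_char_eq_0 by blast

lemma real_char_abs_le: "real_char M f \<Longrightarrow> \<bar>f a\<bar> \<le> 1"
  using real_char_cases[of M f a] by auto

lemma real_char_1: "real_char M f \<Longrightarrow> f 1 = 1"
  using real_char_coprime[of M f 1] real_char_mult[of M f 1 1] by auto

lemma real_char_power: "real_char M f \<Longrightarrow> f (a ^ k) = f a ^ k"
  by (induction k) (auto simp: real_char_mult real_char_1[simplified])

text \<open>Multiplication by c permutes the residues modulo M and f(c) = -1, so the sum equals its
  own negative. A witness c with \<open>f c \<noteq> 1\<close> is how non-principality is stated
  throughout.\<close>

lemma real_char_sum_period: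
  assumes f: "real_char M f" and M: "M > 0" and c: "coprime c M" "f c \<noteq> 1"
  shows "(\<Sum>a<M. f a) = 0"
proof -
  have fc: "f c = -1" using real_char_coprime[OF f c(1)] c(2) by auto
  have inj: "inj_on (\<lambda>a. c * a mod M) {..<M}"
  proof (rule inj_onI)
    fix x y assume "x \<in> {..<M}" "y \<in> {..<M}" "c * x mod M = c * y mod M"
    then have "[c * x = c * y] (mod M)" by (simp add: cong_def)
    then have "[x = y] (mod M)" using c(1) cong_mult_lcancel_nat by blast
    then show "x = y" using \<open>x \<in> {..<M}\<close> \<open>y \<in> {..<M}\<close> by (simp add: cong_def)
  qed
  moreover have "(\<lambda>a. c * a mod M) ` {..<M} \<subseteq> {..<M}" using M by auto
  ultimately have img: "(\<lambda>a. c * a mod M) ` {..<M} = {..<M}"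
    by (simp add: endo_inj_surj)
  have "(\<Sum>a<M. f a) = (\<Sum>a\<in>(\<lambda>a. c * a mod M) ` {..<M}. f a)" by (simp add: img)
  also have "\<dots> = (\<Sum>a<M. f (c * a mod M))" using inj by (simp add: sum.reindex)
  also have "\<dots> = (\<Sum>a<M. - f a)"
    by (intro sum.cong) (simp_all add: real_char_mod[OF f] real_char_mult[OF f] fc)
  finally show ?thesis by (simp add: sum_negf)
qed

lemma real_char_sum_bounded:
  assumes f: "real_char M f" and M: "M > 0" and c: "coprime c M" "f c \<noteq> 1"
  shows "\<bar>\<Sum>a<n. f a\<bar> \<le> real M"
proof (induction n rule: less_induct)
  case (less n)
  show ?case
  proof (cases "n < M")
    case True
    have "\<bar>\<Sum>a<n. f a\<bar> \<le> (\<Sum>a<n. 1)"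
      by (rule order_trans[OF sum_abs]) (intro sum_mono real_char_abs_le[OF f])
    with True show ?thesis by simp
  next
    case False
    then obtain k where k: "n = M + k" using le_Suc_ex not_less by blast
    have "(\<Sum>a<M + k. f a) = (\<Sum>a<M. f a) + (\<Sum>a<k. f a)"
      by (induction k) (simp_all add: real_char_period[OF f] add.commute)
    then have "(\<Sum>a<n. f a) = (\<Sum>a<k. f a)"
      using real_char_sum_period[OF assms] k by simp
    with less[of k] k M show ?thesis by simp
  qed
qed

text \<open>Summation by parts: the boundary terms contribute B g(b) and B g(a), the telescoping
  differences B (g(a) - g(b)); together 2 B g(a).\<close>

lemma Abel_sum_bound:
  fixes f g :: "nat \<Rightarrow> real"
  assumes F: "\<And>m. \<bar>\<Sum>n<m. f n\<bar> \<le> B"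
    and dec: "\<And>n. n \<ge> a \<Longrightarrow> g (Suc n) \<le> g n" and pos: "\<And>n. n \<ge> a \<Longrightarrow> 0 \<le> g n"
  shows "\<bar>\<Sum>n\<in>{a..<b}. f n * g n\<bar> \<le> 2 * B * g a"
proof (cases "a \<le> b")
  case False
  have "0 \<le> B" using F[of 0] by simp
  then show ?thesis using False pos[of a] by simp
next
  case True
  define F where "F m = (\<Sum>n<m. f n)" for m
  have Fb: "\<bar>F m\<bar> \<le> B" for m using F by (simp add: F_def)
  have B0: "0 \<le> B" using F[of 0] by simp
  obtain k where k: "b = a + k" using True le_Suc_ex by blast
  have id: "(\<Sum>n\<in>{a..<a+k}. f n * g n) = F (a+k) * g (a+k) - F a * g a
      + (\<Sum>n\<in>{a..<a+k}. F (Suc n) * (g n - g (Suc n)))"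
    by (induction k) (simp_all add: F_def algebra_simps)
  have tel: "(\<Sum>n\<in>{a..<a+k}. B * (g n - g (Suc n))) = B * (g a - g (a+k))"
    by (induction k) (simp_all add: algebra_simps)
  have "\<bar>\<Sum>n\<in>{a..<a+k}. F (Suc n) * (g n - g (Suc n))\<bar>
      \<le> (\<Sum>n\<in>{a..<a+k}. B * (g n - g (Suc n)))"
    by (rule order_trans[OF sum_abs], rule sum_mono)
       (use Fb dec in \<open>auto simp: abs_mult intro!: mult_mono B0\<close>)
  then have 1: "\<bar>\<Sum>n\<in>{a..<a+k}. F (Suc n) * (g n - g (Suc n))\<bar> \<le> B * (g a - g (a+k))"
    by (simp add: tel)
  have 2: "\<bar>F (a+k) * g (a+k)\<bar> \<le> B * g (a+k)" "\<bar>F a * g a\<bar> \<le> B * g a"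
    using Fb pos by (auto simp: abs_mult intro!: mult_mono B0)
  have "B * (g a - g (a+k)) + B * g (a+k) + B * g a = 2 * B * g a" by (simp add: algebra_simps)
  with 1 2 show ?thesis unfolding k id by linarith
qed

section \<open>Divisor sums of a real character\<close>

lemma le_of_mult_le: "a * b \<le> n \<Longrightarrow> 0 < b \<Longrightarrow> (a::nat) \<le> n"
  by (cases b) auto

lemma sum_divisors_swap:
  "(\<Sum>m\<in>{1..N}. \<Sum>d | d dvd m. h d (m div d)) = (\<Sum>d\<in>{1..N::nat}. \<Sum>k\<in>{1..N div d}. h d k :: real)"
proof -
  have "(\<Sum>m\<in>{1..N}. \<Sum>d | d dvd m. h d (m div d))
      = (\<Sum>(m, d)\<in>(SIGMA m:{1..N}. {d. d dvd m}). h d (m div d))"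
    by (subst sum.Sigma) auto
  also have "\<dots> = (\<Sum>(d, k)\<in>(SIGMA d:{1..N}. {1..N div d}). h d k)"
    by (rule sum.reindex_bij_witness[where i = "\<lambda>(d, k). (d * k, d)" and j = "\<lambda>(m, d). (d, m div d)"])
       (auto simp: Suc_le_eq less_eq_div_iff_mult_less_eq mult.commute
          elim!: dvdE intro: Nat.gr0I dest: le_of_mult_le)
  also have "\<dots> = (\<Sum>d\<in>{1..N}. \<Sum>k\<in>{1..N div d}. h d k)"
    by (subst sum.Sigma) auto
  finally show ?thesis .
qed

lemma divisor_sum_coprime:
  fixes f :: "nat \<Rightarrow> real"
  assumes mult: "\<And>a b. f (a * b) = f a * f b" and ab: "coprime a b" "a > 0" "b > 0"
  shows "(\<Sum>d | d dvd a * b. f d) = (\<Sum>d | d dvd a. f d) * (\<Sum>d | d dvd b. f d)"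
proof -
  have inj: "inj_on (\<lambda>(d, e). d * e) ({d. d dvd a} \<times> {e. e dvd b})"
  proof (rule inj_onI, clarsimp)
    fix d e d' e' assume d: "d dvd a" "e dvd b" "d' dvd a" "e' dvd b" and eq: "d * e = d' * e'"
    have "coprime d e'" "coprime d' e" using ab(1) d coprime_divisors by blast+
    then have "d dvd d'" "d' dvd d" using eq
      by (metis coprime_dvd_mult_left_iff dvd_triv_left)+
    then have "d = d'" by (rule dvd_antisym)
    moreover have "d > 0" using d(1) ab(2) by (meson dvd_pos_nat)
    ultimately show "d = d' \<and> e = e'" using eq by simp
  qed
  have img: "(\<lambda>(d, e). d * e) ` ({d. d dvd a} \<times> {e. e dvd b}) = {d. d dvd a * b}"
  proof (intro equalityI subsetI)
    fix x assume "x \<in> {d. d dvd a * b}"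
    then obtain d e where "x = d * e" "d dvd a" "e dvd b" using division_decomp by blast
    then show "x \<in> (\<lambda>(d, e). d * e) ` ({d. d dvd a} \<times> {e. e dvd b})" by (auto simp: image_iff)
  qed (auto simp: mult_dvd_mono)
  have "(\<Sum>d | d dvd a * b. f d) = (\<Sum>(d, e)\<in>{d. d dvd a} \<times> {e. e dvd b}. f (d * e))"
    using sum.reindex[OF inj, of f] unfolding img by (simp add: case_prod_beta' o_def)
  also have "\<dots> = (\<Sum>d | d dvd a. f d) * (\<Sum>d | d dvd b. f d)"
    by (simp add: mult sum_product sum.cartesian_product)
  finally show ?thesis .
qed

text \<open>The sum is geometric with ratio f(p): it is k + 1 for ratio 1, alternates between 1 and
  0 for ratio -1, and is 1 for ratio 0.\<close>

lemma real_char_divisor_sum_prime_power: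
  assumes f: "real_char M f" and p: "prime p"
  shows "(\<Sum>d | d dvd p ^ k. f d) \<ge> 0" "even k \<Longrightarrow> (\<Sum>d | d dvd p ^ k. f d) \<ge> 1"
proof -
  have inj: "inj_on (\<lambda>i. p ^ i) {..k}" using p
    by (auto intro!: inj_onI dest!: prime_gt_1_nat simp: power_inject_exp)
  have "{d. d dvd p ^ k} = (\<lambda>i. p ^ i) ` {..k}"
    using p by (auto simp: divides_primepow_nat)
  then have eq: "(\<Sum>d | d dvd p ^ k. f d) = (\<Sum>i\<le>k. f p ^ i)"
    using inj by (simp add: sum.reindex real_char_power[OF f])
  have alt: "(\<Sum>i\<le>k. (-1::real) ^ i) = (if even k then 1 else 0)"
    by (induction k) auto
  have zero: "(\<Sum>i\<le>k. (0::real) ^ i) = 1" by (induction k) auto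
  show "(\<Sum>d | d dvd p ^ k. f d) \<ge> 0" unfolding eq
    using real_char_cases[OF f, of p] by (auto simp: alt zero)
  show "(\<Sum>d | d dvd p ^ k. f d) \<ge> 1" if "even k" unfolding eq
    using real_char_cases[OF f, of p] that by (auto simp: alt zero)
qed

lemma prime_power_split:
  fixes n :: nat
  assumes "n > 1"
  obtains p k m where "prime p" "k > 0" "n = p ^ k * m" "\<not> p dvd m" "m < n" "m > 0"
proof -
  obtain p where p: "prime p" "p dvd n" using assms prime_factor_nat[of n] by auto
  then obtain m where m: "n = p ^ multiplicity p n * m" "\<not> p dvd m"
    using assms multiplicity_decompose'[of n p] by (metis not_prime_unit not_one_less_zero)
  have k: "multiplicity p n > 0" using p assms
    by (simp add: prime_multiplicity_gt_zero_iff)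
  have m0: "m > 0" using m(1) assms by (metis Suc_lessD gr0I mult_0_right not_less0)
  have "p ^ multiplicity p n > 1" using k prime_gt_1_nat[OF p(1)] by (rule one_less_power[rotated])
  then have "1 * m < p ^ multiplicity p n * m" using m0 by (rule mult_strict_right_mono)
  also have "\<dots> = n" using m(1) by (rule sym)
  finally have "m < n" by simp
  show ?thesis by (rule that[OF p(1) k m(1) m(2) \<open>m < n\<close> m0])
qed

lemma real_char_divisor_sum_nonneg:
  assumes f: "real_char M f"
  shows "n > 0 \<Longrightarrow> (\<Sum>d | d dvd n. f d) \<ge> 0"
proof (induction n rule: less_induct)
  case (less n)
  show ?case
  proof (cases "n = 1")
    case True
    then show ?thesis using real_char_1[OF f] by simp
  next
    case False
    then have "n > 1" using less.prems by simp
    then obtain p k m where pk: "prime p" "n = p ^ k * m" "\<not> p dvd m" "m < n" "m > 0"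
      using prime_power_split by metis
    have "coprime (p ^ k) m" using pk prime_imp_coprime by (metis coprime_power_left_iff)
    then have "(\<Sum>d | d dvd n. f d) = (\<Sum>d | d dvd p ^ k. f d) * (\<Sum>d | d dvd m. f d)"
      using divisor_sum_coprime[of f "p ^ k" m] pk
      by (simp add: real_char_mult[OF f] prime_gt_0_nat)
    then show ?thesis
      using less.IH[OF pk(4,5)] real_char_divisor_sum_prime_power(1)[OF f pk(1), of k] by simp
  qed
qed

text \<open>All prime exponents in n^2 are even. This lower bound is what makes the Lambert series
  of f unbounded near 1.\<close>

lemma real_char_divisor_sum_square:
  assumes f: "real_char M f"
  shows "n > 0 \<Longrightarrow> (\<Sum>d | d dvd n ^ 2. f d) \<ge> 1"
proof (induction n rule: less_induct)
  case (less n)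
  show ?case
  proof (cases "n = 1")
    case True
    then show ?thesis using real_char_1[OF f] by simp
  next
    case False
    then have "n > 1" using less.prems by simp
    then obtain p k m where pk: "prime p" "n = p ^ k * m" "\<not> p dvd m" "m < n" "m > 0"
      using prime_power_split by metis
    have "coprime (p ^ (2 * k)) (m ^ 2)"
      using pk prime_imp_coprime by (metis coprime_power_left_iff coprime_power_right_iff)
    moreover have "n ^ 2 = p ^ (2 * k) * m ^ 2"
      using pk(2) by (simp add: power_mult_distrib power_mult[symmetric] mult.commute)
    ultimately have "(\<Sum>d | d dvd n ^ 2. f d)
        = (\<Sum>d | d dvd p ^ (2 * k). f d) * (\<Sum>d | d dvd m ^ 2. f d)"
      using divisor_sum_coprime[of f "p ^ (2 * k)" "m ^ 2"] pk
      by (simp add: real_char_mult[OF f] prime_gt_0_nat)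
    also have "\<dots> \<ge> 1 * 1"
      using less.IH[of m] pk real_char_divisor_sum_prime_power(2)[OF f pk(1), of "2 * k"]
      by (intro mult_mono) auto
    finally show ?thesis by simp
  qed
qed

section \<open>Non-vanishing at 1\<close>

text \<open>AM-GM: the exponents 0, 2, ..., 2n - 2 average to n - 1. The proof pairs the first term
  with the last, 1 + s^(2n - 2) >= 2 s^(n - 1), and inducts on the n - 2 terms between them.\<close>

lemma power_sum_lower_bound:
  fixes s :: real
  assumes "0 \<le> s"
  shows "real n * s ^ (n - 1) \<le> (\<Sum>i<n. s ^ (2 * i))"
proof (induction n rule: nat_less_induct)
  case (1 n)
  consider "n = 0" | "n = 1" | m where "n = Suc (Suc m)" by (metis One_nat_def not0_implies_Suc)
  then show ?case
  proof cases
    case 3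
    have "(\<Sum>i<Suc m. s ^ (2 * i)) = 1 + s ^ 2 * (\<Sum>i<m. s ^ (2 * i))"
      unfolding sum.lessThan_Suc_shift
      by (simp add: sum_distrib_left power2_eq_square mult_ac)
    then have eq: "(\<Sum>i<n. s ^ (2 * i)) = 1 + s ^ 2 * (\<Sum>i<m. s ^ (2 * i)) + s ^ (2 * m + 2)"
      unfolding 3 by simp
    have sm: "s ^ 2 * (real m * s ^ (m - 1)) = real m * s ^ (m + 1)"
      by (cases m) (simp_all add: power2_eq_square)
    have "real m * s ^ (m - 1) \<le> (\<Sum>i<m. s ^ (2 * i))" using 1 3 by simp
    then have "real m * s ^ (m + 1) \<le> s ^ 2 * (\<Sum>i<m. s ^ (2 * i))"
      unfolding sm[symmetric] by (intro mult_left_mono) auto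
    moreover have "s ^ (2 * m + 2) = (s ^ (m + 1)) ^ 2"
      by (simp only: power_mult[symmetric]) (simp add: mult.commute)
    then have "2 * s ^ (m + 1) \<le> 1 + s ^ (2 * m + 2)"
      using sum_squares_bound[of 1 "s ^ (m + 1)"] by simp
    ultimately have "real m * s ^ (m + 1) + 2 * s ^ (m + 1) \<le> (\<Sum>i<n. s ^ (2 * i))"
      unfolding eq by linarith
    moreover have "real n * s ^ (n - 1) = real m * s ^ (m + 1) + 2 * s ^ (m + 1)"
      unfolding 3 by (simp add: distrib_right)
    ultimately show ?thesis by linarith
  qed simp_all
qed

text \<open>With s the square root of t, the two AM-GM bounds have the powers s^(n - 1) and s^n,
  whose product s^(2n - 1) is at least s^(2n) = t^n.\<close>

lemma geometric_product_bound:
  fixes t :: real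
  assumes t: "0 < t" "t < 1"
  shows "real n * real (Suc n) * t ^ n \<le> (\<Sum>i<n. t ^ i) * (\<Sum>i<Suc n. t ^ i)"
proof (cases n)
  case (Suc m)
  define s where "s = sqrt t"
  have s: "0 \<le> s" "s \<le> 1" "t = s ^ 2" using t by (auto simp: s_def)
  have a: "real k * s ^ (k - 1) \<le> (\<Sum>i<k. t ^ i)" for k
    using power_sum_lower_bound[OF s(1), of k] by (simp add: s(3) power_mult)
  have "(real n * s ^ (n - 1)) * (real (Suc n) * s ^ n) \<le> (\<Sum>i<n. t ^ i) * (\<Sum>i<Suc n. t ^ i)"
    using a[of n] a[of "Suc n"] s(1) t
    by (intro mult_mono) (auto intro!: sum_nonneg simp del: sum.lessThan_Suc)
  moreover have "s ^ (2 * n) \<le> s ^ (n - 1 + n)"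
    using s by (intro power_decreasing) auto
  then have "real n * real (Suc n) * t ^ n \<le> (real n * s ^ (n - 1)) * (real (Suc n) * s ^ n)"
    by (simp add: s(3) power_mult[symmetric] power_add mult_ac mult_left_mono)
  ultimately show ?thesis by linarith
qed simp

text \<open>The Lambert coefficient t^n / (1 - t^n) subtracted from its leading behaviour at t = 1.
  The sum of f(n) against this sequence is L(1) / (1 - t) minus the Lambert series of f.\<close>

definition monsky :: "real \<Rightarrow> nat \<Rightarrow> real" where
  "monsky t n = 1 / (real n * (1 - t)) - t ^ n / (1 - t ^ n)"

text \<open>With A_n = 1 + t + ... + t^(n - 1), consecutive terms differ by (1 / (n (n + 1)) - t^n /
  (A_n A_(n+1))) / (1 - t), which \<open>geometric_product_bound\<close> shows to be
  nonnegative.\<close>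

lemma monsky_decreasing:
  assumes t: "0 < t" "t < 1" and n: "n \<ge> 1"
  shows "monsky t (Suc n) \<le> monsky t n"
proof -
  define a b where "a = (\<Sum>i<n. t ^ i)" and "b = (\<Sum>i<Suc n. t ^ i)"
  have a0: "a > 0" "b > 0" unfolding a_def b_def using t n
    by (auto intro!: sum_pos simp del: sum.lessThan_Suc simp: lessThan_empty_iff)
  have ab: "1 - t ^ n = (1 - t) * a" "1 - t ^ Suc n = (1 - t) * b"
    unfolding a_def b_def by (simp_all only: one_diff_power_eq)
  have ba: "b = a + t ^ n" by (simp add: a_def b_def)
  have "real n * real (Suc n) * t ^ n \<le> a * b"
    using geometric_product_bound[OF t] by (simp add: a_def b_def)
  then have "t ^ n / (a * b) \<le> 1 / (real n * real (Suc n))"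
    using a0 n by (simp add: divide_simps mult_ac)
  then have 1: "t ^ n / (a * b) / (1 - t) \<le> 1 / (real n * real (Suc n)) / (1 - t)"
    using t by (intro divide_right_mono) auto
  have inv: "x / (1 - x) = 1 / (1 - x) - 1" if "x \<noteq> 1" for x :: real
    using that by (simp add: divide_simps)
  have cab: "1 / (c * a) - 1 / (c * b) = (b - a) / (a * b) / c" if "c > 0" for c
    using that a0 by (simp add: divide_simps mult_ac)
  have "(1 - t) * a > 0" "(1 - t) * b > 0" using a0 t by simp_all
  then have ne: "t ^ n \<noteq> 1" "t ^ Suc n \<noteq> 1" using ab by linarith+
  have "t ^ n / (1 - t ^ n) - t ^ Suc n / (1 - t ^ Suc n) = 1 / ((1 - t) * a) - 1 / ((1 - t) * b)"
    unfolding inv[OF ne(1)] inv[OF ne(2)] unfolding ab by simp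
  then have "t ^ n / (1 - t ^ n) - t ^ Suc n / (1 - t ^ Suc n) = (b - a) / (a * b) / (1 - t)"
    using cab[of "1 - t"] t by simp
  then have 2: "t ^ n / (1 - t ^ n) - t ^ Suc n / (1 - t ^ Suc n) = t ^ n / (a * b) / (1 - t)"
    by (simp add: ba)
  have 3: "1 / (real n * (1 - t)) - 1 / (real (Suc n) * (1 - t)) = 1 / (real n * real (Suc n)) / (1 - t)"
    using n t by (simp add: divide_simps)
  show ?thesis unfolding monsky_def using 1 2 3 by linarith
qed

lemma monsky_nonneg:
  assumes t: "0 < t" "t < 1" and n: "n \<ge> 1"
  shows "0 \<le> monsky t n"
proof -
  have "(\<Sum>i<n. t ^ n) \<le> (\<Sum>i<n. t ^ i)"
    using t by (intro sum_mono power_decreasing) auto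
  then have "(1 - t) * (real n * t ^ n) \<le> (1 - t) * (\<Sum>i<n. t ^ i)"
    using t by (intro mult_left_mono) auto
  then have "(1 - t) * (real n * t ^ n) \<le> 1 - t ^ n" by (simp add: one_diff_power_eq)
  moreover have "t ^ n < 1" using t n by (simp add: power_less_one_iff)
  ultimately show ?thesis unfolding monsky_def using t n
    by (simp add: divide_simps mult_ac)
qed

lemma monsky_1: "0 < t \<Longrightarrow> t < 1 \<Longrightarrow> monsky t 1 = 1"
  by (simp add: monsky_def divide_simps)

text \<open>Finite sums avoid rearranging a double series. In the geometric expansion of t^d / (1 -
  t^d) the terms with d k > N form a tail starting at an exponent >= N, at most t^N / (1 - t) for
  each d.\<close>

lemma lambert_sum_truncated:
  assumes f: "\<And>n. \<bar>f n\<bar> \<le> (1::real)" and t: "0 < t" "t < 1"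
  shows "\<bar>(\<Sum>n\<in>{1..N}. f n * (t ^ n / (1 - t ^ n))) - (\<Sum>m\<in>{1..N}. (\<Sum>d | d dvd m. f d) * t ^ m)\<bar>
    \<le> real N * t ^ N / (1 - t)"
proof -
  have "(\<Sum>m\<in>{1..N}. (\<Sum>d | d dvd m. f d) * t ^ m)
      = (\<Sum>m\<in>{1..N}. \<Sum>d | d dvd m. f d * t ^ (d * (m div d)))"
    by (intro sum.cong refl) (simp add: sum_distrib_right)
  also have "\<dots> = (\<Sum>d\<in>{1..N}. \<Sum>k\<in>{1..N div d}. f d * t ^ (d * k))"
    by (rule sum_divisors_swap)
  finally have eq: "(\<Sum>m\<in>{1..N}. (\<Sum>d | d dvd m. f d) * t ^ m)
      = (\<Sum>d\<in>{1..N}. \<Sum>k\<in>{1..N div d}. f d * t ^ (d * k))" .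
  have term_eq: "\<bar>f d * (t ^ d / (1 - t ^ d)) - (\<Sum>k\<in>{1..N div d}. f d * t ^ (d * k))\<bar> \<le> t ^ N / (1 - t)"
    if d: "d \<in> {1..N}" for d
  proof -
    define u where "u = t ^ d"
    have td: "u \<le> t" using t d power_decreasing[of 1 d t] by (simp add: u_def)
    have u1: "u < 1" "0 < u" using td t by (auto simp: u_def)
    have "(\<Sum>k\<in>{1..K}. u ^ k) * (1 - u) = u - u ^ Suc K" for K
    proof (induction K)
      case (Suc K)
      have "(\<Sum>k\<in>{1..Suc K}. u ^ k) * (1 - u) = (\<Sum>k\<in>{1..K}. u ^ k) * (1 - u) + u ^ Suc K * (1 - u)"
        by (simp add: distrib_right)
      with Suc show ?case by (simp add: algebra_simps)
    qed simp
    then have g1: "(\<Sum>k\<in>{1..K}. u ^ k) = u / (1 - u) - u ^ Suc K / (1 - u)" for K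
      using u1 by (simp add: eq_divide_eq diff_divide_distrib[symmetric])
    have g2: "(\<Sum>k\<in>{1..N div d}. f d * t ^ (d * k)) = f d * (\<Sum>k\<in>{1..N div d}. u ^ k)"
      by (simp add: sum_distrib_left u_def power_mult)
    have "f d * (t ^ d / (1 - t ^ d)) - (\<Sum>k\<in>{1..N div d}. f d * t ^ (d * k))
        = f d * (u ^ Suc (N div d) / (1 - u))"
      unfolding g2 g1 u_def[symmetric] by (simp only: right_diff_distrib)
    moreover have "N \<le> d * Suc (N div d)"
      using d dividend_less_times_div[of d N] by simp
    then have "u ^ Suc (N div d) \<le> t ^ N"
      unfolding u_def power_mult[symmetric] using t by (intro power_decreasing) auto
    then have "u ^ Suc (N div d) / (1 - u) \<le> t ^ N / (1 - t)"
      using u1 td t by (intro frac_le) auto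
    moreover have "0 \<le> u ^ Suc (N div d) / (1 - u)" using u1 by simp
    ultimately show ?thesis using f[of d] mult_mono[of "\<bar>f d\<bar>" 1 "u ^ Suc (N div d) / (1 - u)" "t ^ N / (1 - t)"]
      by (simp only: abs_mult abs_of_nonneg) simp
  qed
  have "\<bar>(\<Sum>n\<in>{1..N}. f n * (t ^ n / (1 - t ^ n))) - (\<Sum>d\<in>{1..N}. \<Sum>k\<in>{1..N div d}. f d * t ^ (d * k))\<bar>
      \<le> (\<Sum>d\<in>{1..N}. t ^ N / (1 - t))"
    unfolding sum_subtractf[symmetric]
    by (rule order_trans[OF sum_abs], rule sum_mono, rule term_eq)
  then show ?thesis unfolding eq by simp
qed

definition L_partial :: "(nat \<Rightarrow> real) \<Rightarrow> nat \<Rightarrow> real" where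
  "L_partial f N = (\<Sum>n\<in>{1..N}. f n / real n)"

text \<open>If L = 0, the Abel bound on the \<open>monsky\<close> sum keeps the Lambert series at
  most 2 M for all t < 1; but that series dominates the partial sums of t^(k^2), which outgrow every
  bound as t tends to 1.\<close>

lemma L_partial_nonzero_limit:
  assumes f: "real_char M f" and M: "M > 0" and c: "coprime c M" "f c \<noteq> 1"
    and lim: "L_partial f \<longlonglongrightarrow> L"
  shows "L \<noteq> 0"
proof
  assume L: "L = 0"
  define r where "r m = (\<Sum>d | d dvd m. f d)" for m
  have r0: "r m \<ge> 0" if "m \<ge> 1" for m
    using real_char_divisor_sum_nonneg[OF f, of m] that by (simp add: r_def)
  have upper: "(\<Sum>k\<in>{1..K}. t ^ (k ^ 2)) \<le> 2 * real M" if t: "0 < t" "t < 1" for t K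
  proof -
    have bound: "(\<Sum>k\<in>{1..K}. t ^ (k ^ 2)) \<le> \<bar>L_partial f N\<bar> / (1 - t) + real N * t ^ N / (1 - t) + 2 * real M"
      if N: "N \<ge> K ^ 2" for N
    proof -
      have "\<bar>\<Sum>n\<in>{1..<Suc N}. f n * monsky t n\<bar> \<le> 2 * real M * monsky t 1"
        by (rule Abel_sum_bound)
          (use real_char_sum_bounded[OF f M c] monsky_decreasing[OF t] monsky_nonneg[OF t] in auto)
      then have m: "\<bar>\<Sum>n\<in>{1..N}. f n * monsky t n\<bar> \<le> 2 * real M"
        using monsky_1[OF t] by (simp add: atLeastLessThanSuc_atLeastAtMost)
      have e: "(\<Sum>n\<in>{1..N}. f n * monsky t n)
          = L_partial f N / (1 - t) - (\<Sum>n\<in>{1..N}. f n * (t ^ n / (1 - t ^ n)))"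
        unfolding L_partial_def monsky_def sum_divide_distrib sum_subtractf[symmetric]
        by (intro sum.cong refl) (simp add: algebra_simps)
      have "\<bar>L_partial f N / (1 - t)\<bar> = \<bar>L_partial f N\<bar> / (1 - t)" using t by simp
      moreover have "\<bar>(\<Sum>n\<in>{1..N}. f n * (t ^ n / (1 - t ^ n))) - (\<Sum>m\<in>{1..N}. r m * t ^ m)\<bar>
          \<le> real N * t ^ N / (1 - t)"
        unfolding r_def by (rule lambert_sum_truncated[OF real_char_abs_le[OF f] t])
      moreover have "(\<Sum>k\<in>{1..K}. t ^ (k ^ 2)) \<le> (\<Sum>m\<in>{1..N}. r m * t ^ m)"
      proof -
        have "(\<Sum>k\<in>{1..K}. t ^ (k ^ 2)) \<le> (\<Sum>k\<in>{1..K}. r (k ^ 2) * t ^ (k ^ 2))"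
          using real_char_divisor_sum_square[OF f] t
          by (intro sum_mono) (auto simp: r_def)
        also have "\<dots> = (\<Sum>m\<in>(\<lambda>k. k ^ 2) ` {1..K}. r m * t ^ m)"
          by (subst sum.reindex) (auto intro!: inj_onI)
        also have "\<dots> \<le> (\<Sum>m\<in>{1..N}. r m * t ^ m)"
        proof (rule sum_mono2)
          show "(\<lambda>k. k\<^sup>2) ` {1..K} \<subseteq> {1..N}"
            using N by (auto intro: order_trans[OF power_mono])
        qed (use r0 t in \<open>auto intro!: mult_nonneg_nonneg\<close>)
        finally show ?thesis .
      qed
      ultimately show ?thesis using m e by linarith
    qed
    have "(\<lambda>N. real N * t ^ N) \<longlonglongrightarrow> 0"
      using t powser_times_n_limit_0[of t] by simp
    then have "(\<lambda>N. \<bar>L_partial f N\<bar> / (1 - t) + real N * t ^ N / (1 - t) + 2 * real M) \<longlonglongrightarrow> \<bar>L\<bar> / (1 - t) + 0 / (1 - t) + 2 * real M"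
      using t lim by (intro tendsto_intros) auto
    then have "(\<lambda>N. \<bar>L_partial f N\<bar> / (1 - t) + real N * t ^ N / (1 - t) + 2 * real M) \<longlonglongrightarrow> 2 * real M"
      by (simp add: L)
    then show ?thesis
      by (rule Lim_bounded2[where N = "K ^ 2"]) (use bound in auto)
  qed
  \<comment> \<open>At t = 1 the sum over k <= K equals K, which has to exceed 2 M.\<close>
  define K where "K = 2 * M + 1"
  have "((\<lambda>t. (\<Sum>k\<in>{1..K}. t ^ (k ^ 2))) \<longlongrightarrow> (\<Sum>k\<in>{1..K}. 1 ^ (k ^ 2))) (at_left (1::real))"
    by (intro tendsto_intros)
  moreover have "\<forall>\<^sub>F t in at_left (1::real). (\<Sum>k\<in>{1..K}. t ^ (k ^ 2)) \<le> 2 * real M"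
    using upper by (auto simp: eventually_at_left[of 0] intro!: exI[of _ 0])
  ultimately have "(\<Sum>k\<in>{1..K}. (1::real) ^ (k ^ 2)) \<le> 2 * real M"
    by (intro tendsto_upperbound) auto
  then show False by (simp add: K_def)
qed

lemma L_partial_difference:
  assumes f: "real_char M f" and M: "M > 0" and c: "coprime c M" "f c \<noteq> 1" and "N \<le> N'"
  shows "\<bar>L_partial f N' - L_partial f N\<bar> \<le> 2 * real M / real (Suc N)"
proof -
  have "{1..N'} = {1..N} \<union> {Suc N..<Suc N'}" using assms(5) by auto
  then have "L_partial f N' = L_partial f N + (\<Sum>n\<in>{Suc N..<Suc N'}. f n / real n)"
    unfolding L_partial_def by (subst sum.union_disjoint[symmetric]) auto
  moreover have "\<bar>\<Sum>n\<in>{Suc N..<Suc N'}. f n * (1 / real n)\<bar> \<le> 2 * real M * (1 / real (Suc N))"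
    by (rule Abel_sum_bound) (use real_char_sum_bounded[OF f M c] in \<open>auto simp: field_simps\<close>)
  ultimately show ?thesis by simp
qed

text \<open>The rate 1 / N is recorded because \<open>sum_char_mangoldt_bounded\<close> sums these
  errors against the von Mangoldt function.\<close>

lemma L_partial_limit:
  assumes f: "real_char M f" and M: "M > 0" and c: "coprime c M" "f c \<noteq> 1"
  obtains L where "L \<noteq> 0" "\<And>N. \<bar>L - L_partial f N\<bar> \<le> 2 * real M / real (Suc N)"
proof -
  have "Cauchy (L_partial f)"
  proof (rule metric_CauchyI)
    fix e :: real assume e: "e > 0"
    obtain N0 :: nat where N0: "2 * real M / e < real N0" using reals_Archimedean2 by blast
    have "\<bar>L_partial f n - L_partial f m\<bar> < e" if "n \<ge> m" "m \<ge> N0" for m n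
    proof -
      have "2 * real M / e < real (Suc m)" using N0 that(2) by linarith
      then have "2 * real M / real (Suc m) < e" using e by (simp add: field_simps)
      then show ?thesis using L_partial_difference[OF assms, of m n] that by simp
    qed
    then show "\<exists>N0. \<forall>m\<ge>N0. \<forall>n\<ge>N0. dist (L_partial f m) (L_partial f n) < e"
      unfolding dist_real_def by (metis abs_minus_commute nle_le)
  qed
  then obtain L where L: "L_partial f \<longlonglongrightarrow> L" using Cauchy_convergent convergent_def by blast
  have "\<bar>L - L_partial f N\<bar> \<le> 2 * real M / real (Suc N)" for N
  proof (rule tendsto_upperbound)
    show "((\<lambda>n. \<bar>L_partial f n - L_partial f N\<bar>) \<longlongrightarrow> \<bar>L - L_partial f N\<bar>) sequentially"
      using L by (intro tendsto_intros)
    show "\<forall>\<^sub>F n in sequentially. \<bar>L_partial f n - L_partial f N\<bar> \<le> 2 * real M / real (Suc N)"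
      using L_partial_difference[OF assms, of N] by (auto simp: eventually_sequentially)
  qed auto
  then show ?thesis using that L_partial_nonzero_limit[OF assms L] by blast
qed

section \<open>Bounds for sums of the von Mangoldt function\<close>

text \<open>Chebyshev's function psi.\<close>

definition psi_sum :: "nat \<Rightarrow> real" where
  "psi_sum N = (\<Sum>d\<in>{1..N}. mangoldt d)"

lemma ln_fact_eq_sum: "ln (fact N) = (\<Sum>m\<in>{1..N}. ln (real m))"
proof (induction N)
  case (Suc N)
  have "ln (fact (Suc N) :: real) = ln (real (Suc N)) + ln (fact N)"
    unfolding fact_Suc by (subst ln_mult) (auto simp del: of_nat_Suc)
  with Suc show ?case by simp
qed simp

text \<open>Legendre's formula for N!. The range may exceed N because \<open>N div d\<close>
  vanishes for d > N; this lets n and 2 n be summed over the same d.\<close>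

lemma sum_mangoldt_floor:
  assumes "N \<le> K"
  shows "(\<Sum>d\<in>{1..K}. mangoldt d * real (N div d)) = ln (fact N)"
proof -
  have "ln (fact N) = (\<Sum>m\<in>{1..N}. \<Sum>d | d dvd m. mangoldt d :: real)"
    unfolding ln_fact_eq_sum by (intro sum.cong refl) (simp add: mangoldt_sum)
  also have "\<dots> = (\<Sum>d\<in>{1..N}. \<Sum>k\<in>{1..N div d}. mangoldt d)"
    by (rule sum_divisors_swap)
  also have "\<dots> = (\<Sum>d\<in>{1..N}. mangoldt d * real (N div d))"
    by (intro sum.cong refl) (simp add: mult.commute)
  also have "\<dots> = (\<Sum>d\<in>{1..K}. mangoldt d * real (N div d))"
    using assms by (intro sum.mono_neutral_left) auto
  finally show ?thesis by simp
qed

lemma ln_fact_lower: "real N * ln (real N) - real N \<le> ln (fact N)"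
proof (induction N)
  case (Suc N)
  show ?case
  proof (cases "N = 0")
    case False
    have "ln (real (Suc N)) - ln (real N) = ln (1 + 1 / real N)"
      using False by (subst ln_divide_pos[symmetric]) (auto simp: field_simps)
    also have "\<dots> \<le> 1 / real N" using False by (intro ln_add_one_self_le_self) auto
    finally have "real N * (ln (real (Suc N)) - ln (real N)) \<le> 1"
      using False by (simp add: field_simps)
    moreover have "ln (fact (Suc N) :: real) = ln (real (Suc N)) + ln (fact N)"
      unfolding fact_Suc by (subst ln_mult) (auto simp del: of_nat_Suc)
    ultimately show ?thesis using Suc by (simp add: algebra_simps)
  qed simp
qed simp

text \<open>Chebyshev's argument: the logarithm of the central binomial coefficient is the sum of
  Lambda(d) (floor(2n / d) - 2 floor(n / d)), whose weights are nonnegative and equal 1 for n < d <=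
  2n.\<close>

lemma psi_sum_double: "psi_sum (2 * n) \<le> psi_sum n + 2 * real n"
proof -
  have split: "{1..2 * n} = {1..n} \<union> {n<..2 * n}" by auto
  have "psi_sum (2 * n) - psi_sum n = (\<Sum>d\<in>{n<..2 * n}. mangoldt d)"
    unfolding psi_sum_def split by (subst sum.union_disjoint) auto
  also have "\<dots> \<le> (\<Sum>d\<in>{n<..2 * n}. mangoldt d * (real (2 * n div d) - 2 * real (n div d)))"
  proof (intro sum_mono)
    fix d assume d: "d \<in> {n<..2 * n}"
    then have "2 * n div d = 1" "n div d = 0" by (auto intro!: div_nat_eqI)
    then show "mangoldt d \<le> mangoldt d * (real (2 * n div d) - 2 * real (n div d))" by simp
  qed
  also have "\<dots> \<le> (\<Sum>d\<in>{1..2 * n}. mangoldt d * (real (2 * n div d) - 2 * real (n div d)))"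
  proof (intro sum_mono2)
    fix d assume "d \<in> {1..2 * n} - {n<..2 * n}"
    then have "n div d * d * 2 \<le> 2 * n" by simp
    then have "2 * (n div d) \<le> 2 * n div d" using \<open>d \<in> _\<close>
      by (simp add: less_eq_div_iff_mult_less_eq mult_ac)
    then have "2 * real (n div d) \<le> real (2 * n div d)" by linarith
    then show "0 \<le> mangoldt d * (real (2 * n div d) - 2 * real (n div d))"
      by (simp add: mangoldt_nonneg)
  qed auto
  also have "\<dots> = ln (fact (2 * n)) - 2 * ln (fact n)"
    unfolding sum_mangoldt_floor[OF order_refl, of "2 * n", symmetric]
      sum_mangoldt_floor[of n "2 * n", OF le_add1[of n n, folded mult_2], symmetric]
    by (simp add: right_diff_distrib sum_subtractf sum_distrib_left mult_ac)
  also have "\<dots> = ln (real (2 * n choose n))"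
  proof -
    have "real (2 * n choose n) * (fact n * fact n) = fact (2 * n)"
      using binomial_fact[of n "2 * n", where ?'a = real] by (simp add: mult_2)
    then have "ln (fact (2 * n)) = ln (real (2 * n choose n) * (fact n * fact n))" by simp
    also have "\<dots> = ln (real (2 * n choose n)) + 2 * ln (fact n)"
      by (simp add: ln_mult)
    finally show ?thesis by simp
  qed
  also have "\<dots> \<le> ln (2 ^ (2 * n))"
  proof -
    have "(2 * n choose n) \<le> (\<Sum>k\<le>2 * n. 2 * n choose k)"
      by (rule member_le_sum) auto
    then have "real (2 * n choose n) \<le> 2 ^ (2 * n)"
      unfolding choose_row_sum using of_nat_mono by fastforce
    then show ?thesis by (subst ln_le_cancel_iff) auto
  qed
  also have "\<dots> = 2 * real n * ln 2" by (simp add: ln_realpow)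
  also have "\<dots> \<le> 2 * real n * 1" by (intro mult_left_mono) (auto simp: ln_2_less_1 less_imp_le)
  finally show ?thesis by simp
qed

lemma psi_sum_le: "psi_sum N \<le> 6 * real N"
proof (induction N rule: less_induct)
  case (less N)
  show ?case
  proof (cases "N = 0")
    case False
    define n where "n = N div 2"
    have n: "N = 2 * n \<or> N = Suc (2 * n)" unfolding n_def by presburger
    have "n < N" using False by (simp add: n_def)
    then have IH: "psi_sum (2 * n) \<le> 8 * real n"
      using less.IH[of n] psi_sum_double[of n] by linarith
    from n show ?thesis
    proof
      assume N: "N = Suc (2 * n)"
      have "mangoldt (Suc (2 * n)) \<le> ln (real (Suc (2 * n)))" by (rule mangoldt_le) simp
      also have "\<dots> \<le> 2 * real n" using ln_add_one_self_le_self[of "2 * real n"]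
        by (simp add: add.commute)
      finally show ?thesis using IH by (simp add: N psi_sum_def)
    qed (use IH in simp)
  qed (simp add: psi_sum_def)
qed

lemma ln_div_self_decreasing:
  assumes "n \<ge> 3"
  shows "ln (real (Suc n)) / real (Suc n) \<le> ln (real n) / real n"
proof -
  have "exp 1 \<le> real n" using exp_le assms by linarith
  then have ln: "1 \<le> ln (real n)" using assms by (subst ln_ge_iff) auto
  have "ln (real (Suc n)) - ln (real n) = ln (1 + 1 / real n)"
    using assms by (subst ln_divide_pos[symmetric]) (auto simp: field_simps)
  also have "\<dots> \<le> 1 / real n" using assms by (intro ln_add_one_self_le_self) auto
  finally have "real n * (ln (real (Suc n)) - ln (real n)) \<le> 1"
    using assms by (simp add: field_simps)
  with ln have "real n * ln (real (Suc n)) \<le> real (Suc n) * ln (real n)"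
    by (simp add: algebra_simps)
  then show ?thesis using assms by (simp add: divide_simps mult.commute del: of_nat_Suc)
qed

text \<open>On the integers ln n / n decreases only from 3 on, so n = 1 and n = 2 are bounded
  separately, by 1 each.\<close>

lemma sum_char_ln_bounded:
  assumes f: "real_char M f" and M: "M > 0" and c: "coprime c M" "f c \<noteq> 1"
  shows "\<bar>\<Sum>n\<in>{1..N}. f n * (ln (real n) / real n)\<bar> \<le> 2 + 2 * real M"
proof -
  have small: "\<bar>\<Sum>n\<in>{1..<min 3 (Suc N)}. f n * (ln (real n) / real n)\<bar> \<le> 2"
  proof -
    have "\<bar>\<Sum>n\<in>{1..<min 3 (Suc N)}. f n * (ln (real n) / real n)\<bar> \<le> (\<Sum>n\<in>{1..<min 3 (Suc N)}. 1)"
    proof (rule order_trans[OF sum_abs], rule sum_mono)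
      fix n assume "n \<in> {1..<min 3 (Suc N)}"
      then have "n \<ge> 1" by simp
      then have "ln (real n) / real n \<le> 1" "0 \<le> ln (real n) / real n"
        using ln_le_minus_one[of "real n"] by (auto simp: divide_simps)
      then show "\<bar>f n * (ln (real n) / real n)\<bar> \<le> 1"
        using real_char_abs_le[OF f, of n] mult_le_one[of "\<bar>f n\<bar>" "ln (real n) / real n"]
        by (simp only: abs_mult abs_of_nonneg)
    qed
    also have "\<dots> \<le> 2" by simp
    finally show ?thesis .
  qed
  have "\<bar>\<Sum>n\<in>{3..<Suc N}. f n * (ln (real n) / real n)\<bar> \<le> 2 * real M * (ln (real 3) / real 3)"
    by (rule Abel_sum_bound)
      (use real_char_sum_bounded[OF f M c] ln_div_self_decreasing in auto)
  also have "\<dots> \<le> 2 * real M * 1"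
    using ln_le_minus_one[of 3] by (intro mult_left_mono) auto
  finally have big: "\<bar>\<Sum>n\<in>{3..<Suc N}. f n * (ln (real n) / real n)\<bar> \<le> 2 * real M" by simp
  have "{1..N} = {1..<min 3 (Suc N)} \<union> {3..<Suc N}" by auto
  then have "(\<Sum>n\<in>{1..N}. f n * (ln (real n) / real n))
      = (\<Sum>n\<in>{1..<min 3 (Suc N)}. f n * (ln (real n) / real n)) + (\<Sum>n\<in>{3..<Suc N}. f n * (ln (real n) / real n))"
    by (simp only:) (rule sum.union_disjoint, auto)
  with small big show ?thesis by linarith
qed

text \<open>Mertens' method: as ln is the divisor sum of Lambda, the sum of f(n) ln n / n equals the
  sum of f(d) Lambda(d) / d times \<open>L_partial f (N div d)\<close>. Replacing the last factor by
  L costs O(Lambda(d) / N) per term, hence O(psi(N) / N) = O(1) in all, and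
  \<open>L \<noteq> 0\<close> can be divided out.\<close>

lemma sum_char_mangoldt_bounded:
  assumes f: "real_char M f" and M: "M > 0" and c: "coprime c M" "f c \<noteq> 1"
  obtains C where "\<And>N. \<bar>\<Sum>d\<in>{1..N}. f d * mangoldt d / real d\<bar> \<le> C"
proof -
  obtain L where L: "L \<noteq> 0" "\<And>N. \<bar>L - L_partial f N\<bar> \<le> 2 * real M / real (Suc N)"
    using L_partial_limit[OF assms] by blast
  define T where "T N = (\<Sum>d\<in>{1..N}. f d * mangoldt d / real d)" for N
  have "\<bar>T N\<bar> \<le> (2 + 2 * real M + 12 * real M) / \<bar>L\<bar>" for N
  proof (cases "N = 0")
    case False
    have "(\<Sum>n\<in>{1..N}. f n * (ln (real n) / real n))
        = (\<Sum>n\<in>{1..N}. \<Sum>d | d dvd n. f d * mangoldt d / real d * (f (n div d) / real (n div d)))"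
    proof (intro sum.cong refl)
      fix n assume n: "n \<in> {1..N}"
      have "f n * (ln (real n) / real n) = (\<Sum>d | d dvd n. f n * mangoldt d / real n)"
        using n mangoldt_sum[of n, where ?'a = real]
        by (simp add: sum_distrib_left[symmetric] sum_divide_distrib[symmetric])
      also have "\<dots> = (\<Sum>d | d dvd n. f d * mangoldt d / real d * (f (n div d) / real (n div d)))"
      proof (intro sum.cong refl)
        fix d assume "d \<in> {d. d dvd n}"
        then have "n = d * (n div d)" by simp
        then have "f n = f d * f (n div d)" "real n = real d * real (n div d)"
          using real_char_mult[OF f] by (metis, metis of_nat_mult)
        then show "f n * mangoldt d / real n = f d * mangoldt d / real d * (f (n div d) / real (n div d))"
          by simp
      qed
      finally show "f n * (ln (real n) / real n) = (\<Sum>d | d dvd n. f d * mangoldt d / real d * (f (n div d) / real (n div d)))" .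
    qed
    also have "\<dots> = (\<Sum>d\<in>{1..N}. \<Sum>k\<in>{1..N div d}. f d * mangoldt d / real d * (f k / real k))"
      by (rule sum_divisors_swap)
    also have "\<dots> = (\<Sum>d\<in>{1..N}. f d * mangoldt d / real d * L_partial f (N div d))"
      by (simp add: L_partial_def sum_distrib_left)
    finally have eq: "(\<Sum>n\<in>{1..N}. f n * (ln (real n) / real n))
        = (\<Sum>d\<in>{1..N}. f d * mangoldt d / real d * L_partial f (N div d))" .
    have "\<bar>(\<Sum>d\<in>{1..N}. f d * mangoldt d / real d * L) - (\<Sum>d\<in>{1..N}. f d * mangoldt d / real d * L_partial f (N div d))\<bar>
        \<le> (\<Sum>d\<in>{1..N}. mangoldt d * (2 * real M / real N))"
      unfolding sum_subtractf[symmetric]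
    proof (rule order_trans[OF sum_abs], rule sum_mono)
      fix d assume d: "d \<in> {1..N}"
      have "real N \<le> real d * real (Suc (N div d))"
        using d dividend_less_times_div[of d N]
        by (metis atLeastAtMost_iff less_imp_le less_le_trans mult_Suc_right of_nat_le_iff of_nat_mult zero_less_one)
      then have "2 * real M * real N \<le> 2 * real M * (real d * real (Suc (N div d)))"
        by (intro mult_left_mono) auto
      then have "2 * real M / real (Suc (N div d)) \<le> real d * (2 * real M / real N)"
        using False by (simp add: divide_simps mult_ac del: of_nat_Suc)
      then have e: "\<bar>L - L_partial f (N div d)\<bar> \<le> real d * (2 * real M / real N)"
        using L(2)[of "N div d"] by linarith
      have "\<bar>f d * mangoldt d / real d * L - f d * mangoldt d / real d * L_partial f (N div d)\<bar>
          = \<bar>f d\<bar> * (mangoldt d / real d) * \<bar>L - L_partial f (N div d)\<bar>"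
        unfolding right_diff_distrib[symmetric] by (simp add: abs_mult)
      also have "\<dots> \<le> 1 * (mangoldt d / real d) * (real d * (2 * real M / real N))"
        using e real_char_abs_le[OF f, of d] by (intro mult_mono) (auto simp: mangoldt_nonneg)
      also have "\<dots> = mangoldt d * (2 * real M / real N)" using d by simp
      finally show "\<bar>f d * mangoldt d / real d * L - f d * mangoldt d / real d * L_partial f (N div d)\<bar>
          \<le> mangoldt d * (2 * real M / real N)" .
    qed
    also have "\<dots> = psi_sum N * (2 * real M / real N)" by (simp only: psi_sum_def sum_distrib_right)
    also have "\<dots> \<le> 6 * real N * (2 * real M / real N)"
      by (intro mult_right_mono psi_sum_le) auto
    also have "\<dots> = 12 * real M" using False by simp
    finally have "\<bar>T N * L - (\<Sum>n\<in>{1..N}. f n * (ln (real n) / real n))\<bar> \<le> 12 * real M"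
      unfolding eq by (simp add: T_def sum_distrib_right)
    then have "\<bar>T N\<bar> * \<bar>L\<bar> \<le> 2 + 2 * real M + 12 * real M"
      using sum_char_ln_bounded[OF assms, of N] unfolding abs_mult[symmetric] by linarith
    then show ?thesis using L(1) by (simp add: pos_le_divide_eq)
  qed (simp add: T_def)
  then show ?thesis using that unfolding T_def by blast
qed

text \<open>Legendre's formula with the floors dropped, compared with ln N! >= N ln N - N.\<close>

lemma sum_mangoldt_over_self_lower:
  assumes "N > 0"
  shows "ln (real N) - 1 \<le> (\<Sum>d\<in>{1..N}. mangoldt d / real d)"
proof -
  have "real N * ln (real N) - real N \<le> (\<Sum>d\<in>{1..N}. mangoldt d * real (N div d))"
    unfolding sum_mangoldt_floor[OF order_refl] by (rule ln_fact_lower)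
  also have "\<dots> \<le> (\<Sum>d\<in>{1..N}. mangoldt d * (real N / real d))"
    by (intro sum_mono mult_left_mono of_nat_div_le_of_nat mangoldt_nonneg)
  also have "\<dots> = real N * (\<Sum>d\<in>{1..N}. mangoldt d / real d)"
    by (simp add: sum_distrib_left mult_ac)
  finally have "real N * (ln (real N) - 1) \<le> real N * (\<Sum>d\<in>{1..N}. mangoldt d / real d)"
    by (simp add: algebra_simps)
  then show ?thesis using assms by (simp add: mult_le_cancel_left_pos)
qed

lemma mangoldt_nonzero_cases:
  assumes "mangoldt d \<noteq> (0::real)"
  obtains p k where "prime p" "k > 0" "d = p ^ k" "mangoldt d = ln (real p)"
proof -
  have "primepow d" using assms by (auto simp: mangoldt_def split: if_splits)
  then obtain p k where "prime p" "k > 0" "d = p ^ k" by (auto simp: primepow_def)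
  then show ?thesis using that by simp
qed

text \<open>Only powers of the finitely many primes p dividing M occur, and each p contributes at
  most ln p. This is the gap between the principal character and the constant 1.\<close>

lemma sum_mangoldt_not_coprime_bounded:
  assumes M: "M > 0"
  obtains C where "\<And>N. (\<Sum>d | d \<in> {1..N} \<and> \<not> coprime d M. mangoldt d / real d) \<le> C"
proof -
  define P where "P = {p. prime p \<and> p dvd M}"
  have finP: "finite P" using M by (auto simp: P_def intro: finite_subset[OF _ finite_divisors_nat])
  have "(\<Sum>d | d \<in> {1..N} \<and> \<not> coprime d M. mangoldt d / real d) \<le> (\<Sum>p\<in>P. ln (real p))" for N
  proof -
    define D where "D = {d \<in> {1..N}. \<not> coprime d M \<and> mangoldt d \<noteq> (0::real)}"
    define G where "G = (\<lambda>(p::nat, k::nat). p ^ k)"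
    have "(\<Sum>d | d \<in> {1..N} \<and> \<not> coprime d M. mangoldt d / real d) = (\<Sum>d\<in>D. mangoldt d / real d)"
      unfolding D_def by (rule sum.mono_neutral_right) auto
    also have "\<dots> \<le> (\<Sum>x\<in>P \<times> {1..N}. ln (real (fst x)) * (1 / real (fst x)) ^ snd x)"
    proof (rule sum_le_included[where i = G])
      show "finite D" "finite (P \<times> {1..N})" using finP by (auto simp: D_def)
      show "\<forall>x\<in>P \<times> {1..N}. 0 \<le> ln (real (fst x)) * (1 / real (fst x)) ^ snd x"
        by (auto simp: P_def dest!: prime_gt_0_nat)
      show "\<forall>d\<in>D. \<exists>x\<in>P \<times> {1..N}. G x = d \<and> mangoldt d / real d \<le> ln (real (fst x)) * (1 / real (fst x)) ^ snd x"
      proof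
        fix d assume d: "d \<in> D"
        then obtain p k where pk: "prime p" "k > 0" "d = p ^ k" "mangoldt d = ln (real p)"
          using mangoldt_nonzero_cases[of d] by (auto simp: D_def)
        have "p dvd M" using d pk by (auto simp: D_def dest: prime_imp_coprime)
        moreover have "k \<le> d" using pk prime_gt_1_nat[OF pk(1)] less_exp[of k] power_mono[of 2 p k]
          by simp
        then have "k \<le> N" using d by (auto simp: D_def)
        ultimately have "(p, k) \<in> P \<times> {1..N}" using pk by (auto simp: P_def)
        moreover have "mangoldt d / real d = ln (real p) * (1 / real p) ^ k"
          using pk by (simp add: power_one_over)
        ultimately show "\<exists>x\<in>P \<times> {1..N}. G x = d \<and> mangoldt d / real d \<le> ln (real (fst x)) * (1 / real (fst x)) ^ snd x"
          using pk by (intro bexI[of _ "(p, k)"]) (auto simp: G_def)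
      qed
    qed
    also have "\<dots> = (\<Sum>p\<in>P. ln (real p) * (\<Sum>k\<in>{1..N}. (1 / real p) ^ k))"
      by (simp add: sum.cartesian_product' sum_distrib_left)
    also have "\<dots> \<le> (\<Sum>p\<in>P. ln (real p) * 1)"
    proof (intro sum_mono mult_left_mono)
      fix p assume "p \<in> P"
      then have p: "p \<ge> 2" by (auto simp: P_def prime_ge_2_nat)
      have "(\<Sum>k\<in>{1..N}. (1 / real p) ^ k) \<le> (\<Sum>k\<in>{1..N}. (1 / 2) ^ k)"
        using p by (intro sum_mono power_mono) (auto simp: field_simps)
      also have "(\<Sum>k\<in>{1..N}. (1 / 2 :: real) ^ k) = 1 - (1 / 2) ^ N"
        by (induction N) auto
      also have "\<dots> \<le> 1" by simp
      finally show "(\<Sum>k\<in>{1..N}. (1 / real p) ^ k) \<le> 1" .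
      show "0 \<le> ln (real p)" using p by simp
    qed
    finally show ?thesis by simp
  qed
  then show ?thesis using that by blast
qed

text \<open>The correction -4 / sqrt n makes the induction close: with b = sqrt (n + 1), the bound
  ln (b^2) <= 2 b gives a new term of at most 2 / b^3, which is below 4 / sqrt n - 4 / b.\<close>

lemma sum_ln_over_square_bounded:
  assumes "n > 0"
  shows "(\<Sum>m\<in>{1..n}. ln (real m) / real m ^ 2) \<le> 4 - 4 / sqrt (real n)"
  using assms
proof (induction n rule: nat_induct_non_zero)
  case (Suc n)
  define a b where "a = sqrt (real n)" and "b = sqrt (real (Suc n))"
  have ab: "0 < a" "a \<le> b" "b ^ 2 = a ^ 2 + 1" "real n = a ^ 2" "real (Suc n) = b ^ 2" "b > 0"
    using Suc.hyps by (auto simp: a_def b_def)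
  have "ln (real (Suc n)) = 2 * ln b" unfolding ab(5) by (simp add: ln_realpow)
  also have "\<dots> \<le> 2 * b" using ln_le_minus_one[OF ab(6)] by simp
  finally have "ln (real (Suc n)) / real (Suc n) ^ 2 \<le> 2 * b / real (Suc n) ^ 2"
    by (intro divide_right_mono) auto
  also have "\<dots> = 2 / b ^ 3" using ab(6) unfolding ab(5)
    by (simp add: power2_eq_square power3_eq_cube)
  also have "\<dots> \<le> 4 / a - 4 / b"
  proof -
    have "(b - a) * (b + a) = 1" using ab(3) by (simp add: power2_eq_square algebra_simps)
    then have ba: "b - a = 1 / (b + a)" using ab by (simp add: field_simps)
    have "4 / a - 4 / b = 4 * (b - a) / (a * b)" using ab by (simp add: field_simps)
    also have "\<dots> = 4 / (a * b * (b + a))" unfolding ba by simp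
    finally have "4 / a - 4 / b = 4 / (a * b * (b + a))" .
    moreover have "a * b * (b + a) \<le> b * b * (b + b)" using ab by (intro mult_mono) auto
    then have "4 / (b * b * (b + b)) \<le> 4 / (a * b * (b + a))" using ab by (intro frac_le) auto
    moreover have "4 / (b * b * (b + b)) = 2 / b ^ 3" using ab by (simp add: power3_eq_cube field_simps)
    ultimately show ?thesis by simp
  qed
  finally show ?case using Suc.IH by (simp add: a_def b_def)
qed simp

section \<open>Primes with prescribed quadratic characters\<close>

text \<open>A real character is determined by the residues below M at which it is 1: its zeros are
  prescribed by M, and elsewhere it is -1.\<close>

lemma finite_real_chars:
  assumes "M > 0"
  shows "finite {f. real_char M f}"
proof (rule finite_imageD)
  show "finite ((\<lambda>f. {a \<in> {..<M}. f a = 1}) ` {f. real_char M f})"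
    by (rule finite_subset[of _ "Pow {..<M}"]) auto
  show "inj_on (\<lambda>f. {a \<in> {..<M}. f a = 1}) {f. real_char M f}"
  proof (intro inj_onI ext)
    fix f g a assume "f \<in> {f. real_char M f}" "g \<in> {f. real_char M f}"
      and eq: "{a \<in> {..<M}. f a = 1} = {a \<in> {..<M}. g a = 1}"
    then have f: "real_char M f" and g: "real_char M g" by auto
    have "a mod M < M" using assms by simp
    then have "f (a mod M) = 1 \<longleftrightarrow> g (a mod M) = 1" using eq by blast
    then have "f a = 1 \<longleftrightarrow> g a = 1" using real_char_mod[OF f] real_char_mod[OF g] by simp
    then show "f a = g a"
      using real_char_coprime[OF f, of a] real_char_coprime[OF g, of a]
        real_char_eq_0[OF f, of a] real_char_eq_0[OF g, of a] by metis
  qed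
qed

lemma real_char_principal: "real_char M (\<lambda>n. if coprime n M then 1 else 0)"
proof -
  have "coprime (a + M) M \<longleftrightarrow> coprime a M" for a
    by (simp add: coprime_iff_gcd_eq_1 del: coprime_imp_gcd_eq_1)
  then show ?thesis unfolding real_char_def by simp
qed

lemma real_char_times:
  assumes "real_char M f" "real_char M g"
  shows "real_char M (\<lambda>n. f n * g n)"
proof -
  have "f a * g a \<in> (if coprime a M then {1, -1} else {0})" for a
    using real_char_coprime[OF assms(1), of a] real_char_coprime[OF assms(2), of a]
      real_char_eq_0[OF assms(1), of a] by (cases "coprime a M") auto
  moreover have "f (a * b) * g (a * b) = (f a * g a) * (f b * g b)" for a b
    by (simp add: real_char_mult[OF assms(1)] real_char_mult[OF assms(2)])
  ultimately show ?thesis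
    unfolding real_char_def
    using real_char_period[OF assms(1)] real_char_period[OF assms(2)] by simp
qed

text \<open>Multiplication by f is an involution on the real characters; if f(N) f(n) = -1, it turns
  the sum into its negative.\<close>

lemma real_char_orthogonality:
  assumes M: "M > 0" and N: "coprime N M"
    and nz: "(\<Sum>f | real_char M f. f N * f n) \<noteq> 0"
  shows "coprime n M" "real_char M f \<Longrightarrow> f n = f N"
proof -
  show n: "coprime n M"
  proof (rule ccontr)
    assume "\<not> coprime n M"
    then have "(\<Sum>f | real_char M f. f N * f n) = 0"
      by (intro sum.neutral) (auto dest: real_char_eq_0)
    with nz show False by simp
  qed
  assume f: "real_char M f"
  show "f n = f N"
  proof (rule ccontr)
    assume "f n \<noteq> f N"
    then have neg: "f N * f n = -1"
      using real_char_coprime[OF f n] real_char_coprime[OF f N] by auto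
    have sq: "(\<lambda>x. g x * f x * f x) = g" if "real_char M g" for g
    proof
      fix x
      show "g x * f x * f x = g x"
        using real_char_coprime[OF f, of x] real_char_eq_0[OF that, of x] by (cases "coprime x M") auto
    qed
    have "(\<Sum>g | real_char M g. g N * g n) = (\<Sum>g | real_char M g. (g N * f N) * (g n * f n))"
    proof (rule sum.reindex_bij_witness[where i = "\<lambda>g x. g x * f x" and j = "\<lambda>g x. g x * f x"])
      fix g assume "g \<in> {g. real_char M g}"
      then have g: "real_char M g" by simp
      show "(\<lambda>x. g x * f x * f x) = g" "(\<lambda>x. g x * f x * f x) = g" by (rule sq[OF g])+
      show "(\<lambda>x. g x * f x) \<in> {g. real_char M g}" "(\<lambda>x. g x * f x) \<in> {g. real_char M g}"
        using real_char_times[OF g f] by simp_all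
      show "g N * f N * f N * (g n * f n * f n) = g N * g n"
        using fun_cong[OF sq[OF g], of N] fun_cong[OF sq[OF g], of n] by (simp only:)
    qed
    also have "\<dots> = (\<Sum>g | real_char M g. - (g N * g n))"
    proof (intro sum.cong refl)
      fix g
      have "(g N * f N) * (g n * f n) = (f N * f n) * (g N * g n)" by simp
      then show "(g N * f N) * (g n * f n) = - (g N * g n)" unfolding neg by simp
    qed
    finally show False using nz by (simp add: sum_negf)
  qed
qed

theorem exists_prime_same_real_chars:
  assumes M: "M > 0" and N: "coprime N M"
  obtains q where "prime q" "coprime q M" "\<And>f. real_char M f \<Longrightarrow> f q = f N"
proof (rule ccontr)
  note thesis_if = that
  assume "\<not> thesis"
  then have no: "\<exists>f. real_char M f \<and> f q \<noteq> f N" if "prime q" "coprime q M" for q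
    using that thesis_if by blast
  define X where "X = {f. real_char M f}"
  have finX: "finite X" using finite_real_chars[OF M] by (simp add: X_def)
  define w where "w n = (\<Sum>f\<in>X. f N * f n)" for n
  define T where "T f n = (\<Sum>d\<in>{1..n}. f d * mangoldt d / real d)" for f :: "nat \<Rightarrow> real" and n
  define f0 where "f0 n = (if coprime n M then 1 else 0 :: real)" for n
  have f0: "f0 \<in> X" using real_char_principal by (simp add: X_def f0_def[abs_def])
  have w_le: "w n \<le> real (card X)" for n
  proof -
    have "w n \<le> (\<Sum>f\<in>X. 1)" unfolding w_def
    proof (rule sum_mono)
      fix f assume "f \<in> X"
      then have "\<bar>f N\<bar> \<le> 1" "\<bar>f n\<bar> \<le> 1" using real_char_abs_le by (auto simp: X_def)
      then have "\<bar>f N * f n\<bar> \<le> 1" unfolding abs_mult by (intro mult_le_one) auto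
      then show "f N * f n \<le> 1" by simp
    qed
    then show ?thesis by simp
  qed
  have upper: "(\<Sum>d\<in>{1..n}. w d * mangoldt d / real d) \<le> 8 * real (card X)" if n: "n > 0" for n
  proof -
    define D where "D = {d \<in> {1..n}. w d \<noteq> 0 \<and> mangoldt d \<noteq> (0::real)}"
    have "(\<Sum>d\<in>{1..n}. w d * mangoldt d / real d) = (\<Sum>d\<in>D. w d * mangoldt d / real d)"
      unfolding D_def by (rule sum.mono_neutral_right) auto
    also have "\<dots> \<le> (\<Sum>m\<in>{1..n}. 2 * real (card X) * (ln (real m) / real m ^ 2))"
    proof (rule sum_le_included[where i = "\<lambda>m. m ^ 2"])
      show "\<forall>d\<in>D. \<exists>m\<in>{1..n}. m ^ 2 = d \<and> w d * mangoldt d / real d \<le> 2 * real (card X) * (ln (real m) / real m ^ 2)"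
      proof
        fix d assume d: "d \<in> D"
        obtain p k where pk: "prime p" "k > 0" "d = p ^ k" "mangoldt d = ln (real p)"
          using d mangoldt_nonzero_cases[of d] by (auto simp: D_def)
        have "(\<Sum>f | real_char M f. f N * f d) \<noteq> 0" using d by (simp add: D_def w_def X_def)
        note orth = real_char_orthogonality[OF M N this]
        have p: "coprime p M" using orth(1) pk by simp
        \<comment> \<open>For odd k every real character takes the same value at p as at p^k, so p
          would be a prime of the kind assumed not to exist.\<close>
        have "even k"
        proof (rule ccontr)
          assume "odd k"
          have "f p = f N" if f: "real_char M f" for f
            using orth(2)[OF f] real_char_coprime[OF f p] \<open>odd k\<close>
            by (auto simp: pk(3) real_char_power[OF f])
          then show False using no[OF pk(1) p] by blast
        qed
        then obtain j where j: "k = 2 * j" by blast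
        define m where "m = p ^ j"
        have m: "m ^ 2 = d" by (simp add: m_def pk(3) j power_mult[symmetric] mult.commute)
        have m0: "m \<ge> 1" using prime_gt_0_nat[OF pk(1)] by (simp add: m_def Suc_le_eq)
        have "m \<le> m ^ 2" using m0 by (simp add: power2_eq_square)
        then have mn: "m \<in> {1..n}" using m0 d unfolding m by (auto simp: D_def)
        have "mangoldt d \<le> ln (real d)" using d by (intro mangoldt_le) (auto simp: D_def)
        also have "\<dots> = 2 * ln (real m)" using m0 by (simp add: m[symmetric] ln_realpow)
        finally have "real (card X) * mangoldt d \<le> real (card X) * (2 * ln (real m))"
          by (intro mult_left_mono) auto
        moreover have "w d * mangoldt d \<le> real (card X) * mangoldt d"
          by (intro mult_right_mono w_le mangoldt_nonneg)
        ultimately have "w d * mangoldt d \<le> real (card X) * (2 * ln (real m))" by linarith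
        then have "w d * mangoldt d / real d \<le> real (card X) * (2 * ln (real m)) / real d"
          by (intro divide_right_mono) auto
        also have "\<dots> = 2 * real (card X) * (ln (real m) / real m ^ 2)"
          by (simp add: m[symmetric])
        finally show "\<exists>m\<in>{1..n}. m ^ 2 = d \<and> w d * mangoldt d / real d \<le> 2 * real (card X) * (ln (real m) / real m ^ 2)"
          using m mn by blast
      qed
    qed (auto simp: D_def)
    also have "\<dots> = 2 * real (card X) * (\<Sum>m\<in>{1..n}. ln (real m) / real m ^ 2)"
      by (simp only: sum_distrib_left)
    also have "\<dots> \<le> 2 * real (card X) * 4"
    proof (rule mult_left_mono)
      show "(\<Sum>m\<in>{1..n}. ln (real m) / real m ^ 2) \<le> 4"
        using sum_ln_over_square_bounded[OF n] by (rule order_trans) simp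
    qed simp
    finally show ?thesis by simp
  qed
  have "\<exists>B. \<forall>n. \<bar>T f n\<bar> \<le> B" if "f \<in> X - {f0}" for f
  proof -
    have f: "real_char M f" using that by (simp add: X_def)
    have "f \<noteq> f0" using that by simp
    then obtain c where "f c \<noteq> f0 c" by blast
    then have c: "coprime c M" "f c \<noteq> 1"
      using real_char_eq_0[OF f, of c] by (auto simp: f0_def split: if_splits)
    obtain B where "\<And>n. \<bar>\<Sum>d\<in>{1..n}. f d * mangoldt d / real d\<bar> \<le> B"
      using sum_char_mangoldt_bounded[OF f M c] by blast
    then show ?thesis unfolding T_def by blast
  qed
  then have "\<forall>f\<in>X - {f0}. \<exists>B. \<forall>n. \<bar>T f n\<bar> \<le> B" by blast
  from bchoice[OF this] obtain B where B: "\<And>f n. f \<in> X - {f0} \<Longrightarrow> \<bar>T f n\<bar> \<le> B f" by blast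
  obtain K where K: "\<And>n. (\<Sum>d | d \<in> {1..n} \<and> \<not> coprime d M. mangoldt d / real d) \<le> K"
    using sum_mangoldt_not_coprime_bounded[OF M] by blast
  \<comment> \<open>The principal character contributes at least ln n - 1 - K; every other one
    contributes at least - \<open>B f\<close>.\<close>
  have lower: "ln (real n) - 1 - K - (\<Sum>f\<in>X - {f0}. B f) \<le> (\<Sum>d\<in>{1..n}. w d * mangoldt d / real d)"
    if n: "n > 0" for n
  proof -
    have "(\<Sum>d\<in>{1..n}. w d * mangoldt d / real d) = (\<Sum>d\<in>{1..n}. \<Sum>f\<in>X. f N * (f d * mangoldt d / real d))"
      by (simp add: w_def sum_distrib_right sum_divide_distrib mult.assoc)
    also have "\<dots> = (\<Sum>f\<in>X. f N * T f n)"
      unfolding T_def sum_distrib_left by (rule sum.swap)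
    also have "\<dots> = f0 N * T f0 n + (\<Sum>f\<in>X - {f0}. f N * T f n)"
      by (rule sum.remove[OF finX f0])
    finally have eq: "(\<Sum>d\<in>{1..n}. w d * mangoldt d / real d) = T f0 n + (\<Sum>f\<in>X - {f0}. f N * T f n)"
      using N by (simp add: f0_def)
    have "- (\<Sum>f\<in>X - {f0}. B f) \<le> (\<Sum>f\<in>X - {f0}. f N * T f n)"
      unfolding sum_negf[symmetric]
    proof (rule sum_mono)
      fix f assume f: "f \<in> X - {f0}"
      then have "real_char M f" by (simp add: X_def)
      then have "f N = 1 \<or> f N = -1" using N by (rule real_char_coprime)
      then show "- B f \<le> f N * T f n" using B[OF f, of n] by auto
    qed
    moreover have "(\<Sum>d\<in>{1..n}. mangoldt d / real d)
        = T f0 n + (\<Sum>d | d \<in> {1..n} \<and> \<not> coprime d M. mangoldt d / real d)"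
    proof -
      have "(\<Sum>d | d \<in> {1..n} \<and> \<not> coprime d M. mangoldt d / real d)
          = (\<Sum>d\<in>{1..n}. if \<not> coprime d M then mangoldt d / real d else 0)"
        by (simp add: sum.inter_filter[symmetric])
      then show ?thesis unfolding T_def f0_def
        by (simp add: sum.distrib[symmetric]) (intro sum.cong, auto)
    qed
    ultimately show ?thesis using eq K[of n] sum_mangoldt_over_self_lower[OF n] by linarith
  qed
  define R where "R = 1 + K + (\<Sum>f\<in>X - {f0}. B f) + 8 * real (card X)"
  obtain n :: nat where n: "exp R < real n" using reals_Archimedean2 by blast
  have "0 < real n" using n exp_gt_zero[of R] by (rule less_trans[rotated])
  then have n0: "n > 0" by simp
  have "exp R < exp (ln (real n))" using n n0 by simp
  then have "R < ln (real n)" by (rule exp_less_cancel)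
  with upper[OF n0] lower[OF n0] show False unfolding R_def by linarith
qed

section \<open>Solving the ternary equations\<close>

lemma sqrt_ceiling_exists:
  assumes "(n::nat) \<ge> 1"
  obtains a where "a \<ge> 1" "(a - 1) ^ 2 < n" "n \<le> a ^ 2"
proof -
  define a where "a = (LEAST a. n \<le> a ^ 2)"
  have ex: "n \<le> n ^ 2" using assms by (simp add: power2_eq_square)
  have a: "n \<le> a ^ 2" unfolding a_def by (rule LeastI[of "\<lambda>a. n \<le> a ^ 2", OF ex])
  have a1: "a \<ge> 1" using a assms by (cases a) auto
  then have "a - 1 < a" by simp
  then have "\<not> n \<le> (a - 1) ^ 2" unfolding a_def by (rule not_less_Least)
  with that a a1 show ?thesis by simp
qed

text \<open>Thue's lemma in three variables: two points of a box with more than n q points have the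
  same residue, and their difference is the solution.\<close>

lemma small_congruence_solution:
  fixes n q :: nat and A B :: int
  assumes "n \<ge> 1" "q \<ge> 1"
  obtains w u z :: int where "w ^ 2 < int q" "u ^ 2 < int n" "z ^ 2 \<le> int (n * q)"
    "(w, u, z) \<noteq> (0, 0, 0)" "int (n * q) dvd z - A * w - B * u"
proof -
  obtain a where a: "a \<ge> 1" "(a - 1) ^ 2 < q" "q \<le> a ^ 2" using sqrt_ceiling_exists assms(2) by blast
  obtain b where b: "b \<ge> 1" "(b - 1) ^ 2 < n" "n \<le> b ^ 2" using sqrt_ceiling_exists assms(1) by blast
  \<comment> \<open>The summand 1 makes the count strict, (a b c)^2 >= q n (n q + 1) > (n q)^2,
    while differences of z-coordinates still satisfy z^2 <= n q.\<close>
  obtain c where c: "c \<ge> 1" "(c - 1) ^ 2 < n * q + 1" "n * q + 1 \<le> c ^ 2"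
    using sqrt_ceiling_exists[of "n * q + 1"] by auto
  have "(n * q) ^ 2 = q * n * (n * q)" by (simp add: power2_eq_square)
  also have "\<dots> < q * n * (n * q + 1)" using assms by simp
  also have "\<dots> \<le> a ^ 2 * b ^ 2 * c ^ 2" using a b c by (intro mult_le_mono) auto
  finally have "(n * q) ^ 2 < (a * b * c) ^ 2" by (simp add: power_mult_distrib)
  then have card_gt: "n * q < a * b * c" by (rule power_less_imp_less_base) simp
  define S where "S = {0..<int a} \<times> {0..<int b} \<times> {0..<int c}"
  define f where "f = (\<lambda>(w, u, z). (z - A * w - B * u) mod int (n * q))"
  have "int (n * q) > 0" using assms by simp
  then have "f ` S \<subseteq> {0..<int (n * q)}" by (auto simp: f_def)
  then have "card (f ` S) \<le> n * q"
    using card_mono[of "{0..<int (n * q)}" "f ` S"] by (simp del: of_nat_mult)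
  moreover have "card S = a * b * c" by (simp add: S_def card_cartesian_product)
  ultimately have "card (f ` S) < card S" using card_gt by simp
  then have "\<not> inj_on f S" by (rule pigeonhole)
  then obtain w u z w' u' z' where S: "(w, u, z) \<in> S" "(w', u', z') \<in> S"
    and ne: "(w, u, z) \<noteq> (w', u', z')" and eq: "f (w, u, z) = f (w', u', z')"
    unfolding inj_on_def by (metis prod_cases3)
  have sq: "(x - y) ^ 2 \<le> int ((k - 1) ^ 2)" if "x \<in> {0..<int k}" "y \<in> {0..<int k}" for x y :: int and k
  proof -
    have "\<bar>x - y\<bar> \<le> \<bar>int (k - 1)\<bar>" using that by auto
    then show ?thesis unfolding abs_le_square_iff by simp
  qed
  have "(w - w') ^ 2 \<le> int ((a - 1) ^ 2)" "(u - u') ^ 2 \<le> int ((b - 1) ^ 2)"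
    "(z - z') ^ 2 \<le> int ((c - 1) ^ 2)"
    using S by (auto simp only: S_def mem_Times_iff fst_conv snd_conv intro!: sq)
  then have "(w - w') ^ 2 < int q" "(u - u') ^ 2 < int n" "(z - z') ^ 2 \<le> int (n * q)"
    using a(2) b(2) c(2) by linarith+
  moreover have "(w - w', u - u', z - z') \<noteq> (0, 0, 0)" using ne by auto
  moreover have "int (n * q) dvd (z - A * w - B * u) - (z' - A * w' - B * u')"
    using eq by (simp add: f_def mod_eq_dvd_iff)
  then have "int (n * q) dvd (z - z') - A * (w - w') - B * (u - u')"
    by (simp add: algebra_simps)
  ultimately show ?thesis by (rule that)
qed

text \<open>The second case uses the identity
  \<open>(z\<^sup>2 + q u\<^sup>2) (w\<^sup>2 + q) = (z w - q u)\<^sup>2 + q (z + u w)\<^sup>2\<close>.\<close>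

lemma legendre_ternary:
  fixes n q :: nat
  assumes pos: "n \<ge> 1" "q \<ge> 1" and cop: "coprime n q"
    and al: "\<exists>y. [y ^ 2 = int n] (mod int q)" and be: "\<exists>y. [y ^ 2 = - int q] (mod int n)"
  obtains w z u :: int where "w > 0" "int n * w ^ 2 = z ^ 2 + int q * u ^ 2"
proof -
  obtain \<alpha> \<beta> :: int where al: "[\<alpha> ^ 2 = int n] (mod int q)" and be: "[\<beta> ^ 2 = - int q] (mod int n)"
    using assms by blast
  have cop': "coprime (int q) (int n)" using cop by (simp add: coprime_commute)
  obtain A where A: "[A = \<alpha>] (mod int q)" "[A = 0] (mod int n)"
    using binary_chinese_remainder_int[OF cop'] by blast
  obtain B where B: "[B = 0] (mod int q)" "[B = \<beta>] (mod int n)"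
    using binary_chinese_remainder_int[OF cop'] by blast
  obtain w u z :: int where s: "w ^ 2 < int q" "u ^ 2 < int n" "z ^ 2 \<le> int (n * q)"
    "(w, u, z) \<noteq> (0, 0, 0)" "int (n * q) dvd z - A * w - B * u"
    using small_congruence_solution[OF pos] by blast
  have z: "[z = A * w + B * u] (mod int (n * q))"
    using s(5) by (simp add: cong_iff_dvd_diff algebra_simps)
  \<comment> \<open>Since A w + B u reduces to \<alpha> w modulo q and to \<beta> u modulo n, V
    vanishes modulo n q. The size bounds give - n q < V < 2 n q, so V is 0 or n q.\<close>
  define V where "V = z ^ 2 + int q * u ^ 2 - int n * w ^ 2"
  have "int q dvd V"
  proof -
    have "[z = A * w + B * u] (mod int q)" using z by (auto intro: cong_dvd_modulus)
    also have "[A * w + B * u = \<alpha> * w + 0 * u] (mod int q)" using A B by (intro cong_add cong_mult) auto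
    finally have "[z ^ 2 = (\<alpha> * w) ^ 2] (mod int q)" by (intro cong_pow) simp
    also have "[(\<alpha> * w) ^ 2 = int n * w ^ 2] (mod int q)"
      unfolding power_mult_distrib using al by (intro cong_mult) auto
    finally have "int q dvd z ^ 2 - int n * w ^ 2" by (simp add: cong_iff_dvd_diff)
    then have "int q dvd (z ^ 2 - int n * w ^ 2) + int q * u ^ 2" by simp
    then show ?thesis by (simp add: V_def algebra_simps)
  qed
  moreover have "int n dvd V"
  proof -
    have "[z = A * w + B * u] (mod int n)" using z by (auto intro: cong_dvd_modulus)
    also have "[A * w + B * u = 0 * w + \<beta> * u] (mod int n)" using A B by (intro cong_add cong_mult) auto
    finally have "[z ^ 2 = (\<beta> * u) ^ 2] (mod int n)" by (intro cong_pow) simp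
    also have "[(\<beta> * u) ^ 2 = - int q * u ^ 2] (mod int n)"
      unfolding power_mult_distrib using be by (intro cong_mult) auto
    finally have "int n dvd z ^ 2 - (- int q * u ^ 2)" by (simp add: cong_iff_dvd_diff)
    then have "int n dvd (z ^ 2 - (- int q * u ^ 2)) - int n * w ^ 2" by simp
    then show ?thesis by (simp add: V_def)
  qed
  ultimately have "int n * int q dvd V" using cop' by (simp add: divides_mult coprime_commute)
  then obtain k where k: "V = int n * int q * k" by blast
  have nq: "int n * int q > 0" using pos by simp
  have "int n * w ^ 2 < int n * int q" using s(1) pos by simp
  moreover have "int q * u ^ 2 < int n * int q" using s(2) pos by (simp add: mult.commute)
  moreover have "0 \<le> z ^ 2" "0 \<le> int q * u ^ 2" "0 \<le> int n * w ^ 2" by simp_all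
  ultimately have "int n * int q * (- 1) < V" "V < int n * int q * 2"
    using s(3) unfolding V_def by (simp_all, linarith+)
  then have "- 1 < k" "k < 2" unfolding k using nq by (simp_all only: mult_less_cancel_left_pos)
  then consider "k = 0" | "k = 1" by linarith
  then show ?thesis
  proof cases
    case 1
    then have eq: "int n * w ^ 2 = z ^ 2 + int q * u ^ 2" using k by (simp add: V_def)
    have "w \<noteq> 0"
    proof
      assume w: "w = 0"
      have "z ^ 2 + int q * u ^ 2 = 0" using eq w by simp
      then have "z ^ 2 = 0 \<and> int q * u ^ 2 = 0" by (subst (asm) add_nonneg_eq_0_iff) auto
      then show False using s(4) w pos by auto
    qed
    then have "\<bar>w\<bar> > 0" "int n * \<bar>w\<bar> ^ 2 = z ^ 2 + int q * u ^ 2" using eq by simp_all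
    then show ?thesis by (rule that)
  next
    case 2
    then have eq: "z ^ 2 + int q * u ^ 2 = int n * (w ^ 2 + int q)"
      using k by (simp add: V_def algebra_simps)
    have "int n * (w ^ 2 + int q) ^ 2 = (z ^ 2 + int q * u ^ 2) * (w ^ 2 + int q)"
      unfolding eq by (simp add: power2_eq_square)
    also have "\<dots> = (z * w - int q * u) ^ 2 + int q * (z + u * w) ^ 2"
      by (simp add: power2_eq_square algebra_simps)
    finally show ?thesis using pos by (intro that[of "w ^ 2 + int q"]) (auto simp: add_nonneg_pos)
  qed
qed

lemma nearest_multiple:
  fixes x w :: int
  assumes "w > 0"
  obtains X where "4 * (x - w * X) ^ 2 \<le> w ^ 2"
proof -
  define X where "X = (2 * x + w) div (2 * w)"
  have "2 * x + w = 2 * w * X + (2 * x + w) mod (2 * w)" by (simp add: X_def)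
  moreover have "0 \<le> (2 * x + w) mod (2 * w)" "(2 * x + w) mod (2 * w) < 2 * w" using assms by simp_all
  moreover have "2 * (x - w * X) = 2 * x + w - 2 * w * X - w" by (simp add: algebra_simps)
  ultimately have "\<bar>2 * (x - w * X)\<bar> \<le> \<bar>w\<bar>" using assms by linarith
  then have "(2 * (x - w * X)) ^ 2 \<le> w ^ 2" by (simp only: abs_le_square_iff)
  moreover have "(2 * (x - w * X)) ^ 2 = 4 * (x - w * X) ^ 2" by (simp only: power_mult_distrib) simp
  ultimately show ?thesis using that[of X] by simp
qed

text \<open>The line through the rational point \<open>(x, y, z) / w\<close> of the sphere and the nearest integral
  point meets the sphere in a second point, whose denominator is smaller.\<close>

lemma davenport_cassels:
  fixes n :: int
  assumes "w > 0" "n * int w ^ 2 = x ^ 2 + y ^ 2 + z ^ 2"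
  shows "\<exists>a b c :: int. n = a ^ 2 + b ^ 2 + c ^ 2"
  using assms
proof (induction w arbitrary: x y z rule: less_induct)
  case (less w)
  define W where "W = int w"
  have W: "W > 0" "n * W ^ 2 = x ^ 2 + y ^ 2 + z ^ 2" using less.prems by (simp_all add: W_def)
  obtain X where X: "4 * (x - W * X) ^ 2 \<le> W ^ 2" using nearest_multiple[OF W(1)] .
  obtain Y where Y: "4 * (y - W * Y) ^ 2 \<le> W ^ 2" using nearest_multiple[OF W(1)] .
  obtain Z where Z: "4 * (z - W * Z) ^ 2 \<le> W ^ 2" using nearest_multiple[OF W(1)] .
  \<comment> \<open>The weights a W and b express the second intersection point, with numerators a x
    + b X and so on over W', as an affine combination of the two given points. By \<open>R\<close>,
    W' / W is the squared distance between these.\<close>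
  define a where "a = X ^ 2 + Y ^ 2 + Z ^ 2 - n"
  define b where "b = 2 * (n * W - (x * X + y * Y + z * Z))"
  define W' where "W' = a * W + b"
  have R: "W * W' = (x - W * X) ^ 2 + (y - W * Y) ^ 2 + (z - W * Z) ^ 2"
  proof -
    have "W * W' = W ^ 2 * (X ^ 2 + Y ^ 2 + Z ^ 2) + n * W ^ 2 - 2 * W * (x * X + y * Y + z * Z)"
      by (simp add: W'_def a_def b_def power2_eq_square algebra_simps)
    then show ?thesis unfolding W(2) by (simp add: power2_eq_square algebra_simps)
  qed
  show ?case
  proof (cases "W' = 0")
    case True
    then have "(x - W * X) ^ 2 + (y - W * Y) ^ 2 + (z - W * Z) ^ 2 = 0" using R by simp
    then have "x - W * X = 0 \<and> y - W * Y = 0 \<and> z - W * Z = 0"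
      by (simp add: add_nonneg_eq_0_iff)
    then have "n * W ^ 2 = (X ^ 2 + Y ^ 2 + Z ^ 2) * W ^ 2"
      unfolding W(2) by (simp add: power2_eq_square algebra_simps)
    then have "n = X ^ 2 + Y ^ 2 + Z ^ 2" using W(1) by simp
    then show ?thesis by blast
  next
    case False
    have "0 \<le> W * W'" unfolding R by simp
    then have W'0: "W' > 0" using False W(1) by (simp add: zero_le_mult_iff)
    have "0 < W ^ 2" using W(1) by simp
    \<comment> \<open>Each coordinate is off by at most 1/2, so the squared distance is at most 3/4
      and W' < W.\<close>
    moreover have "4 * (W * W') \<le> 3 * W ^ 2"
      using add_mono[OF add_mono[OF X Y] Z] unfolding R by (simp add: distrib_left)
    ultimately have "4 * (W * W') < 4 * W ^ 2" by linarith
    then have "W' < W" using W(1) by (simp add: power2_eq_square)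
    then have lt: "nat W' < w" using W'0 by (simp add: W_def)
    have "(a * x + b * X) ^ 2 + (a * y + b * Y) ^ 2 + (a * z + b * Z) ^ 2
        = a ^ 2 * (x ^ 2 + y ^ 2 + z ^ 2) + 2 * a * b * (x * X + y * Y + z * Z) + b ^ 2 * (X ^ 2 + Y ^ 2 + Z ^ 2)"
      by (simp add: power2_eq_square algebra_simps)
    also have "\<dots> = a ^ 2 * (n * W ^ 2) + a * b * (2 * n * W - b) + b ^ 2 * (a + n)"
      unfolding W(2)[symmetric] by (simp add: a_def b_def algebra_simps)
    also have "\<dots> = n * W' ^ 2" by (simp add: W'_def power2_eq_square algebra_simps)
    finally have "n * int (nat W') ^ 2 = (a * x + b * X) ^ 2 + (a * y + b * Y) ^ 2 + (a * z + b * Z) ^ 2"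
      using W'0 by simp
    then show ?thesis using less.IH[OF lt] W'0 by simp
  qed
qed

section \<open>Quadratic residue symbols\<close>

lemma Legendre_cases: "Legendre a p = 1 \<or> Legendre a p = -1 \<or> Legendre a p = 0"
  by (simp add: Legendre_def)

text \<open>Turns Euler's congruences into equalities: elements of {-1, 0, 1} differ by at most 2 <
  p.\<close>

lemma cong_unit_values_eq:
  fixes x y :: int and p :: nat
  assumes "[x = y] (mod int p)" "2 < p" "x = 1 \<or> x = -1 \<or> x = 0" "y = 1 \<or> y = -1 \<or> y = 0"
  shows "x = y"
proof (rule ccontr)
  assume "x \<noteq> y"
  moreover have "int p dvd x - y" using assms(1) by (simp add: cong_iff_dvd_diff)
  ultimately have "int p \<le> \<bar>x - y\<bar>" using zdvd_imp_le[of "int p" "\<bar>x - y\<bar>"] by simp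
  then show False using assms by auto
qed

lemma Legendre_cong: "[a = b] (mod int p) \<Longrightarrow> Legendre a (int p) = Legendre b (int p)"
proof -
  assume ab: "[a = b] (mod int p)"
  have "[a = 0] (mod int p) \<longleftrightarrow> [b = 0] (mod int p)" "QuadRes (int p) a \<longleftrightarrow> QuadRes (int p) b"
    using ab unfolding QuadRes_def by (auto simp: cong_def)
  then show ?thesis unfolding Legendre_def by simp
qed

lemma Legendre_mult:
  assumes p: "prime p" "2 < p"
  shows "Legendre (a * b) (int p) = Legendre a (int p) * Legendre b (int p)"
proof (rule cong_unit_values_eq[OF _ p(2)])
  have "[Legendre (a * b) (int p) = (a * b) ^ ((p - 1) div 2)] (mod int p)"
    by (rule euler_criterion[OF p])
  also have "(a * b) ^ ((p - 1) div 2) = a ^ ((p - 1) div 2) * b ^ ((p - 1) div 2)"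
    by (rule power_mult_distrib)
  also have "[\<dots> = Legendre a (int p) * Legendre b (int p)] (mod int p)"
    by (intro cong_mult cong_sym[OF euler_criterion[OF p]])
  finally show "[Legendre (a * b) (int p) = Legendre a (int p) * Legendre b (int p)] (mod int p)" .
  show "Legendre a (int p) * Legendre b (int p) = 1 \<or> Legendre a (int p) * Legendre b (int p) = -1
      \<or> Legendre a (int p) * Legendre b (int p) = 0"
    using Legendre_cases[of a "int p"] Legendre_cases[of b "int p"] by (elim disjE) simp_all
qed (rule Legendre_cases)

lemma Legendre_eq_0_iff: "Legendre a (int p) = 0 \<longleftrightarrow> int p dvd a"
  by (auto simp: Legendre_def cong_0_iff)

lemma Legendre_1_imp_square: "Legendre a p = 1 \<Longrightarrow> \<exists>y. [y ^ 2 = a] (mod p)"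
  by (auto simp: Legendre_def QuadRes_def split: if_splits)

lemma Legendre_1:
  assumes p: "prime p" "2 < p"
  shows "Legendre 1 (int p) = 1"
proof -
  have "Legendre 1 (int p) = Legendre 1 (int p) * Legendre 1 (int p)"
    using Legendre_mult[OF p, of 1 1] by simp
  moreover have "Legendre 1 (int p) \<noteq> 0" using p by (simp add: Legendre_eq_0_iff)
  ultimately show ?thesis by simp
qed

lemma Legendre_prod:
  assumes p: "prime p" "2 < p" and "finite A"
  shows "Legendre (\<Prod>a\<in>A. f a) (int p) = (\<Prod>a\<in>A. Legendre (f a) (int p))"
  using assms(3) by (induction A) (simp_all add: Legendre_1[OF p] Legendre_mult[OF p])

text \<open>On odd n this is (-1)^((n - 1) / 2), the symbol of -1; even arguments get the default
  -1.\<close>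

definition chi4 :: "nat \<Rightarrow> int" where
  "chi4 n = (if n mod 4 = 1 then 1 else -1)"

text \<open>On odd n this is (-1)^((n^2 - 1) / 8), the symbol of 2; even arguments get the default
  -1.\<close>

definition chi8 :: "nat \<Rightarrow> int" where
  "chi8 n = (if n mod 8 \<in> {1, 7} then 1 else -1)"

lemma odd_mod_8: "odd n \<Longrightarrow> (n::nat) mod 8 = 1 \<or> n mod 8 = 3 \<or> n mod 8 = 5 \<or> n mod 8 = 7"
  by presburger

lemma chi4_mod_8: "chi4 n = (if n mod 8 \<in> {1, 5} then 1 else -1)"
proof -
  have "n mod 4 = 1 \<longleftrightarrow> n mod 8 = 1 \<or> n mod 8 = 5" by presburger
  then show ?thesis by (simp add: chi4_def)
qed

lemma
  assumes "odd a" "odd b"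
  shows chi4_mult: "chi4 (a * b) = chi4 a * chi4 b"
    and chi8_mult: "chi8 (a * b) = chi8 a * chi8 b"
proof -
  have "a * b mod 8 = (a mod 8) * (b mod 8) mod 8" by (simp add: mod_mult_eq)
  then show "chi4 (a * b) = chi4 a * chi4 b" "chi8 (a * b) = chi8 a * chi8 b"
    using odd_mod_8[OF assms(1)] odd_mod_8[OF assms(2)]
    unfolding chi4_mod_8 chi8_def by (elim disjE; simp)+
qed

lemma chi4_prod: "finite P \<Longrightarrow> (\<And>p. p \<in> P \<Longrightarrow> odd p) \<Longrightarrow> chi4 (\<Prod>P) = (\<Prod>p\<in>P. chi4 p)"
  by (induction P rule: finite_induct) (simp_all add: chi4_mult even_prod_iff, simp add: chi4_def)

lemma chi8_prod: "finite P \<Longrightarrow> (\<And>p. p \<in> P \<Longrightarrow> odd p) \<Longrightarrow> chi8 (\<Prod>P) = (\<Prod>p\<in>P. chi8 p)"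
  by (induction P rule: finite_induct) (simp_all add: chi8_mult even_prod_iff, simp add: chi8_def)

lemma Legendre_minus_1:
  assumes p: "prime p" "2 < p"
  shows "Legendre (- 1) (int p) = chi4 p"
proof (rule cong_unit_values_eq[OF _ p(2)])
  have "odd p" using p prime_odd_nat by blast
  then have "(-1::int) ^ ((p - 1) div 2) = chi4 p"
    unfolding chi4_def minus_one_power_iff by presburger
  then show "[Legendre (- 1) (int p) = chi4 p] (mod int p)" using euler_criterion[OF p, of "-1"] by simp
qed (use Legendre_cases in \<open>auto simp: chi4_def\<close>)

lemma Legendre_2:
  assumes p: "prime p" "2 < p"
  shows "Legendre 2 (int p) = chi8 p"
proof -
  have odd: "odd p" using p prime_odd_nat by blast
  interpret GAUSS p 2
    by unfold_locales (use p zdvd_imp_le[of "int p" 2] in \<open>auto simp: cong_0_iff\<close>)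
  define h where "h = (p - 1) div 2"
  have ph: "p = 2 * h + 1" using odd p by (auto simp: h_def elim!: oddE)
  have hh: "(int p - 1) div 2 = int h" using ph by simp
  have B: "B = (\<lambda>x. x * 2) ` {0<..int h}" unfolding B_def A_def hh ..
  \<comment> \<open>The multiples 2, 4, ..., p - 1 are already reduced modulo p, so Gauss's lemma
    counts the x with h div 2 < x <= h.\<close>
  have "C = B" unfolding C_def B
    by (auto simp: image_image ph intro!: image_cong mod_pos_pos_trivial)
  then have E: "E = (\<lambda>x. x * 2) ` {int (h div 2)<..int h}"
    unfolding E_def B hh by (auto simp: image_iff) (presburger+)?
  have "card E = h - h div 2" unfolding E by (subst card_image) (auto simp: inj_on_def)
  then have "Legendre 2 (int p) = (- 1) ^ (h - h div 2)" using gauss_lemma by simp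
  also have "even (h - h div 2) \<longleftrightarrow> p mod 8 = 1 \<or> p mod 8 = 7"
    unfolding ph by presburger
  then have "(- 1) ^ (h - h div 2) = chi8 p"
    by (simp add: chi8_def minus_one_power_iff)
  finally show ?thesis .
qed

lemma square_mod_prod_primes:
  fixes a :: int
  assumes "finite P" "\<And>p. p \<in> P \<Longrightarrow> prime p" "\<And>p. p \<in> P \<Longrightarrow> \<exists>y. [y ^ 2 = a] (mod int p)"
  shows "\<exists>y. [y ^ 2 = a] (mod int (\<Prod>P))"
  using assms
proof (induction P rule: finite_induct)
  case (insert p P)
  obtain y where y: "[y ^ 2 = a] (mod int (\<Prod>P))" using insert by auto
  obtain z where z: "[z ^ 2 = a] (mod int p)" using insert by auto
  have "coprime p (\<Prod>P)"
    by (rule prod_coprime_right) (use insert in \<open>auto intro!: primes_coprime\<close>)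
  then have cop: "coprime (int p) (int (\<Prod>P))" by (simp only: coprime_int_iff)
  then obtain x where x: "[x = z] (mod int p)" "[x = y] (mod int (\<Prod>P))"
    using binary_chinese_remainder_int by blast
  have "[x ^ 2 = a] (mod int p)" "[x ^ 2 = a] (mod int (\<Prod>P))"
    using cong_pow[OF x(1), of 2] cong_pow[OF x(2), of 2] y z cong_trans by blast+
  then have "[x ^ 2 = a] (mod (int p * int (\<Prod>P)))" using cop coprime_cong_mult by blast
  then show ?case using insert by auto
qed auto

lemma real_char_odd_residue:
  fixes g :: "nat \<Rightarrow> int"
  assumes "\<And>a. g a = 1 \<or> g a = -1" "\<And>a b. odd a \<Longrightarrow> odd b \<Longrightarrow> g (a * b) = g a * g b"
    "\<And>a. g (a mod 8) = g a" "8 dvd M"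
  shows "real_char M (\<lambda>n. if coprime n M then of_int (g n) else 0)"
proof -
  have "odd a" if "coprime a M" for a
  proof -
    have "2 dvd M" using assms(4) by (rule dvd_trans[rotated]) simp
    then have "coprime a 2" by (rule coprime_divisors[OF dvd_refl _ that])
    then show ?thesis by simp
  qed
  moreover have "coprime (a + M) M \<longleftrightarrow> coprime a M" for a
    by (simp add: coprime_iff_gcd_eq_1 del: coprime_imp_gcd_eq_1)
  moreover have "g (a + M) = g a" for a
    using assms(3)[of "a + M"] assms(3)[of a] assms(4) by (auto elim!: dvdE)
  moreover have "(if coprime a M then of_int (g a) else 0 :: real) \<in> (if coprime a M then {1, -1} else {0})" for a
    using assms(1)[of a] by auto
  ultimately show ?thesis using assms(2) unfolding real_char_def by simp
qed

lemma real_char_Legendre: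
  assumes p: "prime p" "2 < p" "p dvd M"
  shows "real_char M (\<lambda>n. if coprime n M then of_int (Legendre (int n) (int p)) else 0)"
proof -
  have "coprime (a + M) M \<longleftrightarrow> coprime a M" for a
    by (simp add: coprime_iff_gcd_eq_1 del: coprime_imp_gcd_eq_1)
  moreover have "Legendre (int (a + M)) (int p) = Legendre (int a) (int p)" for a
    by (rule Legendre_cong) (use p(3) in \<open>auto simp: cong_iff_dvd_diff\<close>)
  moreover have "(if coprime a M then of_int (Legendre (int a) (int p)) else 0 :: real) \<in> (if coprime a M then {1, -1} else {0})" for a
  proof (cases "coprime a M")
    case True
    then have "\<not> p dvd a" using p by (metis coprime_common_divisor not_prime_unit)
    then have "Legendre (int a) (int p) \<noteq> 0" by (simp add: Legendre_eq_0_iff)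
    then show ?thesis using Legendre_cases[of "int a" "int p"] True by auto
  qed simp
  ultimately show ?thesis using Legendre_mult[OF p(1,2)] unfolding real_char_def by simp
qed

text \<open>N solves the congruences without being prime. \<open>chi4\<close>, \<open>chi8\<close>
  and the Legendre symbols are real characters modulo 8 m, so q inherits their values from N, and
  \<open>chi4\<close> with \<open>chi8\<close> determines an odd residue modulo 8.\<close>

lemma exists_prime_with_symbols:
  fixes e :: int and r :: nat
  assumes P: "finite P" "\<And>p. p \<in> P \<Longrightarrow> prime p \<and> 2 < p" and e: "\<And>p. p \<in> P \<Longrightarrow> \<not> int p dvd e"
    and r: "odd r" "r < 8"
  obtains q where "prime q" "q mod 8 = r" "q \<notin> P" "\<And>p. p \<in> P \<Longrightarrow> Legendre (int q) (int p) = Legendre e (int p)"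
proof -
  define m where "m = \<Prod>P"
  have m0: "m > 0" using P by (auto simp: m_def intro!: prod_pos prime_gt_0_nat)
  have "odd p" if "p \<in> P" for p using P(2)[OF that] prime_odd_nat by blast
  then have "odd m" using P(1) by (simp add: m_def even_prod_iff)
  then have "coprime m (2 ^ 3)" by (simp only: coprime_power_right_iff coprime_right_2_iff_odd) simp
  then have cop: "coprime m 8" by simp
  obtain N where N: "[N = nat (e mod int m)] (mod m)" "[N = r] (mod 8)"
    using binary_chinese_remainder_nat[OF cop] by blast
  have "[int N = e mod int m] (mod int m)" using N(1) m0
    by (simp flip: cong_int_iff)
  then have Ne: "[int N = e] (mod int m)" by (simp add: cong_def)
  have N8: "N mod 8 = r" using N(2) r(2) by (simp add: cong_def)
  have pm: "p dvd m" if "p \<in> P" for p using that P(1) using dvd_prodI[OF P(1) that, of "\<lambda>x. x"] by (simp add: m_def)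
  have NP: "[int N = e] (mod int p)" if "p \<in> P" for p
    using Ne pm[OF that] cong_dvd_modulus by (metis int_dvd_int_iff)
  have "coprime N p" if "p \<in> P" for p
  proof -
    have "\<not> int p dvd int N" using e[OF that] NP[OF that] cong_dvd_iff by blast
    then show ?thesis using P(2)[OF that] prime_imp_coprime coprime_commute by (metis int_dvd_int_iff)
  qed
  then have "coprime N m" unfolding m_def by (rule prod_coprime_right)
  moreover have "odd N" using N8 r(1) by presburger
  then have "coprime N (2 ^ 3)" by (simp only: coprime_power_right_iff coprime_right_2_iff_odd) simp
  ultimately have NM: "coprime N (8 * m)" by simp
  obtain q where q: "prime q" "coprime q (8 * m)" "\<And>f. real_char (8 * m) f \<Longrightarrow> f q = f N"
    using exists_prime_same_real_chars[OF _ NM] m0 by auto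
  have "real_char (8 * m) (\<lambda>n. if coprime n (8 * m) then of_int (chi4 n) else 0)"
    by (rule real_char_odd_residue) (simp_all add: chi4_mult, simp_all add: chi4_mod_8)
  from q(3)[OF this] have c4: "chi4 q = chi4 N" using q(2) NM by (simp del: coprime_mult_right_iff)
  have "real_char (8 * m) (\<lambda>n. if coprime n (8 * m) then of_int (chi8 n) else 0)"
    by (rule real_char_odd_residue) (simp_all add: chi8_mult, simp_all add: chi8_def)
  from q(3)[OF this] have c8: "chi8 q = chi8 N" using q(2) NM by (simp del: coprime_mult_right_iff)
  have "coprime q 2" by (rule coprime_divisors[OF dvd_refl _ q(2)]) simp
  then have "odd q" by simp
  then have "q mod 8 = r" using c4 c8 odd_mod_8[of q] odd_mod_8[OF \<open>odd N\<close>] N8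
    unfolding chi4_mod_8 chi8_def by (elim disjE) (auto split: if_splits)
  moreover have "q \<notin> P"
  proof
    assume "q \<in> P"
    then have "q dvd 8 * m" using pm by simp
    then have "is_unit q" using q(2) coprime_common_divisor[of q "8 * m" q] by simp
    then show False using q(1) by simp
  qed
  moreover have "Legendre (int q) (int p) = Legendre e (int p)" if p: "p \<in> P" for p
  proof -
    have "real_char (8 * m) (\<lambda>n. if coprime n (8 * m) then of_int (Legendre (int n) (int p)) else 0)"
      using P(2)[OF p] pm[OF p] by (intro real_char_Legendre) auto
    from q(3)[OF this] have "Legendre (int q) (int p) = Legendre (int N) (int p)"
      using q(2) NM by (simp del: coprime_mult_right_iff)
    then show ?thesis using Legendre_cong[OF NP[OF p]] by simp
  qed
  ultimately show ?thesis using that q(1) by blast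
qed

section \<open>Sums of three squares\<close>

text \<open>Substituting one equation into the other gives n (w v)^2 = (z v)^2 + (c u)^2 + (d u)^2.
  The second equation is \<open>legendre_ternary\<close> for the pair (a, 1), where the condition
  modulo 1 is empty.\<close>

lemma three_squares_from_splitting:
  fixes n a :: nat
  assumes pos: "n \<ge> 1" "a \<ge> 1" and cop: "coprime n a"
    and 1: "\<exists>y. [y ^ 2 = int n] (mod int a)" and 2: "\<exists>y. [y ^ 2 = - int a] (mod int n)"
    and 3: "\<exists>y. [y ^ 2 = - 1] (mod int a)"
  shows "\<exists>x y z :: int. int n = x ^ 2 + y ^ 2 + z ^ 2"
proof -
  obtain w z u :: int where w: "w > 0" "int n * w ^ 2 = z ^ 2 + int a * u ^ 2"
    using legendre_ternary[OF pos cop 1 2] by blast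
  have 4: "\<exists>y. [y ^ 2 = int a] (mod int 1)" "\<exists>y. [y ^ 2 = - int 1] (mod int a)" using 3 by auto
  obtain v c d :: int where v: "v > 0" "int a * v ^ 2 = c ^ 2 + int 1 * d ^ 2"
    using legendre_ternary[OF pos(2) order_refl _ 4] by auto
  have "int n * (w * v) ^ 2 = (z * v) ^ 2 + (int a * v ^ 2) * u ^ 2"
    using w(2) by (simp add: power_mult_distrib mult.assoc[symmetric]) (simp add: algebra_simps)
  also have "\<dots> = (z * v) ^ 2 + (c * u) ^ 2 + (d * u) ^ 2"
    unfolding v(2) by (simp add: algebra_simps)
  finally have "int n * int (nat (w * v)) ^ 2 = (z * v) ^ 2 + (c * u) ^ 2 + (d * u) ^ 2"
    using w(1) v(1) by simp
  then show ?thesis using davenport_cassels[of "nat (w * v)" "int n"] w(1) v(1) by simp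
qed

lemma Legendre_swap:
  assumes "prime p" "2 < p" "prime q" "2 < q" "p \<noteq> q" "q mod 4 = 1"
  shows "Legendre (int p) (int q) = Legendre (int q) (int p)"
proof -
  have "even ((q - 1) div 2)" using assms(6) by presburger
  then have "Legendre (int p) (int q) * Legendre (int q) (int p) = 1"
    using Quadratic_Reciprocity[OF assms(1-5)] by simp
  then show ?thesis
    using Legendre_cases[of "int p" "int q"] Legendre_cases[of "int q" "int p"] by (elim disjE) simp_all
qed

text \<open>Taking q = 1 mod 4 serves twice: reciprocity becomes symmetric, and -1 is a square
  modulo q. The choice e = -1 or e = -2 is made so that - q or - 2 q is a square modulo every p in
  P.\<close>

lemma prime_with_symbols:
  fixes P :: "nat set"
  assumes P: "finite P" "\<And>p. p \<in> P \<Longrightarrow> prime p \<and> 2 < p" and e: "e = -1 \<or> e = -2" and r: "r = 1 \<or> r = 5"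
  obtains q where "prime q" "q > 2" "q mod 8 = r" "coprime (\<Prod>P) q"
    "\<And>p. p \<in> P \<Longrightarrow> Legendre (int q) (int p) = Legendre e (int p)"
    "Legendre (int (\<Prod>P)) (int q) = (\<Prod>p\<in>P. Legendre e (int p))"
proof -
  have "\<not> int p dvd e" if "p \<in> P" for p
    using P(2)[OF that] e zdvd_imp_le[of "int p" "- e"] by auto
  moreover have "odd r" "r < 8" using r by auto
  ultimately obtain q where q: "prime q" "q mod 8 = r" "q \<notin> P"
    "\<And>p. p \<in> P \<Longrightarrow> Legendre (int q) (int p) = Legendre e (int p)"
    using exists_prime_with_symbols[OF P] \<open>odd r\<close> \<open>r < 8\<close> by blast
  have q2: "q > 2" using q(1,2) r prime_ge_2_nat[OF q(1)] by (cases "q = 2") auto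
  have q4: "q mod 4 = 1" using q(2) r by presburger
  have "coprime (\<Prod>P) q"
    by (rule prod_coprime_left) (use P q in \<open>auto intro!: primes_coprime\<close>)
  moreover have "Legendre (int (\<Prod>P)) (int q) = (\<Prod>p\<in>P. Legendre e (int p))"
  proof -
    have "Legendre (int (\<Prod>P)) (int q) = (\<Prod>p\<in>P. Legendre (int p) (int q))"
      using Legendre_prod[OF q(1) q2 P(1), of int] by simp
    also have "\<dots> = (\<Prod>p\<in>P. Legendre e (int p))"
      using P(2) q q2 q4 Legendre_swap by (intro prod.cong refl) metis
    finally show ?thesis .
  qed
  ultimately show ?thesis using that q q2 by blast
qed

text \<open>The splitting uses a = q with e = -1 for m = 1 mod 4 and for 2 m. For m = 3 mod 8 this
  would give the symbol \<open>chi4 m\<close> = -1; with e = -2 and a = 2 q it is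
  \<open>chi4 m * chi8 m\<close> = 1.\<close>

lemma three_squares_squarefree:
  fixes P :: "nat set"
  assumes P: "finite P" "\<And>p. p \<in> P \<Longrightarrow> prime p \<and> 2 < p"
  defines "m \<equiv> \<Prod>P"
  shows "m mod 4 = 1 \<Longrightarrow> \<exists>x y z :: int. int m = x ^ 2 + y ^ 2 + z ^ 2"
    and "m mod 8 = 3 \<Longrightarrow> \<exists>x y z :: int. int m = x ^ 2 + y ^ 2 + z ^ 2"
    and "\<exists>x y z :: int. int (2 * m) = x ^ 2 + y ^ 2 + z ^ 2"
proof -
  have m1: "m \<ge> 1" using P by (auto simp: m_def Suc_le_eq intro!: prod_pos prime_gt_0_nat)
  have oddP: "odd p" if "p \<in> P" for p using P(2)[OF that] prime_odd_nat by blast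
  then have oddm: "odd m" using P(1) by (simp add: m_def even_prod_iff)
  have neg1: "(\<Prod>p\<in>P. Legendre (- 1) (int p)) = chi4 m"
    unfolding m_def by (subst chi4_prod) (use P oddP in \<open>auto intro!: prod.cong Legendre_minus_1\<close>)
  have two: "(\<Prod>p\<in>P. Legendre 2 (int p)) = chi8 m"
    unfolding m_def by (subst chi8_prod) (use P oddP in \<open>auto intro!: prod.cong Legendre_2\<close>)
  have neg2: "(\<Prod>p\<in>P. Legendre (- 2) (int p)) = chi4 m * chi8 m"
  proof -
    have "(\<Prod>p\<in>P. Legendre (- 2) (int p)) = (\<Prod>p\<in>P. Legendre (- 1) (int p) * Legendre 2 (int p))"
      using P(2) Legendre_mult[of _ "-1" 2] by (intro prod.cong refl) auto
    then show ?thesis by (simp add: prod.distrib neg1 two)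
  qed
  have square_m: "\<exists>y. [y ^ 2 = a] (mod int m)" if "\<And>p. p \<in> P \<Longrightarrow> Legendre a (int p) = 1" for a
    unfolding m_def using P that by (intro square_mod_prod_primes Legendre_1_imp_square) auto
  have self: "Legendre e (int p) * Legendre e (int p) = 1" if "p \<in> P" "e = -1 \<or> e = -2" for e p
  proof -
    have "\<not> int p dvd e"
      using P(2)[OF that(1)] that(2) zdvd_imp_le[of "int p" "- e"] by auto
    then show ?thesis using Legendre_cases[of e "int p"] Legendre_eq_0_iff[of e p] by auto
  qed
  have two_square: "[a ^ 2 = a] (mod int 2)" for a :: int
    by (simp add: cong_iff_dvd_diff power2_eq_square)
  have minus1: "Legendre (- 1) (int q) = 1" if "prime q" "q > 2" "q mod 8 = r" "r = 1 \<or> r = 5" for q r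
    using Legendre_minus_1[OF that(1,2)] that(3,4) by (auto simp: chi4_mod_8)
  have sq_2q: "\<exists>y. [y ^ 2 = a] (mod int (2 * q))" if "prime q" "q > 2" "Legendre a (int q) = 1" for a q
  proof -
    have "\<exists>y. [y ^ 2 = a] (mod int p)" if "p \<in> {2, q}" for p
    proof (cases "p = q")
      case True
      then show ?thesis using Legendre_1_imp_square[OF \<open>Legendre a (int q) = 1\<close>] by simp
    next
      case False
      then have "p = 2" using that by simp
      then show ?thesis using two_square[of a] by auto
    qed
    then have "\<exists>y. [y ^ 2 = a] (mod int (\<Prod>{2, q}))"
      by (intro square_mod_prod_primes) (use that in auto)
    then show ?thesis using \<open>2 < q\<close> by simp
  qed
  {
    assume m4: "m mod 4 = 1"
    obtain q where q: "prime q" "q > 2" "q mod 8 = 1" "coprime m q"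
      "\<And>p. p \<in> P \<Longrightarrow> Legendre (int q) (int p) = Legendre (- 1) (int p)"
      "Legendre (int m) (int q) = chi4 m"
      using prime_with_symbols[OF P, of "-1" 1] neg1 unfolding m_def by metis
    have "Legendre (- int q) (int p) = 1" if "p \<in> P" for p
      using Legendre_mult[of p "-1" "int q"] P(2)[OF that] q(5)[OF that] self[OF that, of "-1"] by simp
    then have "\<exists>y. [y ^ 2 = - int q] (mod int m)" by (rule square_m)
    moreover have "Legendre (int m) (int q) = 1" using q(6) m4 by (simp add: chi4_def)
    then have "\<exists>y. [y ^ 2 = int m] (mod int q)" by (rule Legendre_1_imp_square)
    moreover have "Legendre (- 1) (int q) = 1" using minus1[OF q(1-3)] by simp
    then have "\<exists>y. [y ^ 2 = - 1] (mod int q)" by (rule Legendre_1_imp_square)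
    ultimately show "\<exists>x y z :: int. int m = x ^ 2 + y ^ 2 + z ^ 2"
      using m1 q(2,4) by (intro three_squares_from_splitting[of m q]) auto
  next
    assume m8: "m mod 8 = 3"
    obtain q where q: "prime q" "q > 2" "q mod 8 = 1" "coprime m q"
      "\<And>p. p \<in> P \<Longrightarrow> Legendre (int q) (int p) = Legendre (- 2) (int p)"
      "Legendre (int m) (int q) = chi4 m * chi8 m"
      using prime_with_symbols[OF P, of "-2" 1] neg2 unfolding m_def by metis
    have "Legendre (- int (2 * q)) (int p) = 1" if "p \<in> P" for p
      using Legendre_mult[of p "-2" "int q"] P(2)[OF that] q(5)[OF that] self[OF that, of "-2"] by simp
    then have sq: "\<exists>y. [y ^ 2 = - int (2 * q)] (mod int m)" by (rule square_m)
    have "Legendre (int m) (int q) = 1" using q(6) m8 by (simp add: chi4_mod_8 chi8_def)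
    then have "\<exists>y. [y ^ 2 = int m] (mod int (2 * q))" by (rule sq_2q[OF q(1,2)])
    moreover have "\<exists>y. [y ^ 2 = - 1] (mod int (2 * q))"
      using minus1[OF q(1-3)] by (intro sq_2q[OF q(1,2)]) simp
    moreover have "coprime m (2 * q)" using q(4) oddm by simp
    ultimately show "\<exists>x y z :: int. int m = x ^ 2 + y ^ 2 + z ^ 2"
      using m1 q(2) sq by (intro three_squares_from_splitting[of m "2 * q"]) auto
  next
    \<comment> \<open>This r makes \<open>chi8 q\<close> equal to \<open>chi4 m\<close>; their
      product is the symbol of 2 m at q.\<close>
    define r :: nat where "r = (if m mod 4 = 1 then 1 else 5)"
    have r: "r = 1 \<or> r = 5" by (simp add: r_def)
    obtain q where q: "prime q" "q > 2" "q mod 8 = r" "coprime m q"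
      "\<And>p. p \<in> P \<Longrightarrow> Legendre (int q) (int p) = Legendre (- 1) (int p)"
      "Legendre (int m) (int q) = chi4 m"
      using prime_with_symbols[OF P _ r, of "-1"] neg1 unfolding m_def by metis
    have "Legendre (- int q) (int p) = 1" if "p \<in> P" for p
      using Legendre_mult[of p "-1" "int q"] P(2)[OF that] q(5)[OF that] self[OF that, of "-1"] by simp
    then have "\<exists>y. [y ^ 2 = - int q] (mod int p)" if "p \<in> insert 2 P" for p
      using that two_square[of "- int q"] Legendre_1_imp_square by (auto simp del: of_nat_numeral)
    then have "\<exists>y. [y ^ 2 = - int q] (mod int (\<Prod>(insert 2 P)))"
      using P by (intro square_mod_prod_primes) auto
    moreover have "2 \<notin> P" using P(2) by auto
    ultimately have "\<exists>y. [y ^ 2 = - int q] (mod int (2 * m))" using P(1) by (simp add: m_def)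
    moreover have "Legendre (int (2 * m)) (int q) = 1"
    proof -
      have "Legendre (int (2 * m)) (int q) = chi8 q * chi4 m"
        using Legendre_mult[OF q(1,2), of 2 "int m"] Legendre_2[OF q(1,2)] q(6) by simp
      then show ?thesis using q(3) by (auto simp: r_def chi4_def chi8_def split: if_splits)
    qed
    then have "\<exists>y. [y ^ 2 = int (2 * m)] (mod int q)" by (rule Legendre_1_imp_square)
    moreover have "\<exists>y. [y ^ 2 = - 1] (mod int q)"
      using minus1[OF q(1-3) r] by (rule Legendre_1_imp_square)
    moreover have "odd q" using q(1,2) prime_odd_nat by blast
    then have "coprime (2 * m) q" using q(4) by simp
    ultimately show "\<exists>x y z :: int. int (2 * m) = x ^ 2 + y ^ 2 + z ^ 2"
      using m1 q(2) by (intro three_squares_from_splitting[of "2 * m" q]) auto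
  }
qed

lemma squarefree_eq_prod_prime_factors:
  fixes n :: nat
  assumes "squarefree n"
  shows "\<Prod>(prime_factors n) = n"
proof -
  have n0: "n \<noteq> 0"
    using assms by (cases "n = 0") (auto simp: squarefree_def dest: spec[of _ 0] spec[of _ 2])
  have "(\<Prod>p\<in>prime_factors n. p ^ multiplicity p n) = n"
    using prod_prime_factors[OF n0] by simp
  moreover have "multiplicity p n = 1" if "p \<in> prime_factors n" for p
    using assms that squarefree_factorial_semiring'[OF n0] by blast
  ultimately show ?thesis by simp
qed

lemma three_squares:
  fixes n :: nat
  assumes "\<nexists>k l. n = 4 ^ k * (8 * l + 7)"
  obtains x y z :: int where "int n = x ^ 2 + y ^ 2 + z ^ 2"
proof (cases "n = 0")
  case True
  then show ?thesis using that[of 0 0 0] by simp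
next
  case False
  define t where "t = squarefree_part n"
  define s where "s = square_part n"
  have n: "n = t * s ^ 2" unfolding t_def s_def by (rule squarefree_decompose)
  have sf: "squarefree t" using squarefree_squarefree_part[of n] by (simp add: t_def)
  have s0: "s \<noteq> 0" using False n by auto
  \<comment> \<open>The factor s^2 is a power of 4 times an odd square, which is 1 mod 8, so t = 7
    mod 8 would make n exceptional.\<close>
  have t8: "t mod 8 \<noteq> 7"
  proof
    assume t: "t mod 8 = 7"
    obtain u where u: "s = 2 ^ multiplicity 2 s * u" "odd u"
      using multiplicity_decompose'[of s 2] s0 by (auto simp del: power_eq_0_iff)
    define k where "k = multiplicity 2 s"
    have u1: "s = 2 ^ k * u" using u(1) by (simp only: k_def)
    have "u ^ 2 mod 8 = 1"
    proof -
      have "u ^ 2 mod 8 = (u mod 8) ^ 2 mod 8" by (simp add: power_mod)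
      then show ?thesis using odd_mod_8[OF u(2)] by auto
    qed
    then have "t * u ^ 2 mod 8 = 7" using t by (metis mod_mult_eq mod_mod_trivial mult.right_neutral)
    then have "t * u ^ 2 = 8 * (t * u ^ 2 div 8) + 7" by presburger
    moreover have "n = 4 ^ k * (t * u ^ 2)"
      unfolding n u1 by (simp add: power_mult_distrib power_mult[symmetric] mult.commute[of k]) (simp add: power_mult)
    ultimately show False using assms by metis
  qed
  have primes: "prime p \<and> 2 < p" if "odd m" "p \<in> prime_factors m" for m p :: nat
    using that prime_ge_2_nat[of p] by (cases "p = 2") (auto simp: in_prime_factors_iff)
  have "\<exists>x y z :: int. int t = x ^ 2 + y ^ 2 + z ^ 2"
  proof (cases "even t")
    case False
    have "t mod 4 = 1 \<or> t mod 8 = 3" using t8 odd_mod_8[OF False] by presburger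
    then show ?thesis
      using three_squares_squarefree[of "prime_factors t", OF _ primes[OF False]]
      unfolding squarefree_eq_prod_prime_factors[OF sf] by auto
  next
    case True
    then obtain m where m: "t = 2 * m" by blast
    have "odd m"
    proof
      assume "even m"
      then have "2 ^ 2 dvd t" using m by auto
      then have "is_unit (2::nat)" using sf unfolding squarefree_def by blast
      then show False by simp
    qed
    have "squarefree m" using sf m squarefree_multD by blast
    from three_squares_squarefree(3)[of "prime_factors m", OF _ primes[OF \<open>odd m\<close>]]
    show ?thesis unfolding squarefree_eq_prod_prime_factors[OF \<open>squarefree m\<close>] m by simp
  qed
  then obtain x y z :: int where "int t = x ^ 2 + y ^ 2 + z ^ 2" by blast
  then have "int n = (x * int s) ^ 2 + (y * int s) ^ 2 + (z * int s) ^ 2"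
    by (simp add: n algebra_simps)
  then show ?thesis by (rule that)
qed

section \<open>Ternary forms and divisibility by 3\<close>

lemma three_squares_mod_8:
  fixes n :: nat
  assumes "n mod 4 \<noteq> 0" "n mod 8 \<noteq> 7"
  obtains x y z :: int where "int n = x ^ 2 + y ^ 2 + z ^ 2"
proof (rule three_squares[of n])
  show "\<nexists>k l. n = 4 ^ k * (8 * l + 7)"
  proof safe
    fix k l assume "n = 4 ^ k * (8 * l + 7)"
    with assms show False by (cases k) simp_all
  qed
qed (use that in blast)

lemma exceptional_mod_4: "(4 ^ k * (8 * l + 7)) mod 4 = (if k = 0 then 3 else 0 :: nat)"
proof (cases k)
  case 0
  have "(8 * l + 7) mod 4 = 3" by presburger
  then show ?thesis using 0 by simp
qed simp

lemma square_mod_8_int: "(x::int) ^ 2 mod 8 = 0 \<or> x ^ 2 mod 8 = 1 \<or> x ^ 2 mod 8 = 4"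
proof -
  have "x mod 8 \<in> {0, 1, 2, 3, 4, 5, 6, 7}" by auto
  then have "(x mod 8) ^ 2 mod 8 \<in> {0, 1, 4}" by auto
  then show ?thesis by (simp add: power_mod)
qed

lemma square_mod_4: "(x::int) ^ 2 mod 4 = (if even x then 0 else 1)"
proof (cases "even x")
  case False
  then obtain k where "x = 2 * k + 1" by (rule oddE)
  then have "x ^ 2 = 4 * (k ^ 2 + k) + 1" by (simp add: power2_eq_square algebra_simps)
  then show ?thesis using False by (simp only: mod_mult_self4) simp
qed (auto elim!: evenE simp: power_mult_distrib)

lemma sum_mod_3: "(a + b + c) mod m = (a mod m + b mod m + c mod m) mod (m::int)"
  by (metis mod_add_eq mod_add_left_eq)

text \<open>Descent: a sum of three squares divisible by 4 has only even variables, and 7 is not a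
  sum of three of the squares 0, 1, 4 modulo 8.\<close>

lemma three_squares_necessary:
  fixes x y z :: int
  shows "x ^ 2 + y ^ 2 + z ^ 2 \<noteq> 4 ^ k * (8 * l + 7)"
proof (induction k arbitrary: x y z)
  case 0
  have "(x ^ 2 + y ^ 2 + z ^ 2) mod 8 \<noteq> 7"
    unfolding sum_mod_3[of "x ^ 2" "y ^ 2" "z ^ 2"]
    using square_mod_8_int[of x] square_mod_8_int[of y] square_mod_8_int[of z]
    by (elim disjE; simp only:; simp)
  then show ?case by auto
next
  case (Suc k)
  show ?case
  proof
    assume eq: "x ^ 2 + y ^ 2 + z ^ 2 = 4 ^ Suc k * (8 * l + 7)"
    then have "(x ^ 2 + y ^ 2 + z ^ 2) mod 4 = 0" by simp
    then have "even x" "even y" "even z"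
      unfolding sum_mod_3[of "x ^ 2" "y ^ 2" "z ^ 2"] square_mod_4 by (simp_all split: if_splits)
    then obtain a b c where "x = 2 * a" "y = 2 * b" "z = 2 * c" by (auto elim!: evenE)
    then have "a ^ 2 + b ^ 2 + c ^ 2 = 4 ^ k * (8 * l + 7)" using eq by (simp add: power2_eq_square)
    then show False using Suc by blast
  qed
qed

lemma half_sum_of_squares:
  fixes a b :: int
  assumes "even (a + b)"
  obtains x y where "a ^ 2 + b ^ 2 = 2 * x ^ 2 + 2 * y ^ 2"
proof -
  obtain x where x: "a + b = 2 * x" using assms by blast
  then have "a = 2 * x - b" by (simp add: eq_diff_eq)
  have "a ^ 2 + b ^ 2 = 2 * x ^ 2 + 2 * (x - b) ^ 2"
    unfolding \<open>a = 2 * x - b\<close> by (simp add: power2_eq_square algebra_simps)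
  then show ?thesis by (rule that)
qed

text \<open>Division of a + b i by a Gaussian integer of norm 5; modulo 5 the sum is (a - 2 b) (a +
  2 b), and the vanishing factor tells which one divides.\<close>

lemma fifth_sum_of_squares:
  fixes a b :: int
  assumes "5 dvd a ^ 2 + b ^ 2"
  obtains x y where "a ^ 2 + b ^ 2 = 5 * x ^ 2 + 5 * y ^ 2"
proof -
  have *: "\<exists>x y. a ^ 2 + b ^ 2 = 5 * x ^ 2 + 5 * y ^ 2" if d: "5 dvd a - 2 * b" for a b :: int
  proof -
    obtain t where "a - 2 * b = 5 * t" using d by (rule dvdE)
    then have a: "a = 2 * b + 5 * t" by simp
    have "a ^ 2 + b ^ 2 = 5 * (b + 2 * t) ^ 2 + 5 * t ^ 2"
      unfolding a by (simp add: power2_eq_square algebra_simps)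
    then show ?thesis by blast
  qed
  have "(a - 2 * b) * (a + 2 * b) = a ^ 2 + b ^ 2 - 5 * b ^ 2" by (simp add: power2_eq_square algebra_simps)
  moreover have "5 dvd a ^ 2 + b ^ 2 - 5 * b ^ 2" using assms by (intro dvd_diff) simp_all
  ultimately have "5 dvd (a - 2 * b) * (a + 2 * b)" by (simp only:)
  then have "5 dvd a - 2 * b \<or> 5 dvd a + 2 * b"
    using prime_dvd_mult_iff[of "5::int"] by simp
  then show ?thesis using *[of a b] *[of a "-b"] that by auto
qed

lemma square_mod_5: "(x::int) ^ 2 mod 5 = 0 \<or> x ^ 2 mod 5 = 1 \<or> x ^ 2 mod 5 = 4"
proof -
  have "x mod 5 \<in> {0, 1, 2, 3, 4}" by auto
  then have "(x mod 5) ^ 2 mod 5 \<in> {0, 1, 4}" by auto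
  then show ?thesis by (simp add: power_mod)
qed

text \<open>Squares are 0, 1 or -1 modulo 5, and three of them with sum 0 or -1 always include two
  that cancel.\<close>

lemma three_squares_split_5:
  fixes m a b c :: int
  assumes m: "m = a ^ 2 + b ^ 2 + c ^ 2" and m5: "m mod 5 = 0 \<or> m mod 5 = 4"
  obtains x y z where "m = x ^ 2 + 5 * y ^ 2 + 5 * z ^ 2"
proof -
  have dvd: "5 dvd x + y \<longleftrightarrow> (x mod 5 + y mod 5) mod 5 = 0" for x y :: int
    by (simp add: mod_simps dvd_eq_mod_eq_0)
  have "(q + r) mod 5 = 0 \<or> (p + r) mod 5 = 0 \<or> (p + q) mod 5 = 0"
    if "p = 0 \<or> p = 1 \<or> p = 4" "q = 0 \<or> q = 1 \<or> q = 4" "r = 0 \<or> r = 1 \<or> r = 4"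
      "(p + q + r) mod 5 = 0 \<or> (p + q + r) mod 5 = 4" for p q r :: int
    using that by (elim disjE) simp_all
  from this[OF square_mod_5[of a] square_mod_5[of b] square_mod_5[of c]]
  have "5 dvd b ^ 2 + c ^ 2 \<or> 5 dvd a ^ 2 + c ^ 2 \<or> 5 dvd a ^ 2 + b ^ 2"
    using m5 unfolding dvd m sum_mod_3[of "a ^ 2" "b ^ 2" "c ^ 2"] by blast
  then show ?thesis
  proof (elim disjE)
    assume "5 dvd b ^ 2 + c ^ 2"
    then obtain x y where "b ^ 2 + c ^ 2 = 5 * x ^ 2 + 5 * y ^ 2" by (rule fifth_sum_of_squares)
    then show ?thesis using m by (intro that[of a x y]) simp
  next
    assume "5 dvd a ^ 2 + c ^ 2"
    then obtain x y where "a ^ 2 + c ^ 2 = 5 * x ^ 2 + 5 * y ^ 2" by (rule fifth_sum_of_squares)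
    then show ?thesis using m by (intro that[of b x y]) simp
  next
    assume "5 dvd a ^ 2 + b ^ 2"
    then obtain x y where "a ^ 2 + b ^ 2 = 5 * x ^ 2 + 5 * y ^ 2" by (rule fifth_sum_of_squares)
    then show ?thesis using m by (intro that[of c x y]) simp
  qed
qed

text \<open>In a representation of 2 m by three squares one variable is even and the other two have
  equal parity; half-sum and half-difference of these give the two unit coefficients.\<close>

lemma form_1_1_2:
  fixes m :: nat
  assumes "\<nexists>k l. 2 * m = 4 ^ k * (8 * l + 7)"
  obtains x y z :: int where "int m = x ^ 2 + y ^ 2 + 2 * z ^ 2"
proof -
  obtain a b c :: int where abc: "int (2 * m) = a ^ 2 + b ^ 2 + c ^ 2"
    using three_squares[OF assms] by blast
  have *: "\<exists>x y z. int m = x ^ 2 + y ^ 2 + 2 * z ^ 2"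
    if "2 * int m = a ^ 2 + b ^ 2 + c ^ 2" "even (a + b)" "even c" for a b c
  proof -
    obtain x y where "a ^ 2 + b ^ 2 = 2 * x ^ 2 + 2 * y ^ 2" using half_sum_of_squares \<open>even (a + b)\<close> by blast
    moreover obtain z where "c = 2 * z" using \<open>even c\<close> by blast
    ultimately have "int m = x ^ 2 + y ^ 2 + 2 * z ^ 2" using that(1) by (simp add: power2_eq_square)
    then show ?thesis by blast
  qed
  have "even (a ^ 2 + b ^ 2 + c ^ 2)" unfolding abc[symmetric] by simp
  then have "even a \<longleftrightarrow> (even b \<longleftrightarrow> even c)" by simp blast
  then consider "even (a + b)" "even c" | "even (a + c)" "even b" | "even (b + c)" "even a" by auto
  then have "\<exists>x y z. int m = x ^ 2 + y ^ 2 + 2 * z ^ 2"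
    by cases (rule *[of a b c] *[of a c b] *[of b c a]; use abc in simp)+
  then show ?thesis using that by blast
qed

text \<open>When 5 m = x^2 + 5 y^2 + 5 z^2, 5 divides x, and division by 5 exchanges the
  coefficients 1 and 5.\<close>

lemma form_1_1_5:
  fixes m :: nat
  assumes "(5 * m) mod 4 \<noteq> 0" "(5 * m) mod 8 \<noteq> 7"
  obtains x y z :: int where "int m = x ^ 2 + y ^ 2 + 5 * z ^ 2"
proof -
  obtain a b c :: int where "int (5 * m) = a ^ 2 + b ^ 2 + c ^ 2"
    using three_squares_mod_8[OF assms] .
  then obtain x y z :: int where xyz: "int (5 * m) = x ^ 2 + 5 * y ^ 2 + 5 * z ^ 2"
    by (rule three_squares_split_5) simp
  have "5 dvd x ^ 2 + 5 * y ^ 2 + 5 * z ^ 2" unfolding xyz[symmetric] by simp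
  then have "5 dvd x ^ 2 + 5 * (y ^ 2 + z ^ 2)" by (simp add: algebra_simps)
  then have "5 dvd x ^ 2" by (simp add: dvd_add_left_iff)
  then have "5 dvd x" using prime_dvd_power_int[of 5 x 2] by simp
  then obtain w where "x = 5 * w" by blast
  then have "int m = y ^ 2 + z ^ 2 + 5 * w ^ 2" using xyz by (simp add: power2_eq_square)
  then show ?thesis by (rule that)
qed

section \<open>Making variables prime to 3\<close>

lemma square_mod_3: "(x::int) ^ 2 mod 3 = (if 3 dvd x then 0 else 1)"
proof -
  have "x mod 3 \<in> {0, 1, 2}" by auto
  then have "(x mod 3) ^ 2 mod 3 = (if x mod 3 = 0 then 0 else 1)" by auto
  then show ?thesis by (simp add: power_mod dvd_eq_mod_eq_0)
qed

text \<open>Isolates the fact about c = 2 and c = 5 that the repair uses besides c = 2 mod 3, so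
  that both forms share one argument.\<close>

definition lifts_by_3 :: "int \<Rightarrow> bool" where
  "lifts_by_3 c \<longleftrightarrow> (\<forall>u v. \<not> (3 dvd u \<and> 3 dvd v) \<longrightarrow>
     (\<exists>U V. \<not> 3 dvd U \<and> \<not> 3 dvd V \<and> 9 * (u ^ 2 + c * v ^ 2) = U ^ 2 + c * V ^ 2))"

text \<open>From \<open>9 = 1\<^sup>2 + 2 \<cdot> 2\<^sup>2 = 2\<^sup>2 + 5 \<cdot> 1\<^sup>2\<close> and the multiplicativity of \<open>u\<^sup>2 + c v\<^sup>2\<close>.\<close>

lemma lifts_by_3_2: "lifts_by_3 2"
  unfolding lifts_by_3_def
proof (intro allI impI)
  fix u v :: int assume uv: "\<not> (3 dvd u \<and> 3 dvd v)"
  have "9 * (u ^ 2 + 2 * v ^ 2) = (u + 4 * v) ^ 2 + 2 * (2 * u - v) ^ 2"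
    "9 * (u ^ 2 + 2 * v ^ 2) = (u - 4 * v) ^ 2 + 2 * (2 * u + v) ^ 2"
    by (simp_all add: power2_eq_square algebra_simps)
  \<comment> \<open>Modulo 3 the first pair consists of nonzero multiples of u + v and the second of
    nonzero multiples of u - v; both vanish only if 3 divides u and v.\<close>
  moreover have "\<not> 3 dvd u + 4 * v \<and> \<not> 3 dvd 2 * u - v \<or> \<not> 3 dvd u - 4 * v \<and> \<not> 3 dvd 2 * u + v"
    using uv by presburger
  ultimately show "\<exists>U V. \<not> 3 dvd U \<and> \<not> 3 dvd V \<and> 9 * (u ^ 2 + 2 * v ^ 2) = U ^ 2 + 2 * V ^ 2"
    by blast
qed

lemma lifts_by_3_5: "lifts_by_3 5"
  unfolding lifts_by_3_def
proof (intro allI impI)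
  fix u v :: int assume uv: "\<not> (3 dvd u \<and> 3 dvd v)"
  have "9 * (u ^ 2 + 5 * v ^ 2) = (2 * u + 5 * v) ^ 2 + 5 * (u - 2 * v) ^ 2"
    "9 * (u ^ 2 + 5 * v ^ 2) = (2 * u - 5 * v) ^ 2 + 5 * (u + 2 * v) ^ 2"
    by (simp_all add: power2_eq_square algebra_simps)
  moreover have "\<not> 3 dvd 2 * u + 5 * v \<and> \<not> 3 dvd u - 2 * v \<or> \<not> 3 dvd 2 * u - 5 * v \<and> \<not> 3 dvd u + 2 * v"
    using uv by presburger
  ultimately show "\<exists>U V. \<not> 3 dvd U \<and> \<not> 3 dvd V \<and> 9 * (u ^ 2 + 5 * v ^ 2) = U ^ 2 + 5 * V ^ 2"
    by blast
qed

text \<open>Descent: factors 9 are removed until some entry is prime to 3, and are put back one at a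
  time by \<open>lifts_by_3\<close>.\<close>

lemma binary_form_coprime_3:
  fixes y z c :: int
  assumes c: "lifts_by_3 c" and "3 dvd y" "3 dvd z" "\<not> (y = 0 \<and> z = 0)"
  shows "\<exists>u v. \<not> 3 dvd u \<and> \<not> 3 dvd v \<and> y ^ 2 + c * z ^ 2 = u ^ 2 + c * v ^ 2"
  using assms(2-)
proof (induction "nat (\<bar>y\<bar> + \<bar>z\<bar>)" arbitrary: y z rule: less_induct)
  case less
  obtain a b where ab: "y = 3 * a" "z = 3 * b" using less.prems by (auto elim!: dvdE)
  have eq: "y ^ 2 + c * z ^ 2 = 9 * (a ^ 2 + c * b ^ 2)"
    unfolding ab by (simp add: power2_eq_square algebra_simps)
  have "\<exists>u v. \<not> (3 dvd u \<and> 3 dvd v) \<and> a ^ 2 + c * b ^ 2 = u ^ 2 + c * v ^ 2"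
  proof (cases "3 dvd a \<and> 3 dvd b")
    case True
    have "nat (\<bar>a\<bar> + \<bar>b\<bar>) < nat (\<bar>y\<bar> + \<bar>z\<bar>)" using less.prems ab by auto
    then show ?thesis using less.hyps[of a b] True less.prems ab by auto
  qed blast
  then obtain u v where uv: "\<not> (3 dvd u \<and> 3 dvd v)" "a ^ 2 + c * b ^ 2 = u ^ 2 + c * v ^ 2" by blast
  with c have "\<exists>U V. \<not> 3 dvd U \<and> \<not> 3 dvd V \<and> 9 * (u ^ 2 + c * v ^ 2) = U ^ 2 + c * V ^ 2"
    unfolding lifts_by_3_def by blast
  then show ?case unfolding eq uv(2) .
qed

text \<open>Modulo 3 either all variables are prime to 3, or 3 divides z and exactly one of x, y.
  That pair is repaired, and \<open>nt\<close> keeps it from being (0, 0).\<close>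

lemma form_1_1_c_coprime_3:
  fixes m c :: int
  assumes c: "lifts_by_3 c" "c mod 3 = 2" and m: "m mod 3 = 1" "m = x ^ 2 + y ^ 2 + c * z ^ 2"
    and nt: "\<not> (y = 0 \<and> z = 0)" "\<not> (x = 0 \<and> z = 0)"
  obtains u v w where "m = u ^ 2 + v ^ 2 + c * w ^ 2" "\<not> 3 dvd u" "\<not> 3 dvd v" "\<not> 3 dvd w"
proof -
  have "[x ^ 2 + y ^ 2 + c * z ^ 2 = x ^ 2 mod 3 + y ^ 2 mod 3 + (c mod 3) * (z ^ 2 mod 3)] (mod 3)"
    by (intro cong_add cong_mult) (simp_all add: cong_def)
  then have "(x ^ 2 + y ^ 2 + c * z ^ 2) mod 3 = (x ^ 2 mod 3 + y ^ 2 mod 3 + (c mod 3) * (z ^ 2 mod 3)) mod 3"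
    by (simp only: cong_def)
  then have "(x ^ 2 mod 3 + y ^ 2 mod 3 + 2 * (z ^ 2 mod 3)) mod 3 = 1"
    unfolding m(2)[symmetric] m(1) c(2) by (rule sym)
  then consider "\<not> 3 dvd x" "\<not> 3 dvd y" "\<not> 3 dvd z" | "\<not> 3 dvd x" "3 dvd y" "3 dvd z"
    | "3 dvd x" "\<not> 3 dvd y" "3 dvd z"
    unfolding square_mod_3 by (cases "3 dvd x"; cases "3 dvd y"; cases "3 dvd z"; simp)
  then show ?thesis
  proof cases
    case 1
    then show ?thesis using that m(2) by blast
  next
    case 2
    then obtain u v where "\<not> 3 dvd u" "\<not> 3 dvd v" "y ^ 2 + c * z ^ 2 = u ^ 2 + c * v ^ 2"
      using binary_form_coprime_3[OF c(1)] nt by blast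
    then show ?thesis using that[of x u v] 2 m(2) by simp
  next
    case 3
    then obtain u v where "\<not> 3 dvd u" "\<not> 3 dvd v" "x ^ 2 + c * z ^ 2 = u ^ 2 + c * v ^ 2"
      using binary_form_coprime_3[OF c(1)] nt by blast
    then show ?thesis using that[of y u v] 3 m(2) by simp
  qed
qed

text \<open>Here a bad representation has 3 dividing x and exactly one of y, z, so
  \<open>x \<noteq> 0\<close> makes the pair nonzero.\<close>

lemma form_1_c_c_coprime_3:
  fixes m c :: int
  assumes c: "lifts_by_3 c" "c mod 3 = 2" and m: "m mod 3 = 2" "m = x ^ 2 + c * y ^ 2 + c * z ^ 2"
    and nt: "x \<noteq> 0"
  obtains u v w where "m = u ^ 2 + c * v ^ 2 + c * w ^ 2" "\<not> 3 dvd u" "\<not> 3 dvd v" "\<not> 3 dvd w"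
proof -
  have "[x ^ 2 + c * y ^ 2 + c * z ^ 2 = x ^ 2 mod 3 + (c mod 3) * (y ^ 2 mod 3) + (c mod 3) * (z ^ 2 mod 3)] (mod 3)"
    by (intro cong_add cong_mult) (simp_all add: cong_def)
  then have "(x ^ 2 + c * y ^ 2 + c * z ^ 2) mod 3 = (x ^ 2 mod 3 + (c mod 3) * (y ^ 2 mod 3) + (c mod 3) * (z ^ 2 mod 3)) mod 3"
    by (simp only: cong_def)
  then have "(x ^ 2 mod 3 + 2 * (y ^ 2 mod 3) + 2 * (z ^ 2 mod 3)) mod 3 = 2"
    unfolding m(2)[symmetric] m(1) c(2) by (rule sym)
  then consider "\<not> 3 dvd x" "\<not> 3 dvd y" "\<not> 3 dvd z" | "3 dvd x" "\<not> 3 dvd y" "3 dvd z"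
    | "3 dvd x" "3 dvd y" "\<not> 3 dvd z"
    unfolding square_mod_3 by (cases "3 dvd x"; cases "3 dvd y"; cases "3 dvd z"; simp)
  then show ?thesis
  proof cases
    case 1
    then show ?thesis using that m(2) by blast
  next
    case 2
    then obtain u v where "\<not> 3 dvd u" "\<not> 3 dvd v" "x ^ 2 + c * z ^ 2 = u ^ 2 + c * v ^ 2"
      using binary_form_coprime_3[OF c(1)] nt by blast
    then show ?thesis using that[of u y v] 2 m(2) by simp
  next
    case 3
    then obtain u v where "\<not> 3 dvd u" "\<not> 3 dvd v" "x ^ 2 + c * y ^ 2 = u ^ 2 + c * v ^ 2"
      using binary_form_coprime_3[OF c(1)] nt by blast
    then show ?thesis using that[of u v z] 3 m(2) by simp
  qed
qed

text \<open>Condition \<open>nt\<close> of \<open>form_1_1_c_coprime_3\<close>, for a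
  square.\<close>

definition nontrivial_square_rep :: "int \<Rightarrow> int \<Rightarrow> bool" where
  "nontrivial_square_rep c X \<longleftrightarrow> (\<exists>x y z. X ^ 2 = x ^ 2 + y ^ 2 + c * z ^ 2 \<and>
     \<not> (y = 0 \<and> z = 0) \<and> \<not> (x = 0 \<and> z = 0))"

lemma nontrivial_square_rep_mult:
  assumes "nontrivial_square_rep c X" "k \<noteq> 0"
  shows "nontrivial_square_rep c (k * X)"
proof -
  obtain x y z where "X ^ 2 = x ^ 2 + y ^ 2 + c * z ^ 2" "\<not> (y = 0 \<and> z = 0)" "\<not> (x = 0 \<and> z = 0)"
    using assms(1) unfolding nontrivial_square_rep_def by blast
  then show ?thesis unfolding nontrivial_square_rep_def using assms(2)
    by (intro exI[of _ "k * x"] exI[of _ "k * y"] exI[of _ "k * z"])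
      (auto simp: power_mult_distrib algebra_simps)
qed

text \<open>Here \<open>X\<close> is written as \<open>a\<^sup>2 + b\<^sup>2 + c e\<^sup>2 + c d\<^sup>2\<close> with \<open>d = 1\<close>, the reduced norm of a quaternion
  \<open>q\<close>; conjugating a pure quaternion by \<open>q\<close> gives the representation of \<open>X\<^sup>2\<close>.\<close>

lemma nontrivial_square_rep_norm:
  fixes a b e c :: int
  assumes X: "X = a ^ 2 + b ^ 2 + c * e ^ 2 + c" "odd X" and c: "c > 0" and a: "a \<noteq> 0"
  shows "nontrivial_square_rep c X"
  unfolding nontrivial_square_rep_def
proof (intro exI conjI notI)
  let ?x = "a ^ 2 + c * e ^ 2 - b ^ 2 - c" and ?y = "2 * (a * b + c * e)" and ?z = "2 * (a - e * b)"
  show "X ^ 2 = ?x ^ 2 + ?y ^ 2 + c * ?z ^ 2"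
    unfolding X(1) by (simp add: power2_eq_square algebra_simps)
  show False if "?y = 0 \<and> ?z = 0"
  proof -
    have ae: "a = e * b" using that by simp
    have "e * (b ^ 2 + c) = a * b + c * e" unfolding ae by (simp add: power2_eq_square algebra_simps)
    also have "\<dots> = 0" using conjunct1[OF that] by (simp only: mult_eq_0_iff) simp
    finally have "e = 0 \<or> b ^ 2 + c = 0" by simp
    moreover have "b ^ 2 + c > 0" using c by (simp add: add_nonneg_pos)
    ultimately have "e = 0" by simp
    then show False using a ae by simp
  qed
  show False if "?x = 0 \<and> ?z = 0"
  proof -
    have ae: "a = e * b" using that by simp
    have "(e ^ 2 - 1) * (b ^ 2 + c) = ?x" unfolding ae by (simp add: power2_eq_square algebra_simps)
    then have "e ^ 2 - 1 = 0 \<or> b ^ 2 + c = 0" using that by simp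
    moreover have "b ^ 2 + c > 0" using c by (simp add: add_nonneg_pos)
    ultimately have "e ^ 2 = 1" by simp
    \<comment> \<open>With e = 1 or e = -1 the two halves of the norm coincide, which the parity of
      X forbids.\<close>
    then have "X = 2 * b ^ 2 + 2 * c" unfolding X(1) ae power_mult_distrib by simp
    then show False using X(2) by simp
  qed
qed

text \<open>An even X reduces to X / 2 by scaling, starting from 4 = 1 + 1 + 2. For odd X, 2 (X - 2)
  is 2 mod 4, so X - 2 = a^2 + b^2 + 2 e^2, which is the norm form with d = 1.\<close>

lemma nontrivial_square_rep_2:
  fixes X :: nat
  assumes "X \<ge> 2"
  shows "nontrivial_square_rep 2 (int X)"
  using assms
proof (induction X rule: less_induct)
  case (less X)
  show ?case
  proof (cases "even X")
    case True
    then obtain k where k: "X = 2 * k" by blast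
    show ?thesis
    proof (cases "k = 1")
      case True
      then show ?thesis unfolding nontrivial_square_rep_def k
        by (intro exI[of _ 1]) simp
    next
      case False
      then have "nontrivial_square_rep 2 (int k)" using less k by auto
      then show ?thesis using nontrivial_square_rep_mult[of 2 "int k" 2] k by simp
    qed
  next
    case False
    have "\<nexists>k l. 2 * (X - 2) = 4 ^ k * (8 * l + 7)"
    proof safe
      fix k l assume eq: "2 * (X - 2) = 4 ^ k * (8 * l + 7)"
      obtain j where "X = 2 * j + 1" using False by (rule oddE)
      then have "2 * (X - 2) = 4 * (j - 1) + 2" using less.prems by simp
      then have "2 * (X - 2) mod 4 = 2" by (simp only: mod_mult_self4) simp
      then show False unfolding eq exceptional_mod_4 by (simp split: if_splits)
    qed
    then obtain a b e :: int where abe: "int (X - 2) = a ^ 2 + b ^ 2 + 2 * e ^ 2"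
      using form_1_1_2 by blast
    then have eq: "int X = a ^ 2 + b ^ 2 + 2 * e ^ 2 + 2" using less.prems by simp
    have "odd (int X)" using False by simp
    then have "a \<noteq> 0 \<or> b \<noteq> 0" using eq by auto
    then show ?thesis
      using nontrivial_square_rep_norm[of "int X" a b 2 e] nontrivial_square_rep_norm[of "int X" b a 2 e] eq \<open>odd (int X)\<close>
      by (auto simp: add.commute add.left_commute)
  qed
qed

text \<open>For X = 1, 5 or 7 mod 8 the form represents X itself, a norm with d = 0. For X = 3 mod
  8, 5 X is 7 mod 8, so X - 5 is represented instead and d = 1. Multiples of 5 are treated by 3^2 +
  4^2 = 5^2; for other X the case a = b = 0 cannot occur.\<close>

lemma nontrivial_square_rep_5:
  fixes X :: nat
  assumes "odd X" "X \<ge> 3"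
  shows "nontrivial_square_rep 5 (int X)"
  using assms
proof (induction X rule: less_induct)
  case (less X)
  have oddX: "odd (int X)" using less.prems by simp
  consider "5 dvd X" | "X mod 8 = 3" "\<not> 5 dvd X" | "X mod 8 \<noteq> 3" "\<not> 5 dvd X" by blast
  then show ?case
  proof cases
    case 1
    then obtain k where "X = 5 * k" by blast
    then show ?thesis using less.prems unfolding nontrivial_square_rep_def
      by (intro exI[of _ "3 * int k"] exI[of _ "4 * int k"] exI[of _ 0]) (auto simp: power2_eq_square)
  next
    case 2
    show ?thesis
    proof (cases "X = 3")
      case True
      then show ?thesis unfolding nontrivial_square_rep_def
        by (intro exI[of _ 2] exI[of _ 0] exI[of _ 1]) simp
    next
      case False
      then have X: "X \<ge> 11" using 2(1) by presburger
      define j where "j = X div 8"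
      have "X = 8 * j + 3" using div_mult_mod_eq[of X 8] 2(1) by (simp add: j_def)
      then have "5 * (X - 5) = 8 * (5 * j - 2) + 6" using X by simp
      then have "5 * (X - 5) mod 8 = 6" by (simp only: mod_mult_self4) simp
      then have "5 * (X - 5) mod 4 \<noteq> 0" "5 * (X - 5) mod 8 \<noteq> 7"
        using mod_mod_cancel[of 4 8 "5 * (X - 5)"] by simp_all
      then obtain a b e :: int where "int (X - 5) = a ^ 2 + b ^ 2 + 5 * e ^ 2"
        using form_1_1_5 by blast
      then have eq: "int X = a ^ 2 + b ^ 2 + 5 * e ^ 2 + 5" using X by simp
      have "a \<noteq> 0 \<or> b \<noteq> 0"
      proof (rule ccontr)
        assume "\<not> (a \<noteq> 0 \<or> b \<noteq> 0)"
        then have "int X = 5 * (e ^ 2 + 1)" using eq by simp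
        then have "int 5 dvd int X" by simp
        then show False using 2 by (simp only: int_dvd_int_iff)
      qed
      then show ?thesis
        using nontrivial_square_rep_norm[of "int X" a b 5 e] nontrivial_square_rep_norm[of "int X" b a 5 e] eq oddX
        by (auto simp: add.commute add.left_commute)
    qed
  next
    case 3
    have "X mod 8 = 1 \<or> X mod 8 = 5 \<or> X mod 8 = 7" using 3(1) less.prems(1) by presburger
    moreover have E: "5 * X mod 8 = 5 * (X mod 8) mod 8" by (rule mod_mult_right_eq[symmetric])
    ultimately have "5 * X mod 8 = 5 \<or> 5 * X mod 8 = 1 \<or> 5 * X mod 8 = 3"
      unfolding E by (elim disjE) simp_all
    then have "5 * X mod 4 \<noteq> 0" "5 * X mod 8 \<noteq> 7"
      unfolding mod_mod_cancel[of 4 8 "5 * X", symmetric, simplified] by (elim disjE; simp only:; simp)+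
    then obtain a b e :: int where eq: "int X = a ^ 2 + b ^ 2 + 5 * e ^ 2"
      using form_1_1_5 by blast
    have *: "nontrivial_square_rep 5 (int X)"
      if eq: "int X = a ^ 2 + b ^ 2 + 5 * e ^ 2" and ne: "b \<noteq> 0" "a \<noteq> 0 \<or> e \<noteq> 0" for a b e :: int
      unfolding nontrivial_square_rep_def
    proof (intro exI conjI notI)
      let ?x = "a ^ 2 + 5 * e ^ 2 - b ^ 2" and ?y = "2 * (a * b)" and ?z = "2 * (e * b)"
      show "int X ^ 2 = ?x ^ 2 + ?y ^ 2 + 5 * ?z ^ 2"
        unfolding eq by (simp add: power2_eq_square algebra_simps)
      show False if "?y = 0 \<and> ?z = 0" using that ne by simp
      show False if "?x = 0 \<and> ?z = 0"
      proof -
        have "e = 0" using that ne by simp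
        then have "int X = 2 * b ^ 2" using that eq by simp
        then show False using oddX by simp
      qed
    qed
    \<comment> \<open>When only one of a, b, e is nonzero, the conjugation yields nothing; X is then
      a perfect square, and a representation for its root is scaled.\<close>
    have sq: "nontrivial_square_rep 5 (int X)" if "int X = a ^ 2" for a
    proof -
      define k where "k = nat \<bar>a\<bar>"
      have "int X = int (k * k)" using that by (simp add: k_def power2_eq_square)
      then have k: "X = k * k" by (simp only: of_nat_eq_iff)
      have "odd k" using less.prems(1) unfolding k by simp
      moreover have "k \<noteq> 1" using less.prems(2) unfolding k by auto
      ultimately have k3: "k \<ge> 3" by presburger
      then have "k < X" unfolding k by simp
      then have "nontrivial_square_rep 5 (int k)" using less.IH k3 \<open>odd k\<close> by blast
      then show ?thesis using nontrivial_square_rep_mult[of 5 "int k" "int k"] k k3 by simp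
    qed
    have "\<not> (a = 0 \<and> b = 0)"
    proof
      assume "a = 0 \<and> b = 0"
      then have "int 5 dvd int X" using eq by simp
      then show False using 3 by (simp only: int_dvd_int_iff)
    qed
    then consider "b \<noteq> 0" "a \<noteq> 0 \<or> e \<noteq> 0" | "a \<noteq> 0" "b \<noteq> 0 \<or> e \<noteq> 0" | "a = 0" "e = 0" | "b = 0" "e = 0" by blast
    then show ?thesis
    proof cases
      case 1
      then show ?thesis using *[OF eq] by blast
    next
      case 2
      then show ?thesis using *[of b a e] eq by simp
    next
      case 3
      then show ?thesis using sq[of b] eq by simp
    next
      case 4
      then show ?thesis using sq[of a] eq by simp
    qed
  qed
qed

text \<open>A representation violating \<open>nt\<close> has at most one nonzero variable, with
  coefficient 1, so m is a square and \<open>sq\<close> supplies another.\<close>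

lemma form_coprime_3_of_square:
  assumes c: "lifts_by_3 c" "c mod 3 = 2" "m mod 3 = 1" and m: "m = x ^ 2 + y ^ 2 + c * z ^ 2"
    and sq: "\<And>X. m = X ^ 2 \<Longrightarrow> nontrivial_square_rep c X"
  obtains u v w where "m = u ^ 2 + v ^ 2 + c * w ^ 2" "\<not> 3 dvd u" "\<not> 3 dvd v" "\<not> 3 dvd w"
proof -
  have "\<exists>x y z. m = x ^ 2 + y ^ 2 + c * z ^ 2 \<and> \<not> (y = 0 \<and> z = 0) \<and> \<not> (x = 0 \<and> z = 0)"
  proof (cases "z = 0 \<and> (x = 0 \<or> y = 0)")
    case True
    then obtain X where X: "m = X ^ 2" using m by auto
    from sq[OF X] show ?thesis unfolding nontrivial_square_rep_def X .
  qed (use m in blast)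
  then show ?thesis using form_1_1_c_coprime_3[OF c(1,2,3)] that by metis
qed

text \<open>The bound 4 excludes m = 1, whose only representations are trivial.\<close>

lemma form_1_1_2_coprime_3:
  fixes m :: nat
  assumes "m mod 3 = 1" "m \<ge> 4" "\<nexists>k l. 2 * m = 4 ^ k * (8 * l + 7)"
  obtains u v w :: int where "int m = u ^ 2 + v ^ 2 + 2 * w ^ 2" "\<not> 3 dvd u" "\<not> 3 dvd v" "\<not> 3 dvd w"
proof -
  obtain x y z where xyz: "int m = x ^ 2 + y ^ 2 + 2 * z ^ 2" using form_1_1_2[OF assms(3)] .
  have "int m mod 3 = 1" using assms(1) by presburger
  moreover have "nontrivial_square_rep 2 X" if X: "int m = X ^ 2" for X
  proof -
    have "nat \<bar>X\<bar> \<ge> 2"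
    proof (rule ccontr)
      assume "\<not> nat \<bar>X\<bar> \<ge> 2"
      then have "\<bar>X\<bar> \<le> 1" by simp
      then have "X ^ 2 \<le> 1" using abs_le_square_iff[of X 1] by simp
      then show False using X assms(2) by simp
    qed
    from nontrivial_square_rep_2[OF this] show ?thesis by (simp add: nontrivial_square_rep_def)
  qed
  ultimately show ?thesis using form_coprime_3_of_square[OF lifts_by_3_2 _ _ xyz] that by auto
qed

section \<open>Representations by the forms with coefficients (1, 2, 2), (1, 4, 4) and (1, 5,
  5)\<close>

lemma double_odd_not_exceptional:
  fixes m :: nat
  assumes "odd m"
  shows "\<nexists>k l. 2 * m = 4 ^ k * (8 * l + 7)"
proof safe
  fix k l assume eq: "2 * m = 4 ^ k * (8 * l + 7)"
  have "2 * m mod 4 = 2" using assms by presburger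
  then show False unfolding eq exceptional_mod_4 by (simp split: if_splits)
qed

text \<open>Here r is the remainder lost in halving an octagonal number, and 5 = 1 + 2 + 2. If 6 n +
  5 is 7 mod 8, r = 1 gives 6 n + 8 = 2 (3 n + 4) with 3 n + 4 odd, and doubling u^2 + v^2 + 2 w^2
  produces (2 w)^2 + 2 u^2 + 2 v^2. Otherwise r = 0 works.\<close>

lemma form_1_2_2_coprime_3:
  fixes n :: nat
  obtains u v w :: int and r :: nat where "r < 2" "6 * int n + 3 * int r + 5 = u ^ 2 + 2 * v ^ 2 + 2 * w ^ 2"
    "\<not> 3 dvd u" "\<not> 3 dvd v" "\<not> 3 dvd w"
proof (cases "(6 * n + 5) mod 8 = 7")
  case True
  then have "odd (3 * n + 4)" by presburger
  note exc = double_odd_not_exceptional[OF this]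
  have m: "(3 * n + 4) mod 3 = 1" "3 * n + 4 \<ge> 4" by presburger+
  obtain u v w :: int where uvw: "int (3 * n + 4) = u ^ 2 + v ^ 2 + 2 * w ^ 2"
    "\<not> 3 dvd u" "\<not> 3 dvd v" "\<not> 3 dvd w"
    using form_1_1_2_coprime_3[OF m exc] .
  have "6 * int n + 3 * int 1 + 5 = (2 * w) ^ 2 + 2 * u ^ 2 + 2 * v ^ 2"
    using uvw(1) by (simp add: power_mult_distrib)
  moreover have "\<not> 3 dvd 2 * w" using uvw(4) by presburger
  ultimately show ?thesis using uvw that[of 1 "2 * w" u v] by simp
next
  case False
  define m where "m = int (6 * n + 5)"
  have "(6 * n + 5) mod 4 \<noteq> 0" by presburger
  then obtain a b c :: int where abc: "m = a ^ 2 + b ^ 2 + c ^ 2"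
    using three_squares_mod_8[OF _ False] unfolding m_def by blast
  have *: "\<exists>x y z. m = x ^ 2 + 2 * y ^ 2 + 2 * z ^ 2"
    if "m = a ^ 2 + b ^ 2 + c ^ 2" "even (b + c)" for a b c
  proof -
    obtain x y where "b ^ 2 + c ^ 2 = 2 * x ^ 2 + 2 * y ^ 2" using half_sum_of_squares \<open>even (b + c)\<close> by blast
    then have "m = a ^ 2 + 2 * x ^ 2 + 2 * y ^ 2" using that(1) by simp
    then show ?thesis by blast
  qed
  have "even (b + c) \<or> even (a + c) \<or> even (a + b)" by auto
  then have "\<exists>x y z. m = x ^ 2 + 2 * y ^ 2 + 2 * z ^ 2"
    using *[of a b c] *[of b a c] *[of c a b] abc by auto
  then obtain x y z where xyz: "m = x ^ 2 + 2 * y ^ 2 + 2 * z ^ 2" by blast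
  have "odd m" "m mod 3 = 2" unfolding m_def by presburger+
  then have "x \<noteq> 0" using xyz by auto
  obtain u v w where "m = u ^ 2 + 2 * v ^ 2 + 2 * w ^ 2" "\<not> 3 dvd u" "\<not> 3 dvd v" "\<not> 3 dvd w"
    using form_1_c_c_coprime_3[OF lifts_by_3_2 _ \<open>m mod 3 = 2\<close> xyz \<open>x \<noteq> 0\<close>] by auto
  then show ?thesis using that[of 0 u v w] by (simp add: m_def)
qed

text \<open>The matrix with rows \<open>(1, 2, 2)\<close>, \<open>(2, 1, -2)\<close>, \<open>(2, -2, 1)\<close> is three times an orthogonal matrix.\<close>

lemma nine_times_three_squares:
  fixes a b c :: int
  assumes "\<not> (3 dvd a \<and> 3 dvd b \<and> 3 dvd c)"
  obtains u v w where "9 * (a ^ 2 + b ^ 2 + c ^ 2) = u ^ 2 + v ^ 2 + w ^ 2"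
    "\<not> 3 dvd u" "\<not> 3 dvd v" "\<not> 3 dvd w"
proof -
  have *: "\<exists>u v w. 9 * (a ^ 2 + b ^ 2 + c ^ 2) = u ^ 2 + v ^ 2 + w ^ 2 \<and> \<not> 3 dvd u \<and> \<not> 3 dvd v \<and> \<not> 3 dvd w"
    if "\<not> 3 dvd a - b - c" for a b c :: int
  proof (intro exI conjI)
    show "9 * (a ^ 2 + b ^ 2 + c ^ 2) = (a + 2 * b + 2 * c) ^ 2 + (2 * a + b - 2 * c) ^ 2 + (2 * a - 2 * b + c) ^ 2"
      by (simp add: power2_eq_square algebra_simps)
    show "\<not> 3 dvd a + 2 * b + 2 * c" "\<not> 3 dvd 2 * a + b - 2 * c" "\<not> 3 dvd 2 * a - 2 * b + c"
      using that by presburger+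
  qed
  have "\<not> 3 dvd a - b - c \<or> \<not> 3 dvd a - (- b) - c \<or> \<not> 3 dvd a - b - (- c) \<or> \<not> 3 dvd a - (- b) - (- c)"
    using assms by presburger
  then show ?thesis using *[of a b c] *[of a "-b" c] *[of a b "-c"] *[of a "-b" "-c"] that by auto
qed

text \<open>When 3 divides the sum, it divides all of a, b, c or none, so only factors 9 have to be
  removed and put back.\<close>

lemma three_squares_coprime_3:
  fixes a b c :: int
  assumes "3 dvd a ^ 2 + b ^ 2 + c ^ 2" "\<not> (a = 0 \<and> b = 0 \<and> c = 0)"
  shows "\<exists>u v w. a ^ 2 + b ^ 2 + c ^ 2 = u ^ 2 + v ^ 2 + w ^ 2 \<and> \<not> 3 dvd u \<and> \<not> 3 dvd v \<and> \<not> 3 dvd w"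
  using assms
proof (induction "nat (\<bar>a\<bar> + \<bar>b\<bar> + \<bar>c\<bar>)" arbitrary: a b c rule: less_induct)
  case less
  have "(a ^ 2 mod 3 + b ^ 2 mod 3 + c ^ 2 mod 3) mod 3 = 0"
    using less.prems(1) unfolding sum_mod_3[symmetric] by (rule dvd_imp_mod_0)
  then consider "\<not> 3 dvd a" "\<not> 3 dvd b" "\<not> 3 dvd c" | "3 dvd a" "3 dvd b" "3 dvd c"
    unfolding square_mod_3 by (cases "3 dvd a"; cases "3 dvd b"; cases "3 dvd c"; simp)
  then show ?case
  proof cases
    case 2
    then obtain x y z where xyz: "a = 3 * x" "b = 3 * y" "c = 3 * z" by (auto elim!: dvdE)
    have eq: "a ^ 2 + b ^ 2 + c ^ 2 = 9 * (x ^ 2 + y ^ 2 + z ^ 2)"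
      unfolding xyz by (simp add: power2_eq_square algebra_simps)
    have "\<exists>u v w. x ^ 2 + y ^ 2 + z ^ 2 = u ^ 2 + v ^ 2 + w ^ 2 \<and> \<not> (3 dvd u \<and> 3 dvd v \<and> 3 dvd w)"
    proof (cases "3 dvd x \<and> 3 dvd y \<and> 3 dvd z")
      case True
      have "nat (\<bar>x\<bar> + \<bar>y\<bar> + \<bar>z\<bar>) < nat (\<bar>a\<bar> + \<bar>b\<bar> + \<bar>c\<bar>)" using less.prems(2) xyz by auto
      moreover have "3 dvd x ^ 2 + y ^ 2 + z ^ 2" using True by (auto simp: power2_eq_square)
      ultimately have "\<exists>u v w. x ^ 2 + y ^ 2 + z ^ 2 = u ^ 2 + v ^ 2 + w ^ 2 \<and> \<not> 3 dvd u \<and> \<not> 3 dvd v \<and> \<not> 3 dvd w"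
        using less.prems(2) xyz by (intro less.hyps) auto
      then show ?thesis by blast
    qed blast
    then obtain u v w where uvw: "x ^ 2 + y ^ 2 + z ^ 2 = u ^ 2 + v ^ 2 + w ^ 2"
      "\<not> (3 dvd u \<and> 3 dvd v \<and> 3 dvd w)" by blast
    show ?thesis unfolding eq uvw(1) using nine_times_three_squares[OF uvw(2)] by metis
  qed blast
qed

text \<open>12 n + 9 is divisible by 3, so its three squares can be taken prime to 3; it is also 1
  mod 4, so exactly two of them are even and supply the coefficients 4.\<close>

lemma form_1_4_4_coprime_3:
  fixes n :: nat
  obtains u v w :: int where "12 * int n + 9 = u ^ 2 + 4 * v ^ 2 + 4 * w ^ 2"
    "\<not> 3 dvd u" "\<not> 3 dvd v" "\<not> 3 dvd w"
proof -
  define m where "m = 12 * int n + 9"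
  have "(12 * n + 9) mod 4 \<noteq> 0" "(12 * n + 9) mod 8 \<noteq> 7" by presburger+
  then obtain a b c :: int where abc: "int (12 * n + 9) = a ^ 2 + b ^ 2 + c ^ 2"
    using three_squares_mod_8 by blast
  have m: "m = a ^ 2 + b ^ 2 + c ^ 2" unfolding abc[symmetric] m_def by simp
  have "3 dvd m" "m > 0" unfolding m_def by simp_all
  moreover from this have "\<not> (a = 0 \<and> b = 0 \<and> c = 0)" unfolding m by auto
  ultimately obtain u v w where uvw: "m = u ^ 2 + v ^ 2 + w ^ 2" "\<not> 3 dvd u" "\<not> 3 dvd v" "\<not> 3 dvd w"
    using three_squares_coprime_3[of a b c] unfolding m by blast
  note intro = that
  have *: thesis if "m = u ^ 2 + v ^ 2 + w ^ 2" "\<not> 3 dvd u" "\<not> 3 dvd v" "\<not> 3 dvd w" "even v" "even w" for u v w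
  proof -
    obtain x y where xy: "v = 2 * x" "w = 2 * y" using \<open>even v\<close> \<open>even w\<close> by (auto elim!: evenE)
    moreover have "\<not> 3 dvd x" "\<not> 3 dvd y" using \<open>\<not> 3 dvd v\<close> \<open>\<not> 3 dvd w\<close> xy by auto
    ultimately show thesis using that(1,2) intro[of u x y]
      by (simp add: m_def power_mult_distrib)
  qed
  have "m mod 4 = 1" unfolding m_def by presburger
  then have "even v \<and> even w \<or> even u \<and> even w \<or> even u \<and> even v"
    unfolding uvw(1) sum_mod_3[of "u ^ 2" "v ^ 2" "w ^ 2"] square_mod_4 by (simp split: if_splits)
  then show thesis
  proof (elim disjE conjE)
    assume "even v" "even w"
    then show thesis using *[of u v w] uvw by blast
  next
    assume "even u" "even w"
    then show thesis using *[of v u w] uvw by simp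
  next
    assume "even u" "even v"
    then show thesis using *[of w u v] uvw by simp
  qed
qed

text \<open>The remainder r = 1 gives 15 n + 14, which is -1 mod 5, and r = 3 gives 15 n + 20 = 5 (3
  n + 4). They differ by 6, so at least one satisfies the congruence conditions of
  \<open>three_squares_mod_8\<close>.\<close>

lemma form_1_5_5_coprime_3:
  fixes n :: nat
  obtains u v w :: int and r :: nat where "r < 5" "15 * int n + 3 * int r + 11 = u ^ 2 + 5 * v ^ 2 + 5 * w ^ 2"
    "\<not> 3 dvd u" "\<not> 3 dvd v" "\<not> 3 dvd w"
proof -
  define E where "E = 5 * (3 * n + 4)"
  consider "E mod 8 = 0 \<or> E mod 8 = 4 \<or> E mod 8 = 7" | "E mod 4 \<noteq> 0" "E mod 8 \<noteq> 7"
  proof -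
    have "E mod 4 = 0 \<Longrightarrow> E mod 8 = 0 \<or> E mod 8 = 4" by presburger
    then show ?thesis using that by metis
  qed
  then show ?thesis
  proof cases
    case 1
    have E: "15 * n + 14 = E - 6" "E \<ge> 6" by (simp_all add: E_def)
    define F where "F = E - 6"
    have "E = F + 6" using E(2) by (simp add: F_def)
    then have "F mod 4 \<noteq> 0" "F mod 8 \<noteq> 7" using 1 by presburger+
    then have "(E - 6) mod 4 \<noteq> 0" "(E - 6) mod 8 \<noteq> 7" unfolding F_def .
    then obtain a b c :: int where "int (15 * n + 14) = a ^ 2 + b ^ 2 + c ^ 2"
      using three_squares_mod_8[of "E - 6"] unfolding E(1) by blast
    moreover have m5: "int (15 * n + 14) mod 5 = 4" by presburger
    ultimately obtain x y z where xyz: "int (15 * n + 14) = x ^ 2 + 5 * y ^ 2 + 5 * z ^ 2"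
      using three_squares_split_5 by metis
    have "x \<noteq> 0"
    proof
      assume "x = 0"
      then have "int (15 * n + 14) = 5 * (y ^ 2 + z ^ 2)" using xyz by simp
      then show False using m5 by simp
    qed
    moreover have "int (15 * n + 14) mod 3 = 2" by presburger
    ultimately obtain u v w where "int (15 * n + 14) = u ^ 2 + 5 * v ^ 2 + 5 * w ^ 2"
      "\<not> 3 dvd u" "\<not> 3 dvd v" "\<not> 3 dvd w"
      using form_1_c_c_coprime_3[OF lifts_by_3_5 _ _ xyz] by auto
    then show ?thesis using that[of 1 u v w] by simp
  next
    case 2
    define m where "m = 3 * n + 4"
    obtain x y z where xyz: "int m = x ^ 2 + y ^ 2 + 5 * z ^ 2"
      using form_1_1_5[of m] 2 by (auto simp: E_def m_def)
    have m3: "int m mod 3 = 1" "(5::int) mod 3 = 2" unfolding m_def by presburger+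
    have nt: "nontrivial_square_rep 5 X" if X: "int m = X ^ 2" for X
    proof -
      define k where "k = nat \<bar>X\<bar>"
      have "int m = int (k ^ 2)" using X by (simp add: k_def)
      then have k: "m = k ^ 2" by (simp only: of_nat_eq_iff)
      \<comment> \<open>The case condition says that 4 does not divide E = 5 k^2.\<close>
      have "odd k"
      proof
        assume "even k"
        then obtain j where "k = 2 * j" by blast
        then have "E = 4 * (5 * j ^ 2)" using k by (simp add: E_def m_def power_mult_distrib)
        then show False using 2(1) by simp
      qed
      moreover have "k \<noteq> 1" using k by (auto simp: m_def)
      ultimately have "k \<ge> 3" by presburger
      from nontrivial_square_rep_5[OF \<open>odd k\<close> this] show ?thesis
        by (simp add: nontrivial_square_rep_def k_def)
    qed
    obtain u v w where "int m = u ^ 2 + v ^ 2 + 5 * w ^ 2"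
      "\<not> 3 dvd u" "\<not> 3 dvd v" "\<not> 3 dvd w"
      using form_coprime_3_of_square[OF lifts_by_3_5 m3(2,1) xyz nt] .
    moreover from this have "\<not> 3 dvd 5 * w" by presburger
    ultimately show ?thesis using that[of 3 "5 * w" u v] by (simp add: m_def power_mult_distrib)
  qed
qed

section \<open>Octagonal numbers\<close>

lemma square_pred_p8: "(3 * x - 1) ^ 2 = 3 * p8 x + 1"
  by (simp add: p8_def power2_eq_square algebra_simps)

text \<open>One of X and -X is -1 mod 3, hence of the form 3 x - 1.\<close>

lemma square_eq_p8:
  assumes "\<not> 3 dvd X"
  obtains x where "X ^ 2 = 3 * p8 x + 1"
proof -
  have "X mod 3 = 1 \<or> X mod 3 = 2" using assms by presburger
  then have "\<exists>x. X = 3 * x - 1 \<or> X = - (3 * x - 1)" by presburger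
  then show ?thesis using that square_pred_p8 by (metis power2_minus)
qed

lemma p8_nonneg: "0 \<le> p8 x"
proof -
  have "0 \<le> 3 * p8 x + 1" unfolding square_pred_p8[symmetric] by simp
  then show ?thesis by simp
qed

lemma floor_numeral_divide: "\<lfloor>real_of_int a / numeral k\<rfloor> = a div numeral k"
  using floor_divide_of_int_eq[of a "numeral k", where ?'a = real] by simp

lemma range_eq_Nats:
  fixes f :: "int \<Rightarrow> int \<Rightarrow> int \<Rightarrow> int"
  assumes "\<And>x y z. 0 \<le> f x y z" "\<And>n. \<exists>x y z. int n = f x y z"
  shows "{f x y z | x y z. True} = \<nat>"
proof (intro equalityI subsetI)
  fix a assume "a \<in> {f x y z | x y z. True}"
  then have "0 \<le> a" using assms(1) by auto
  then show "a \<in> \<nat>" by (metis nonneg_int_cases of_nat_in_Nats)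
next
  fix a :: int assume "a \<in> \<nat>"
  then obtain n where "a = int n" by (rule Nats_cases)
  then show "a \<in> {f x y z | x y z. True}" using assms(2)[of n] by auto
qed

text \<open>With X = 3 x - 1 and so on, 3 n + 4 = X^2 + Y^2 + 2 Z^2, and doubling gives (X + Y)^2 +
  (X - Y)^2 + (2 Z)^2; so the obstruction for three squares is inherited.\<close>

lemma p8_sum_1_1_2_iff:
  "(\<exists>x y z. int n = p8 x + p8 y + 2 * p8 z) \<longleftrightarrow> (\<nexists>k l. 2 * (3 * n + 4) = 4 ^ k * (8 * l + 7))"
proof
  assume "\<exists>x y z. int n = p8 x + p8 y + 2 * p8 z"
  then obtain x y z where n: "int n = p8 x + p8 y + 2 * p8 z" by blast
  define X Y Z where "X = 3 * x - 1" "Y = 3 * y - 1" "Z = 3 * z - 1"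
  have "X ^ 2 = 3 * p8 x + 1" "Y ^ 2 = 3 * p8 y + 1" "Z ^ 2 = 3 * p8 z + 1"
    unfolding X_Y_Z_def by (rule square_pred_p8)+
  then have "2 * (3 * int n + 4) = 2 * X ^ 2 + 2 * Y ^ 2 + 4 * Z ^ 2" using n by simp
  then have eq: "int (2 * (3 * n + 4)) = (X + Y) ^ 2 + (X - Y) ^ 2 + (2 * Z) ^ 2"
    by (simp add: power2_eq_square algebra_simps)
  show "\<nexists>k l. 2 * (3 * n + 4) = 4 ^ k * (8 * l + 7)"
  proof safe
    fix k l assume "2 * (3 * n + 4) = 4 ^ k * (8 * l + 7)"
    then have "int (2 * (3 * n + 4)) = int (4 ^ k * (8 * l + 7))" by (simp only:)
    then have "int (2 * (3 * n + 4)) = 4 ^ k * (8 * int l + 7)" by simp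
    then show False using three_squares_necessary[of "X + Y" "X - Y" "2 * Z" k "int l"] eq by simp
  qed
next
  assume exc: "\<nexists>k l. 2 * (3 * n + 4) = 4 ^ k * (8 * l + 7)"
  have m: "(3 * n + 4) mod 3 = 1" "3 * n + 4 \<ge> 4" by presburger+
  obtain u v w :: int where uvw: "int (3 * n + 4) = u ^ 2 + v ^ 2 + 2 * w ^ 2"
    "\<not> 3 dvd u" "\<not> 3 dvd v" "\<not> 3 dvd w"
    using form_1_1_2_coprime_3[OF m exc] .
  obtain x where x: "u ^ 2 = 3 * p8 x + 1" using square_eq_p8[OF uvw(2)] .
  obtain y where y: "v ^ 2 = 3 * p8 y + 1" using square_eq_p8[OF uvw(3)] .
  obtain z where z: "w ^ 2 = 3 * p8 z + 1" using square_eq_p8[OF uvw(4)] .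
  have "int n = p8 x + p8 y + 2 * p8 z" using uvw(1) unfolding x y z by simp
  then show "\<exists>x y z. int n = p8 x + p8 y + 2 * p8 z" by blast
qed

text \<open>Parity forces k = j + 1, and reduction modulo 3 forces l = 2 mod 3; writing l = 3 q - 1
  gives 3 n + 4 = 4^j (48 q - 2).\<close>

lemma exceptional_set_iff:
  "real n \<in> {4 ^ (k + 2) * real q - 2 / 3 * (4 ^ k + 2) | (k::nat) (q::nat). q \<ge> 1}
    \<longleftrightarrow> (\<exists>k l. 2 * (3 * n + 4) = 4 ^ k * (8 * l + 7))"
proof
  assume "real n \<in> {4 ^ (k + 2) * real q - 2 / 3 * (4 ^ k + 2) | (k::nat) (q::nat). q \<ge> 1}"
  then obtain k q where q: "q \<ge> 1" and n: "real n = 4 ^ (k + 2) * real q - 2 / 3 * (4 ^ k + 2)" by auto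
  obtain p where p: "q = Suc p" using q by (cases q) auto
  have "real (2 * (3 * n + 4)) = real (4 ^ Suc k * (8 * (3 * p + 2) + 7))"
    using n unfolding p by (simp add: field_simps)
  then have "2 * (3 * n + 4) = 4 ^ Suc k * (8 * (3 * p + 2) + 7)" by (simp only: of_nat_eq_iff)
  then show "\<exists>k l. 2 * (3 * n + 4) = 4 ^ k * (8 * l + 7)" by blast
next
  assume "\<exists>k l. 2 * (3 * n + 4) = 4 ^ k * (8 * l + 7)"
  then obtain k l where eq: "2 * (3 * n + 4) = 4 ^ k * (8 * l + 7)" by blast
  have "even (4 ^ k * (8 * l + 7))" unfolding eq[symmetric] by simp
  then obtain j where j: "k = Suc j" by (cases k) auto
  have "2 * (3 * n + 4) = 2 * (4 ^ j * (16 * l + 14))" unfolding eq j by simp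
  then have 1: "3 * n + 4 = 4 ^ j * (16 * l + 14)" by (simp only: nat_mult_eq_cancel_disj) simp
  have "[4 ^ j * (16 * l + 14) = 1 ^ j * (16 * l + 14)] (mod 3)"
    by (intro cong_mult cong_pow) (simp_all add: cong_def)
  then have "(16 * l + 14) mod 3 = (3 * n + 4) mod 3" unfolding 1 by (simp add: cong_def)
  then have "l mod 3 = 2" by presburger
  then obtain i where i: "l = 3 * i + 2" by (metis mult_div_mod_eq)
  have "real (3 * n + 4) = 4 ^ j * (48 * real (Suc i) - 2)" unfolding 1 i by simp
  then have "real n = 4 ^ (j + 2) * real (Suc i) - 2 / 3 * (4 ^ j + 2)"
    by (simp add: field_simps)
  then show "real n \<in> {4 ^ (k + 2) * real q - 2 / 3 * (4 ^ k + 2) | (k::nat) (q::nat). q \<ge> 1}"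
    by (intro CollectI exI[of _ j] exI[of _ "Suc i"]) simp
qed

text \<open>For even n the number 3 n + 7 = u^2 + v^2 + 2 w^2 is odd, so one of u, v is even, and
  its half carries the coefficient 4.\<close>

lemma p8_even:
  fixes n :: nat
  assumes "even n"
  shows "\<exists>x y z. int n = p8 x + 2 * p8 y + 4 * p8 z"
proof -
  have m: "(3 * n + 7) mod 3 = 1" "3 * n + 7 \<ge> 4" "odd (3 * n + 7)" using assms by presburger+
  obtain u v w :: int where uvw: "int (3 * n + 7) = u ^ 2 + v ^ 2 + 2 * w ^ 2"
    "\<not> 3 dvd u" "\<not> 3 dvd v" "\<not> 3 dvd w"
    using form_1_1_2_coprime_3[OF m(1,2) double_odd_not_exceptional[OF m(3)]] .
  have *: "\<exists>x y z. int n = p8 x + 2 * p8 y + 4 * p8 z"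
    if eq: "int (3 * n + 7) = u ^ 2 + v ^ 2 + 2 * w ^ 2" and u: "\<not> 3 dvd u" and v: "\<not> 3 dvd v" "even v" for u v
  proof -
    obtain t where t: "v = 2 * t" using \<open>even v\<close> by blast
    then have "\<not> 3 dvd t" using v(1) by auto
    obtain x where x: "u ^ 2 = 3 * p8 x + 1" using square_eq_p8[OF u] .
    obtain y where y: "w ^ 2 = 3 * p8 y + 1" using square_eq_p8[OF uvw(4)] .
    obtain z where z: "t ^ 2 = 3 * p8 z + 1" using square_eq_p8[OF \<open>\<not> 3 dvd t\<close>] .
    have "int n = p8 x + 2 * p8 y + 4 * p8 z"
      using eq unfolding t power_mult_distrib x y z by simp
    then show ?thesis by blast
  qed
  have "odd (u ^ 2 + v ^ 2 + 2 * w ^ 2)" unfolding uvw(1)[symmetric] using m(3) by simp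
  then have "even v \<or> even u" by auto
  then show ?thesis using *[of u v] *[of v u] uvw by (auto simp: add.commute)
qed

text \<open>The odd number 2 n + 1 is never exceptional. Exactly one of the two octagonal numbers
  with coefficient 1 is odd, so the two floors lose 1/2 in total.\<close>

lemma p8_sum_1_half_half: "\<exists>x y z. int n = p8 x + p8 y div 2 + p8 z div 2"
proof -
  have "odd (3 * (2 * n + 1) + 4)" by simp
  then have "\<exists>x y z. int (2 * n + 1) = p8 x + p8 y + 2 * p8 z"
    using p8_sum_1_1_2_iff double_odd_not_exceptional by blast
  then obtain x y z where xyz: "int (2 * n + 1) = p8 x + p8 y + 2 * p8 z" by blast
  then have "int n = p8 z + p8 x div 2 + p8 y div 2" by simp
  then show ?thesis by blast
qed

lemma p8_sum_1_1_half: "\<exists>x y z. int n = p8 x + p8 y + p8 z div 2"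
proof -
  obtain u v w :: int and r :: nat
    where r: "r < 2" and uvw: "6 * int n + 3 * int r + 5 = u ^ 2 + 2 * v ^ 2 + 2 * w ^ 2"
      "\<not> 3 dvd u" "\<not> 3 dvd v" "\<not> 3 dvd w"
    by (rule form_1_2_2_coprime_3)
  obtain z where z: "u ^ 2 = 3 * p8 z + 1" using square_eq_p8[OF uvw(2)] .
  obtain x where x: "v ^ 2 = 3 * p8 x + 1" using square_eq_p8[OF uvw(3)] .
  obtain y where y: "w ^ 2 = 3 * p8 y + 1" using square_eq_p8[OF uvw(4)] .
  have "p8 z = 2 * (int n - p8 x - p8 y) + int r" using uvw(1) unfolding x y z by simp
  then have "p8 z div 2 = int n - p8 x - p8 y" using r by simp
  then have "int n = p8 x + p8 y + p8 z div 2" by simp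
  then show ?thesis by blast
qed

lemma p8_sum_1_1_quarter: "\<exists>x y z. 4 * int n = 4 * p8 x + 4 * p8 y + p8 z"
proof -
  obtain u v w :: int where uvw: "12 * int n + 9 = u ^ 2 + 4 * v ^ 2 + 4 * w ^ 2"
    "\<not> 3 dvd u" "\<not> 3 dvd v" "\<not> 3 dvd w"
    by (rule form_1_4_4_coprime_3)
  obtain z where z: "u ^ 2 = 3 * p8 z + 1" using square_eq_p8[OF uvw(2)] .
  obtain x where x: "v ^ 2 = 3 * p8 x + 1" using square_eq_p8[OF uvw(3)] .
  obtain y where y: "w ^ 2 = 3 * p8 y + 1" using square_eq_p8[OF uvw(4)] .
  have "4 * int n = 4 * p8 x + 4 * p8 y + p8 z" using uvw(1) unfolding x y z by simp
  then show ?thesis by blast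
qed

lemma p8_sum_1_1_fifth: "\<exists>x y z. int n = p8 x + p8 y + p8 z div 5"
proof -
  obtain u v w :: int and r :: nat
    where r: "r < 5" and uvw: "15 * int n + 3 * int r + 11 = u ^ 2 + 5 * v ^ 2 + 5 * w ^ 2"
      "\<not> 3 dvd u" "\<not> 3 dvd v" "\<not> 3 dvd w"
    by (rule form_1_5_5_coprime_3)
  obtain z where z: "u ^ 2 = 3 * p8 z + 1" using square_eq_p8[OF uvw(2)] .
  obtain x where x: "v ^ 2 = 3 * p8 x + 1" using square_eq_p8[OF uvw(3)] .
  obtain y where y: "w ^ 2 = 3 * p8 y + 1" using square_eq_p8[OF uvw(4)] .
  have "p8 z = 5 * (int n - p8 x - p8 y) + int r" using uvw(1) unfolding x y z by simp
  then have "p8 z div 5 = int n - p8 x - p8 y" using r by simp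
  then have "int n = p8 x + p8 y + p8 z div 5" by simp
  then show ?thesis by blast
qed

lemma square_div_p8:
  "(3 * x - 1) ^ 2 div 3 = p8 x" "(3 * x - 1) ^ 2 div 6 = p8 x div 2" "(3 * x - 1) ^ 2 div 15 = p8 x div 5"
proof -
  show 3: "(3 * x - 1) ^ 2 div 3 = p8 x" unfolding square_pred_p8 by simp
  have "(3 * x - 1) ^ 2 div 6 = (3 * x - 1) ^ 2 div 3 div 2" "(3 * x - 1) ^ 2 div 15 = (3 * x - 1) ^ 2 div 3 div 5"
    by (simp_all add: zdiv_zmult2_eq[symmetric])
  then show "(3 * x - 1) ^ 2 div 6 = p8 x div 2" "(3 * x - 1) ^ 2 div 15 = p8 x div 5"
    unfolding 3 .
qed

text \<open>As p8(1 - 2 x) = 4 p8(x) + 1, this substitution transfers the result for halves to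
  eighths.\<close>

lemma p8_div_8: "p8 (1 - 2 * x) div 8 = p8 x div 2"
proof -
  have "p8 (1 - 2 * x) = 4 * p8 x + 1" by (simp add: p8_def algebra_simps)
  then show ?thesis by presburger
qed

theorem theorem1p5:
  shows
    "\<comment> \<open>(i)\<close>
    (\<forall>n::nat. (\<exists>x y z :: int. int n = p8 x + p8 y + 2 * p8 z) \<longleftrightarrow>
        real n \<notin> {4 ^ (k + 2) * real q - 2 / 3 * (4 ^ k + 2) | (k::nat) (q::nat). q \<ge> 1})
   \<and> (\<forall>n::nat. even n \<longrightarrow> (\<exists>x y z :: int. int n = p8 x + 2 * p8 y + 4 * p8 z))
   \<and> {p8 x + \<lfloor>real_of_int (p8 y) / 2\<rfloor> + \<lfloor>real_of_int (p8 z) / 2\<rfloor> | x y z :: int. True} = \<nat>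
   \<and> {\<lfloor>real_of_int (x ^ 2) / 3\<rfloor> + \<lfloor>real_of_int (y ^ 2) / 6\<rfloor> + \<lfloor>real_of_int (z ^ 2) / 6\<rfloor> | x y z :: int. True} = \<nat>
   \<and> \<comment> \<open>(ii)\<close>
     {p8 x + p8 y + \<lfloor>real_of_int (p8 z) / 2\<rfloor> | x y z :: int. True} = \<nat>
   \<and> {p8 x + p8 y + \<lfloor>real_of_int (p8 z) / 8\<rfloor> | x y z :: int. True} = \<nat>
   \<and> {\<lfloor>real_of_int (x ^ 2) / 3\<rfloor> + \<lfloor>real_of_int (y ^ 2) / 3\<rfloor> + \<lfloor>real_of_int (z ^ 2) / 6\<rfloor> | x y z :: int. True} = \<nat>
   \<and> \<comment> \<open>(iii)\<close>
     (\<forall>n::nat. \<exists>x y z :: int.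
        real n = real_of_int (p8 x) + real_of_int (p8 y) + real_of_int (p8 z) / 4)
   \<and> \<comment> \<open>(iv)\<close>
     {p8 x + p8 y + \<lfloor>real_of_int (p8 z) / 5\<rfloor> | x y z :: int. True} = \<nat>
   \<and> {\<lfloor>real_of_int (x ^ 2) / 3\<rfloor> + \<lfloor>real_of_int (y ^ 2) / 3\<rfloor> + \<lfloor>real_of_int (z ^ 2) / 15\<rfloor> | x y z :: int. True} = \<nat>"
proof (intro conjI)
  show "\<forall>n::nat. (\<exists>x y z :: int. int n = p8 x + p8 y + 2 * p8 z) \<longleftrightarrow>
      real n \<notin> {4 ^ (k + 2) * real q - 2 / 3 * (4 ^ k + 2) | (k::nat) (q::nat). q \<ge> 1}"
    unfolding p8_sum_1_1_2_iff exceptional_set_iff by blast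
  show "\<forall>n::nat. even n \<longrightarrow> (\<exists>x y z :: int. int n = p8 x + 2 * p8 y + 4 * p8 z)"
    using p8_even by blast
  show "{p8 x + \<lfloor>real_of_int (p8 y) / 2\<rfloor> + \<lfloor>real_of_int (p8 z) / 2\<rfloor> | x y z :: int. True} = \<nat>"
    unfolding floor_numeral_divide
    by (rule range_eq_Nats) (simp_all add: p8_nonneg pos_imp_zdiv_nonneg_iff p8_sum_1_half_half)
  show "{\<lfloor>real_of_int (x ^ 2) / 3\<rfloor> + \<lfloor>real_of_int (y ^ 2) / 6\<rfloor> + \<lfloor>real_of_int (z ^ 2) / 6\<rfloor> | x y z :: int. True} = \<nat>"
    unfolding floor_numeral_divide
  proof (rule range_eq_Nats)
    fix n
    obtain x y z where "int n = p8 x + p8 y div 2 + p8 z div 2" using p8_sum_1_half_half by blast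
    then have "int n = (3 * x - 1) ^ 2 div 3 + (3 * y - 1) ^ 2 div 6 + (3 * z - 1) ^ 2 div 6"
      by (simp only: square_div_p8)
    then show "\<exists>x y z. int n = x ^ 2 div 3 + y ^ 2 div 6 + z ^ 2 div 6" by blast
  qed (simp add: pos_imp_zdiv_nonneg_iff)
  show "{p8 x + p8 y + \<lfloor>real_of_int (p8 z) / 2\<rfloor> | x y z :: int. True} = \<nat>"
    unfolding floor_numeral_divide
    by (rule range_eq_Nats) (simp_all add: p8_nonneg pos_imp_zdiv_nonneg_iff p8_sum_1_1_half)
  show "{p8 x + p8 y + \<lfloor>real_of_int (p8 z) / 8\<rfloor> | x y z :: int. True} = \<nat>"
    unfolding floor_numeral_divide
  proof (rule range_eq_Nats)
    fix n
    show "\<exists>x y z. int n = p8 x + p8 y + p8 z div 8"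
      using p8_sum_1_1_half[of n] unfolding p8_div_8[symmetric] by blast
  qed (simp add: p8_nonneg pos_imp_zdiv_nonneg_iff)
  show "{\<lfloor>real_of_int (x ^ 2) / 3\<rfloor> + \<lfloor>real_of_int (y ^ 2) / 3\<rfloor> + \<lfloor>real_of_int (z ^ 2) / 6\<rfloor> | x y z :: int. True} = \<nat>"
    unfolding floor_numeral_divide
  proof (rule range_eq_Nats)
    fix n
    obtain x y z where "int n = p8 x + p8 y + p8 z div 2" using p8_sum_1_1_half by blast
    then have "int n = (3 * x - 1) ^ 2 div 3 + (3 * y - 1) ^ 2 div 3 + (3 * z - 1) ^ 2 div 6"
      by (simp only: square_div_p8)
    then show "\<exists>x y z. int n = x ^ 2 div 3 + y ^ 2 div 3 + z ^ 2 div 6" by blast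
  qed (simp add: pos_imp_zdiv_nonneg_iff)
  show "\<forall>n::nat. \<exists>x y z :: int.
      real n = real_of_int (p8 x) + real_of_int (p8 y) + real_of_int (p8 z) / 4"
  proof
    fix n :: nat
    obtain x y z where "4 * int n = 4 * p8 x + 4 * p8 y + p8 z" using p8_sum_1_1_quarter by blast
    then have "real_of_int (4 * int n) = real_of_int (4 * p8 x + 4 * p8 y + p8 z)" by (simp only:)
    then have "real n = real_of_int (p8 x) + real_of_int (p8 y) + real_of_int (p8 z) / 4" by simp
    then show "\<exists>x y z. real n = real_of_int (p8 x) + real_of_int (p8 y) + real_of_int (p8 z) / 4" by blast
  qed
  show "{p8 x + p8 y + \<lfloor>real_of_int (p8 z) / 5\<rfloor> | x y z :: int. True} = \<nat>"
    unfolding floor_numeral_divide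
    by (rule range_eq_Nats) (simp_all add: p8_nonneg pos_imp_zdiv_nonneg_iff p8_sum_1_1_fifth)
  show "{\<lfloor>real_of_int (x ^ 2) / 3\<rfloor> + \<lfloor>real_of_int (y ^ 2) / 3\<rfloor> + \<lfloor>real_of_int (z ^ 2) / 15\<rfloor> | x y z :: int. True} = \<nat>"
    unfolding floor_numeral_divide
  proof (rule range_eq_Nats)
    fix n
    obtain x y z where "int n = p8 x + p8 y + p8 z div 5" using p8_sum_1_1_fifth by blast
    then have "int n = (3 * x - 1) ^ 2 div 3 + (3 * y - 1) ^ 2 div 3 + (3 * z - 1) ^ 2 div 15"
      by (simp only: square_div_p8)
    then show "\<exists>x y z. int n = x ^ 2 div 3 + y ^ 2 div 3 + z ^ 2 div 15" by blast
  qed (simp add: pos_imp_zdiv_nonneg_iff)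
qed

end
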